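(* Let $H$ and $K$ be unbraided Hopf algebras in $\mathcal B$ whose antipodes are automorphisms in $\mathcal B$, and suppose that $H$ and $K$ satisfy both chain conditions. Let $$\mathcal A=\begin{pmatrix}\operatorname{Aut}(H)&\operatorname{Hom}^c(K,H)\\ \operatorname{Hom}^c(H,K)&\operatorname{Aut}(K)\end{pmatrix}.$$ Then $\mathcal A\subseteq\operatorname{Aut}(H\otimes K)$ if and only if $H$ and $K$ have no non-trivial common abelian direct tensor factors. On the other hand, $\operatorname{Aut}(H\otimes K)=\mathcal A$ if and only if $H$ and $K$ have no non-trivial common direct tensor factors.
   Context: $\mathcal B$ is an abelian category that is a (strict) braided tensor category with unit object $I$, braiding $\tau$, and exact tensor products. Algebras, coalgebras, Hopf algebras are taken in $\mathcal B$, with structure maps $\nabla,\eta,\Delta,\epsilon,S$; $\operatorname{Hom}$, $\operatorname{End}$, $\operatorname{Aut}$ refer to Hopf algebra morphisms. Objects $V,W$ are unbraided if $\tau_{VW}=\tau_{WV}^{-1}$; the tensor product of two unbraided Hopf algebras is a Hopf algebra. A Hopf algebra is abelian if it is both commutative and cocommutative. A Hopf algebra satisfies both chain conditions if it satisfies the descending chain condition on Hopf subalgebras and the descending chain condition on quotient Hopf algebras (every sequence of quotient Hopf algebras $H\to Q_1\to Q_2\to\cdots$, each a quotient of the previous one, stabilizes). If $H\cong A\otimes B$ for Hopf algebras $A,B$, then $A$ is a (direct) tensor factor of $H$; it is trivial if $A\cong I$. A common tensor factor of $H$ and $K$ is a Hopf algebra that is (up to isomorphism) a tensor factor of both. For morphisms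 $f\colon V\to A$, $g\colon W\to A$ to an algebra, $f\curlyvee g$ means $\nabla(g\otimes f)=\nabla(f\otimes g)\tau_{W,V}$. For morphisms $f\colon C\to V$, $g\colon C\to W$ from a coalgebra, $f\curlywedge g$ means $(g\otimes f)\Delta=\tau_{V,W}(f\otimes g)\Delta$. Endomorphisms in $\operatorname{End}(H\otimes K)$ are identified with matrices $\begin{pmatrix}a&b\\c&d\end{pmatrix}$ with $a\in\operatorname{End}(H)$, $b\in\operatorname{Hom}(K,H)$, $c\in\operatorname{Hom}(H,K)$, $d\in\operatorname{End}(K)$ satisfying $a\curlyvee b$, $c\curlyvee d$, $a\curlywedge c$, $b\curlywedge d$; the matrix corresponds to the endomorphism $(\nabla_H\otimes\nabla_K)(a\otimes b\otimes c\otimes d)(H\otimes\tau_{H,K}\otimes K)(\Delta_H\otimes\Delta_K)$. $\operatorname{Hom}^c(K,H):=\{b\in\operatorname{Hom}(K,H)\mid b\curlyvee\operatorname{id}_H\text{ and }b\curlywedge\operatorname{id}_K\}$, and likewise $\operatorname{Hom}^c(H,K)=\{c\in\operatorname{Hom}(H,K)\mid c\curlyvee\operatorname{id}_K\text{ and }c\curlywedge\operatorname{id}_H\}$. The set $\mathcal A$ consists of all matrices with entries in the indicated sets. *)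

theory Defs
  imports "HOL-Algebra.Group"
begin

text \<open>The symbol \<open>\<otimes>\<close> is used below for the tensor product of morphisms.\<close>

no_notation monoid.mult (infixl \<open>\<otimes>\<index>\<close> 70)

text \<open>
  Morphisms know their domain and codomain. All operations are only meaningful for objects in
  \<open>Obj C\<close> and (composable, respectively parallel) morphisms in \<open>Arr C\<close>;
  their values elsewhere are never constrained.
\<close>

record ('o, 'm) cat =
  Obj :: "'o set"
  Arr :: "'m set"
  Dom :: "'m \<Rightarrow> 'o"
  Cod :: "'m \<Rightarrow> 'o"
  Idn :: "'o \<Rightarrow> 'm"
  Cmp :: "'m \<Rightarrow> 'm \<Rightarrow> 'm" (infixr \<open>\<cdot>\<index>\<close> 65)

definition Mor :: "('o, 'm, 'z) cat_scheme \<Rightarrow> 'o \<Rightarrow> 'o \<Rightarrow> 'm set" where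
  "Mor C A B = {f \<in> Arr C. Dom C f = A \<and> Cod C f = B}"

locale category =
  fixes C (structure)
  assumes Dom_Obj: "f \<in> Arr C \<Longrightarrow> Dom C f \<in> Obj C"
    and Cod_Obj: "f \<in> Arr C \<Longrightarrow> Cod C f \<in> Obj C"
    and Idn_Mor: "A \<in> Obj C \<Longrightarrow> Idn C A \<in> Mor C A A"
    and Cmp_Mor: "f \<in> Mor C A B \<Longrightarrow> g \<in> Mor C B D \<Longrightarrow> g \<cdot> f \<in> Mor C A D"
    and Idn_left: "f \<in> Mor C A B \<Longrightarrow> Idn C B \<cdot> f = f"
    and Idn_right: "f \<in> Mor C A B \<Longrightarrow> f \<cdot> Idn C A = f"
    and Cmp_assoc: "f \<in> Mor C A B \<Longrightarrow> g \<in> Mor C B D \<Longrightarrow> h \<in> Mor C D E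
      \<Longrightarrow> (h \<cdot> g) \<cdot> f = h \<cdot> (g \<cdot> f)"

definition is_mono :: "('o, 'm, 'z) cat_scheme \<Rightarrow> 'm \<Rightarrow> bool" where
  "is_mono C f \<longleftrightarrow> f \<in> Arr C \<and>
    (\<forall>X. \<forall>g \<in> Mor C X (Dom C f). \<forall>h \<in> Mor C X (Dom C f).
       f \<cdot>\<^bsub>C\<^esub> g = f \<cdot>\<^bsub>C\<^esub> h \<longrightarrow> g = h)"

definition is_epi :: "('o, 'm, 'z) cat_scheme \<Rightarrow> 'm \<Rightarrow> bool" where
  "is_epi C f \<longleftrightarrow> f \<in> Arr C \<and>
    (\<forall>X. \<forall>g \<in> Mor C (Cod C f) X. \<forall>h \<in> Mor C (Cod C f) X.
       g \<cdot>\<^bsub>C\<^esub> f = h \<cdot>\<^bsub>C\<^esub> f \<longrightarrow> g = h)"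

definition mutually_inverse :: "('o, 'm, 'z) cat_scheme \<Rightarrow> 'm \<Rightarrow> 'm \<Rightarrow> bool" where
  "mutually_inverse C f g \<longleftrightarrow> f \<in> Arr C \<and> g \<in> Mor C (Cod C f) (Dom C f) \<and>
     g \<cdot>\<^bsub>C\<^esub> f = Idn C (Dom C f) \<and> f \<cdot>\<^bsub>C\<^esub> g = Idn C (Cod C f)"

definition is_isomorphism :: "('o, 'm, 'z) cat_scheme \<Rightarrow> 'm \<Rightarrow> bool" where
  "is_isomorphism C f \<longleftrightarrow> (\<exists>g. mutually_inverse C f g)"

text \<open>\<open>Add\<close> adds parallel morphisms, \<open>Zro C A B\<close> is the zero morphism from \<open>A\<close> to \<open>B\<close>.\<close>

record ('o, 'm) add_cat = "('o, 'm) cat" +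
  Add :: "'m \<Rightarrow> 'm \<Rightarrow> 'm" (infixl \<open>\<oplus>\<index>\<close> 63)
  Zro :: "'o \<Rightarrow> 'o \<Rightarrow> 'm"

definition Mor_group :: "('o, 'm, 'z) add_cat_scheme \<Rightarrow> 'o \<Rightarrow> 'o \<Rightarrow> 'm monoid" where
  "Mor_group C A B = \<lparr>carrier = Mor C A B, monoid.mult = Add C, one = Zro C A B\<rparr>"

definition is_kernel :: "('o, 'm, 'z) add_cat_scheme \<Rightarrow> 'm \<Rightarrow> 'm \<Rightarrow> bool" where
  "is_kernel C k f \<longleftrightarrow> f \<in> Arr C \<and> k \<in> Arr C \<and> Cod C k = Dom C f \<and>
     f \<cdot>\<^bsub>C\<^esub> k = Zro C (Dom C k) (Cod C f) \<and>
     (\<forall>X. \<forall>g \<in> Mor C X (Dom C f). f \<cdot>\<^bsub>C\<^esub> g = Zro C X (Cod C f) \<longrightarrow>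
        (\<exists>!u. u \<in> Mor C X (Dom C k) \<and> k \<cdot>\<^bsub>C\<^esub> u = g))"

definition is_cokernel :: "('o, 'm, 'z) add_cat_scheme \<Rightarrow> 'm \<Rightarrow> 'm \<Rightarrow> bool" where
  "is_cokernel C q f \<longleftrightarrow> f \<in> Arr C \<and> q \<in> Arr C \<and> Dom C q = Cod C f \<and>
     q \<cdot>\<^bsub>C\<^esub> f = Zro C (Dom C f) (Cod C q) \<and>
     (\<forall>X. \<forall>g \<in> Mor C (Cod C f) X. g \<cdot>\<^bsub>C\<^esub> f = Zro C (Dom C f) X \<longrightarrow>
        (\<exists>!u. u \<in> Mor C (Cod C q) X \<and> u \<cdot>\<^bsub>C\<^esub> q = g))"

definition short_exact :: "('o, 'm, 'z) add_cat_scheme \<Rightarrow> 'm \<Rightarrow> 'm \<Rightarrow> bool" where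
  "short_exact C f g \<longleftrightarrow> is_kernel C f g \<and> is_cokernel C g f"

locale abelian_category = category +
  assumes Mor_comm_group: "A \<in> Obj C \<Longrightarrow> B \<in> Obj C \<Longrightarrow> comm_group (Mor_group C A B)"
    and Cmp_Add_left: "f \<in> Mor C A B \<Longrightarrow> g \<in> Mor C B D \<Longrightarrow> h \<in> Mor C B D
      \<Longrightarrow> (g \<oplus> h) \<cdot> f = (g \<cdot> f) \<oplus> (h \<cdot> f)"
    and Cmp_Add_right: "f \<in> Mor C A B \<Longrightarrow> g \<in> Mor C A B \<Longrightarrow> h \<in> Mor C B D
      \<Longrightarrow> h \<cdot> (f \<oplus> g) = (h \<cdot> f) \<oplus> (h \<cdot> g)"
    and zero_object: "\<exists>Z \<in> Obj C. \<forall>A \<in> Obj C. (\<exists>!f. f \<in> Mor C A Z) \<and> (\<exists>!f. f \<in> Mor C Z A)"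
    and biproducts: "A \<in> Obj C \<Longrightarrow> B \<in> Obj C \<Longrightarrow>
      \<exists>P \<in> Obj C. \<exists>i \<in> Mor C A P. \<exists>j \<in> Mor C B P. \<exists>p \<in> Mor C P A. \<exists>q \<in> Mor C P B.
        p \<cdot> i = Idn C A \<and> q \<cdot> j = Idn C B \<and> (i \<cdot> p) \<oplus> (j \<cdot> q) = Idn C P"
    and kernels: "f \<in> Arr C \<Longrightarrow> \<exists>k. is_kernel C k f"
    and cokernels: "f \<in> Arr C \<Longrightarrow> \<exists>q. is_cokernel C q f"
    and mono_normal: "is_mono C k \<Longrightarrow> \<exists>f. is_kernel C k f"
    and epi_normal: "is_epi C q \<Longrightarrow> \<exists>f. is_cokernel C q f"

record ('o, 'm) braided_cat = "('o, 'm) add_cat" +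
  TenO :: "'o \<Rightarrow> 'o \<Rightarrow> 'o" (infixr \<open>\<odot>\<index>\<close> 70)
  Ten :: "'m \<Rightarrow> 'm \<Rightarrow> 'm" (infixr \<open>\<otimes>\<index>\<close> 70)
  Unit :: "'o"
  Brd :: "'o \<Rightarrow> 'o \<Rightarrow> 'm" (\<open>\<tau>\<index>\<close>)

text \<open>
  \<open>A \<odot> B\<close> is the tensor product of objects, \<open>f \<otimes> g\<close> that of morphisms, and
  \<open>\<tau> A B\<close> the braiding from \<open>A \<odot> B\<close> to \<open>B \<odot> A\<close>. Associativity and unit
  constraints are identities, so that they appear as equations between objects and morphisms.
  An exact functor is, as usual, an additive functor preserving short exact sequences.
\<close>

locale strict_tensor_category = category C for C :: "('o, 'm, 'z) braided_cat_scheme" (structure) +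
  assumes TenO_Obj: "A \<in> Obj C \<Longrightarrow> B \<in> Obj C \<Longrightarrow> A \<odot> B \<in> Obj C"
    and Unit_Obj: "Unit C \<in> Obj C"
    and Ten_Mor: "f \<in> Mor C A B \<Longrightarrow> g \<in> Mor C A' B' \<Longrightarrow> f \<otimes> g \<in> Mor C (A \<odot> A') (B \<odot> B')"
    and Ten_Idn: "A \<in> Obj C \<Longrightarrow> B \<in> Obj C \<Longrightarrow> Idn C A \<otimes> Idn C B = Idn C (A \<odot> B)"
    and Ten_Cmp: "f \<in> Mor C A B \<Longrightarrow> g \<in> Mor C B D \<Longrightarrow> f' \<in> Mor C A' B' \<Longrightarrow> g' \<in> Mor C B' D'
      \<Longrightarrow> (g \<cdot> f) \<otimes> (g' \<cdot> f') = (g \<otimes> g') \<cdot> (f \<otimes> f')"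
    and TenO_assoc: "A \<in> Obj C \<Longrightarrow> B \<in> Obj C \<Longrightarrow> D \<in> Obj C \<Longrightarrow> (A \<odot> B) \<odot> D = A \<odot> (B \<odot> D)"
    and TenO_Unit_left: "A \<in> Obj C \<Longrightarrow> Unit C \<odot> A = A"
    and TenO_Unit_right: "A \<in> Obj C \<Longrightarrow> A \<odot> Unit C = A"
    and Ten_assoc: "f \<in> Arr C \<Longrightarrow> g \<in> Arr C \<Longrightarrow> h \<in> Arr C \<Longrightarrow> (f \<otimes> g) \<otimes> h = f \<otimes> (g \<otimes> h)"
    and Ten_Unit_left: "f \<in> Arr C \<Longrightarrow> Idn C (Unit C) \<otimes> f = f"
    and Ten_Unit_right: "f \<in> Arr C \<Longrightarrow> f \<otimes> Idn C (Unit C) = f"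

locale strict_braided_category = strict_tensor_category +
  assumes Brd_Mor: "A \<in> Obj C \<Longrightarrow> B \<in> Obj C \<Longrightarrow> \<tau> A B \<in> Mor C (A \<odot> B) (B \<odot> A)"
    and Brd_isomorphism: "A \<in> Obj C \<Longrightarrow> B \<in> Obj C \<Longrightarrow> is_isomorphism C (\<tau> A B)"
    and Brd_natural: "f \<in> Mor C A B \<Longrightarrow> g \<in> Mor C A' B'
      \<Longrightarrow> \<tau> B B' \<cdot> (f \<otimes> g) = (g \<otimes> f) \<cdot> \<tau> A A'"
    and hexagon_left: "A \<in> Obj C \<Longrightarrow> B \<in> Obj C \<Longrightarrow> D \<in> Obj C
      \<Longrightarrow> \<tau> (A \<odot> B) D = (\<tau> A D \<otimes> Idn C B) \<cdot> (Idn C A \<otimes> \<tau> B D)"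
    and hexagon_right: "A \<in> Obj C \<Longrightarrow> B \<in> Obj C \<Longrightarrow> D \<in> Obj C
      \<Longrightarrow> \<tau> A (B \<odot> D) = (Idn C B \<otimes> \<tau> A D) \<cdot> (\<tau> A B \<otimes> Idn C D)"

locale abelian_braided_category = abelian_category C + strict_braided_category C
  for C :: "('o, 'm, 'z) braided_cat_scheme" (structure) +
  assumes Ten_additive_left: "f \<in> Mor C A B \<Longrightarrow> g \<in> Mor C A B \<Longrightarrow> X \<in> Obj C
      \<Longrightarrow> (f \<oplus> g) \<otimes> Idn C X = (f \<otimes> Idn C X) \<oplus> (g \<otimes> Idn C X)"
    and Ten_additive_right: "f \<in> Mor C A B \<Longrightarrow> g \<in> Mor C A B \<Longrightarrow> X \<in> Obj C
      \<Longrightarrow> Idn C X \<otimes> (f \<oplus> g) = (Idn C X \<otimes> f) \<oplus> (Idn C X \<otimes> g)"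
    and Ten_exact_left: "short_exact C f g \<Longrightarrow> X \<in> Obj C
      \<Longrightarrow> short_exact C (f \<otimes> Idn C X) (g \<otimes> Idn C X)"
    and Ten_exact_right: "short_exact C f g \<Longrightarrow> X \<in> Obj C
      \<Longrightarrow> short_exact C (Idn C X \<otimes> f) (Idn C X \<otimes> g)"

definition unbraided :: "('o, 'm, 'z) braided_cat_scheme \<Rightarrow> 'o \<Rightarrow> 'o \<Rightarrow> bool" where
  "unbraided C V W \<longleftrightarrow> mutually_inverse C (\<tau>\<^bsub>C\<^esub> V W) (\<tau>\<^bsub>C\<^esub> W V)"

record ('o, 'm) hopf =
  Car :: "'o"
  Mul :: "'m" (\<open>\<nabla>\<index>\<close>)
  Unt :: "'m" (\<open>\<eta>\<index>\<close>)
  Com :: "'m" (\<open>\<Delta>\<index>\<close>)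
  Cou :: "'m" (\<open>\<epsilon>\<index>\<close>)
  Ant :: "'m"

definition is_algebra :: "('o, 'm, 'z) braided_cat_scheme \<Rightarrow> ('o, 'm) hopf \<Rightarrow> bool" where
  "is_algebra C H \<longleftrightarrow> Car H \<in> Obj C \<and>
     \<nabla>\<^bsub>H\<^esub> \<in> Mor C (Car H \<odot>\<^bsub>C\<^esub> Car H) (Car H) \<and> \<eta>\<^bsub>H\<^esub> \<in> Mor C (Unit C) (Car H) \<and>
     \<nabla>\<^bsub>H\<^esub> \<cdot>\<^bsub>C\<^esub> (\<nabla>\<^bsub>H\<^esub> \<otimes>\<^bsub>C\<^esub> Idn C (Car H)) = \<nabla>\<^bsub>H\<^esub> \<cdot>\<^bsub>C\<^esub> (Idn C (Car H) \<otimes>\<^bsub>C\<^esub> \<nabla>\<^bsub>H\<^esub>) \<and>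
     \<nabla>\<^bsub>H\<^esub> \<cdot>\<^bsub>C\<^esub> (\<eta>\<^bsub>H\<^esub> \<otimes>\<^bsub>C\<^esub> Idn C (Car H)) = Idn C (Car H) \<and>
     \<nabla>\<^bsub>H\<^esub> \<cdot>\<^bsub>C\<^esub> (Idn C (Car H) \<otimes>\<^bsub>C\<^esub> \<eta>\<^bsub>H\<^esub>) = Idn C (Car H)"

definition is_coalgebra :: "('o, 'm, 'z) braided_cat_scheme \<Rightarrow> ('o, 'm) hopf \<Rightarrow> bool" where
  "is_coalgebra C H \<longleftrightarrow> Car H \<in> Obj C \<and>
     \<Delta>\<^bsub>H\<^esub> \<in> Mor C (Car H) (Car H \<odot>\<^bsub>C\<^esub> Car H) \<and> \<epsilon>\<^bsub>H\<^esub> \<in> Mor C (Car H) (Unit C) \<and>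
     (\<Delta>\<^bsub>H\<^esub> \<otimes>\<^bsub>C\<^esub> Idn C (Car H)) \<cdot>\<^bsub>C\<^esub> \<Delta>\<^bsub>H\<^esub> = (Idn C (Car H) \<otimes>\<^bsub>C\<^esub> \<Delta>\<^bsub>H\<^esub>) \<cdot>\<^bsub>C\<^esub> \<Delta>\<^bsub>H\<^esub> \<and>
     (\<epsilon>\<^bsub>H\<^esub> \<otimes>\<^bsub>C\<^esub> Idn C (Car H)) \<cdot>\<^bsub>C\<^esub> \<Delta>\<^bsub>H\<^esub> = Idn C (Car H) \<and>
     (Idn C (Car H) \<otimes>\<^bsub>C\<^esub> \<epsilon>\<^bsub>H\<^esub>) \<cdot>\<^bsub>C\<^esub> \<Delta>\<^bsub>H\<^esub> = Idn C (Car H)"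

definition is_bialgebra :: "('o, 'm, 'z) braided_cat_scheme \<Rightarrow> ('o, 'm) hopf \<Rightarrow> bool" where
  "is_bialgebra C H \<longleftrightarrow> is_algebra C H \<and> is_coalgebra C H \<and>
     \<Delta>\<^bsub>H\<^esub> \<cdot>\<^bsub>C\<^esub> \<nabla>\<^bsub>H\<^esub> =
       (\<nabla>\<^bsub>H\<^esub> \<otimes>\<^bsub>C\<^esub> \<nabla>\<^bsub>H\<^esub>) \<cdot>\<^bsub>C\<^esub>
       (Idn C (Car H) \<otimes>\<^bsub>C\<^esub> \<tau>\<^bsub>C\<^esub> (Car H) (Car H) \<otimes>\<^bsub>C\<^esub> Idn C (Car H)) \<cdot>\<^bsub>C\<^esub>
       (\<Delta>\<^bsub>H\<^esub> \<otimes>\<^bsub>C\<^esub> \<Delta>\<^bsub>H\<^esub>) \<and>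
     \<Delta>\<^bsub>H\<^esub> \<cdot>\<^bsub>C\<^esub> \<eta>\<^bsub>H\<^esub> = \<eta>\<^bsub>H\<^esub> \<otimes>\<^bsub>C\<^esub> \<eta>\<^bsub>H\<^esub> \<and>
     \<epsilon>\<^bsub>H\<^esub> \<cdot>\<^bsub>C\<^esub> \<nabla>\<^bsub>H\<^esub> = \<epsilon>\<^bsub>H\<^esub> \<otimes>\<^bsub>C\<^esub> \<epsilon>\<^bsub>H\<^esub> \<and>
     \<epsilon>\<^bsub>H\<^esub> \<cdot>\<^bsub>C\<^esub> \<eta>\<^bsub>H\<^esub> = Idn C (Unit C)"

definition is_hopf_algebra :: "('o, 'm, 'z) braided_cat_scheme \<Rightarrow> ('o, 'm) hopf \<Rightarrow> bool" where
  "is_hopf_algebra C H \<longleftrightarrow> is_bialgebra C H \<and> Ant H \<in> Mor C (Car H) (Car H) \<and>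
     \<nabla>\<^bsub>H\<^esub> \<cdot>\<^bsub>C\<^esub> (Ant H \<otimes>\<^bsub>C\<^esub> Idn C (Car H)) \<cdot>\<^bsub>C\<^esub> \<Delta>\<^bsub>H\<^esub> = \<eta>\<^bsub>H\<^esub> \<cdot>\<^bsub>C\<^esub> \<epsilon>\<^bsub>H\<^esub> \<and>
     \<nabla>\<^bsub>H\<^esub> \<cdot>\<^bsub>C\<^esub> (Idn C (Car H) \<otimes>\<^bsub>C\<^esub> Ant H) \<cdot>\<^bsub>C\<^esub> \<Delta>\<^bsub>H\<^esub> = \<eta>\<^bsub>H\<^esub> \<cdot>\<^bsub>C\<^esub> \<epsilon>\<^bsub>H\<^esub>"

text \<open>
  Morphisms of Hopf algebras are morphisms of the underlying algebras and coalgebras; these are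
  automatically compatible with the antipodes.
\<close>

definition hopf_Hom ::
  "('o, 'm, 'z) braided_cat_scheme \<Rightarrow> ('o, 'm) hopf \<Rightarrow> ('o, 'm) hopf \<Rightarrow> 'm set" where
  "hopf_Hom C H K = {f \<in> Mor C (Car H) (Car K).
     f \<cdot>\<^bsub>C\<^esub> \<nabla>\<^bsub>H\<^esub> = \<nabla>\<^bsub>K\<^esub> \<cdot>\<^bsub>C\<^esub> (f \<otimes>\<^bsub>C\<^esub> f) \<and> f \<cdot>\<^bsub>C\<^esub> \<eta>\<^bsub>H\<^esub> = \<eta>\<^bsub>K\<^esub> \<and>
     \<Delta>\<^bsub>K\<^esub> \<cdot>\<^bsub>C\<^esub> f = (f \<otimes>\<^bsub>C\<^esub> f) \<cdot>\<^bsub>C\<^esub> \<Delta>\<^bsub>H\<^esub> \<and> \<epsilon>\<^bsub>K\<^esub> \<cdot>\<^bsub>C\<^esub> f = \<epsilon>\<^bsub>H\<^esub>}"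

definition hopf_Iso ::
  "('o, 'm, 'z) braided_cat_scheme \<Rightarrow> ('o, 'm) hopf \<Rightarrow> ('o, 'm) hopf \<Rightarrow> 'm set" where
  "hopf_Iso C H K = {f \<in> hopf_Hom C H K. \<exists>g \<in> hopf_Hom C K H. mutually_inverse C f g}"

definition hopf_Aut :: "('o, 'm, 'z) braided_cat_scheme \<Rightarrow> ('o, 'm) hopf \<Rightarrow> 'm set" where
  "hopf_Aut C H = hopf_Iso C H H"

definition hopf_isomorphic ::
  "('o, 'm, 'z) braided_cat_scheme \<Rightarrow> ('o, 'm) hopf \<Rightarrow> ('o, 'm) hopf \<Rightarrow> bool" where
  "hopf_isomorphic C H K \<longleftrightarrow> hopf_Iso C H K \<noteq> {}"

definition unit_hopf :: "('o, 'm, 'z) braided_cat_scheme \<Rightarrow> ('o, 'm) hopf" where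
  "unit_hopf C = \<lparr>Car = Unit C, Mul = Idn C (Unit C), Unt = Idn C (Unit C),
     Com = Idn C (Unit C), Cou = Idn C (Unit C), Ant = Idn C (Unit C)\<rparr>"

text \<open>This is a Hopf algebra if the carriers of \<open>H\<close> and \<open>K\<close> are unbraided.\<close>

definition tensor_hopf ::
  "('o, 'm, 'z) braided_cat_scheme \<Rightarrow> ('o, 'm) hopf \<Rightarrow> ('o, 'm) hopf \<Rightarrow> ('o, 'm) hopf" where
  "tensor_hopf C H K = \<lparr>
     Car = Car H \<odot>\<^bsub>C\<^esub> Car K,
     Mul = (\<nabla>\<^bsub>H\<^esub> \<otimes>\<^bsub>C\<^esub> \<nabla>\<^bsub>K\<^esub>) \<cdot>\<^bsub>C\<^esub> (Idn C (Car H) \<otimes>\<^bsub>C\<^esub> \<tau>\<^bsub>C\<^esub> (Car K) (Car H) \<otimes>\<^bsub>C\<^esub> Idn C (Car K)),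
     Unt = \<eta>\<^bsub>H\<^esub> \<otimes>\<^bsub>C\<^esub> \<eta>\<^bsub>K\<^esub>,
     Com = (Idn C (Car H) \<otimes>\<^bsub>C\<^esub> \<tau>\<^bsub>C\<^esub> (Car H) (Car K) \<otimes>\<^bsub>C\<^esub> Idn C (Car K)) \<cdot>\<^bsub>C\<^esub> (\<Delta>\<^bsub>H\<^esub> \<otimes>\<^bsub>C\<^esub> \<Delta>\<^bsub>K\<^esub>),
     Cou = \<epsilon>\<^bsub>H\<^esub> \<otimes>\<^bsub>C\<^esub> \<epsilon>\<^bsub>K\<^esub>,
     Ant = Ant H \<otimes>\<^bsub>C\<^esub> Ant K\<rparr>"

definition abelian_hopf :: "('o, 'm, 'z) braided_cat_scheme \<Rightarrow> ('o, 'm) hopf \<Rightarrow> bool" where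
  "abelian_hopf C H \<longleftrightarrow> \<nabla>\<^bsub>H\<^esub> \<cdot>\<^bsub>C\<^esub> \<tau>\<^bsub>C\<^esub> (Car H) (Car H) = \<nabla>\<^bsub>H\<^esub> \<and>
     \<tau>\<^bsub>C\<^esub> (Car H) (Car H) \<cdot>\<^bsub>C\<^esub> \<Delta>\<^bsub>H\<^esub> = \<Delta>\<^bsub>H\<^esub>"

definition trivial_hopf :: "('o, 'm, 'z) braided_cat_scheme \<Rightarrow> ('o, 'm) hopf \<Rightarrow> bool" where
  "trivial_hopf C A \<longleftrightarrow> hopf_isomorphic C A (unit_hopf C)"

text \<open>
  \<open>A\<close> is a tensor factor of \<open>H\<close>, up to isomorphism. The condition that \<open>A\<close> and \<open>B\<close> be
  unbraided is what makes \<open>A \<otimes> B\<close> a Hopf algebra.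
\<close>

definition tensor_factor ::
  "('o, 'm, 'z) braided_cat_scheme \<Rightarrow> ('o, 'm) hopf \<Rightarrow> ('o, 'm) hopf \<Rightarrow> bool" where
  "tensor_factor C A H \<longleftrightarrow> is_hopf_algebra C A \<and>
     (\<exists>B. is_hopf_algebra C B \<and> unbraided C (Car A) (Car B) \<and>
          hopf_isomorphic C H (tensor_hopf C A B))"

definition common_tensor_factor ::
  "('o, 'm, 'z) braided_cat_scheme \<Rightarrow> ('o, 'm) hopf \<Rightarrow> ('o, 'm) hopf \<Rightarrow> ('o, 'm) hopf \<Rightarrow> bool" where
  "common_tensor_factor C A H K \<longleftrightarrow> tensor_factor C A H \<and> tensor_factor C A K"

definition hopf_subalgebra ::
  "('o, 'm, 'z) braided_cat_scheme \<Rightarrow> ('o, 'm) hopf \<Rightarrow> 'm \<Rightarrow> ('o, 'm) hopf \<Rightarrow> bool" where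
  "hopf_subalgebra C A i H \<longleftrightarrow> is_hopf_algebra C A \<and> i \<in> hopf_Hom C A H \<and> is_mono C i"

definition hopf_quotient ::
  "('o, 'm, 'z) braided_cat_scheme \<Rightarrow> ('o, 'm) hopf \<Rightarrow> 'm \<Rightarrow> ('o, 'm) hopf \<Rightarrow> bool" where
  "hopf_quotient C H p Q \<longleftrightarrow> is_hopf_algebra C Q \<and> p \<in> hopf_Hom C H Q \<and> is_epi C p"

text \<open>
  Chains \<open>\<dots> \<rightarrow> A 2 \<rightarrow> A 1 \<rightarrow> A 0 = H\<close> of Hopf subalgebras, respectively
  \<open>H = Q 0 \<rightarrow> Q 1 \<rightarrow> Q 2 \<rightarrow> \<dots>\<close> of quotient Hopf algebras. Such a chain stabilizes if
  its transition morphisms are eventually isomorphisms.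
\<close>

definition dcc_hopf_subalgebras ::
  "('o, 'm, 'z) braided_cat_scheme \<Rightarrow> ('o, 'm) hopf \<Rightarrow> bool" where
  "dcc_hopf_subalgebras C H \<longleftrightarrow>
     (\<forall>A i. A 0 = H \<and> (\<forall>n::nat. hopf_subalgebra C (A (Suc n)) (i n) (A n)) \<longrightarrow>
        (\<exists>N. \<forall>n\<ge>N. is_isomorphism C (i n)))"

definition dcc_hopf_quotients ::
  "('o, 'm, 'z) braided_cat_scheme \<Rightarrow> ('o, 'm) hopf \<Rightarrow> bool" where
  "dcc_hopf_quotients C H \<longleftrightarrow>
     (\<forall>Q p. Q 0 = H \<and> (\<forall>n::nat. hopf_quotient C (Q n) (p n) (Q (Suc n))) \<longrightarrow>
        (\<exists>N. \<forall>n\<ge>N. is_isomorphism C (p n)))"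

definition both_chain_conditions ::
  "('o, 'm, 'z) braided_cat_scheme \<Rightarrow> ('o, 'm) hopf \<Rightarrow> bool" where
  "both_chain_conditions C H \<longleftrightarrow> dcc_hopf_subalgebras C H \<and> dcc_hopf_quotients C H"

text \<open>
  \<open>commuting C A f g\<close> is \<open>f \<curlyvee> g\<close> for morphisms \<open>f\<close>, \<open>g\<close> to the algebra \<open>A\<close>, and
  \<open>cocommuting C D f g\<close> is \<open>f \<curlywedge> g\<close> for morphisms \<open>f\<close>, \<open>g\<close> from the coalgebra \<open>D\<close>.
\<close>

definition commuting ::
  "('o, 'm, 'z) braided_cat_scheme \<Rightarrow> ('o, 'm) hopf \<Rightarrow> 'm \<Rightarrow> 'm \<Rightarrow> bool" where
  "commuting C A f g \<longleftrightarrow>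
     \<nabla>\<^bsub>A\<^esub> \<cdot>\<^bsub>C\<^esub> (g \<otimes>\<^bsub>C\<^esub> f) = \<nabla>\<^bsub>A\<^esub> \<cdot>\<^bsub>C\<^esub> (f \<otimes>\<^bsub>C\<^esub> g) \<cdot>\<^bsub>C\<^esub> \<tau>\<^bsub>C\<^esub> (Dom C g) (Dom C f)"

definition cocommuting ::
  "('o, 'm, 'z) braided_cat_scheme \<Rightarrow> ('o, 'm) hopf \<Rightarrow> 'm \<Rightarrow> 'm \<Rightarrow> bool" where
  "cocommuting C D f g \<longleftrightarrow>
     (g \<otimes>\<^bsub>C\<^esub> f) \<cdot>\<^bsub>C\<^esub> \<Delta>\<^bsub>D\<^esub> = \<tau>\<^bsub>C\<^esub> (Cod C f) (Cod C g) \<cdot>\<^bsub>C\<^esub> (f \<otimes>\<^bsub>C\<^esub> g) \<cdot>\<^bsub>C\<^esub> \<Delta>\<^bsub>D\<^esub>"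

definition hopf_Hom_c ::
  "('o, 'm, 'z) braided_cat_scheme \<Rightarrow> ('o, 'm) hopf \<Rightarrow> ('o, 'm) hopf \<Rightarrow> 'm set" where
  "hopf_Hom_c C K H = {b \<in> hopf_Hom C K H.
     commuting C H b (Idn C (Car H)) \<and> cocommuting C K b (Idn C (Car K))}"

text \<open>The matrix with rows \<open>a b\<close> and \<open>c d\<close> is represented by the tuple \<open>(a, b, c, d)\<close>.\<close>

definition matrix_set ::
  "('o, 'm, 'z) braided_cat_scheme \<Rightarrow> ('o, 'm) hopf \<Rightarrow> ('o, 'm) hopf \<Rightarrow> ('m \<times> 'm \<times> 'm \<times> 'm) set" where
  "matrix_set C H K = hopf_Aut C H \<times> hopf_Hom_c C K H \<times> hopf_Hom_c C H K \<times> hopf_Aut C K"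

text \<open>
  The endomorphism of \<open>H \<otimes> K\<close> identified with a matrix. For \<open>H\<close> and \<open>K\<close> unbraided, a matrix
  of Hopf algebra morphisms can be recovered from it, so that nothing is lost in passing to the
  image under this map.
\<close>

definition matrix_morphism ::
  "('o, 'm, 'z) braided_cat_scheme \<Rightarrow> ('o, 'm) hopf \<Rightarrow> ('o, 'm) hopf \<Rightarrow> 'm \<times> 'm \<times> 'm \<times> 'm \<Rightarrow> 'm" where
  "matrix_morphism C H K = (\<lambda>(a, b, c, d).
     (\<nabla>\<^bsub>H\<^esub> \<otimes>\<^bsub>C\<^esub> \<nabla>\<^bsub>K\<^esub>) \<cdot>\<^bsub>C\<^esub> (a \<otimes>\<^bsub>C\<^esub> b \<otimes>\<^bsub>C\<^esub> c \<otimes>\<^bsub>C\<^esub> d) \<cdot>\<^bsub>C\<^esub>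
     (Idn C (Car H) \<otimes>\<^bsub>C\<^esub> \<tau>\<^bsub>C\<^esub> (Car H) (Car K) \<otimes>\<^bsub>C\<^esub> Idn C (Car K)) \<cdot>\<^bsub>C\<^esub> (\<Delta>\<^bsub>H\<^esub> \<otimes>\<^bsub>C\<^esub> \<Delta>\<^bsub>K\<^esub>))"

end

theory Submission
  imports Defs
begin

text \<open>
  Morphisms from a coalgebra to an algebra form a monoid under convolution, and \<open>f \<curlyvee> g\<close> says that
  \<open>f\<close> and \<open>g\<close>, pulled back to the tensor product of their domains, commute in such a monoid.
  Write convolution additively, with zero \<open>\<eta> \<epsilon>\<close>. An endomorphism of \<open>H \<otimes> K\<close> is then a matrix of
  morphisms, and matrices multiply as usual. Suppose \<open>f\<close>, \<open>g\<close> are commuting and cocommuting endomorphisms of \<open>H\<close>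
  with \<open>f + g = 1\<close>. By the chain conditions the images of the powers of \<open>g\<close> stabilize at some \<open>J\<close>
  on which \<open>g\<close> is invertible (Fitting). Since \<open>f g\<close> is central and cocentral, the projection of \<open>H\<close>
  onto \<open>J\<close> has a complement, so \<open>J\<close> is a tensor factor of \<open>H\<close>. If \<open>g = b c\<close> factors through \<open>K\<close>,
  then \<open>J\<close> is a tensor factor of \<open>K\<close> as well. If common factors are trivial, \<open>g\<close> is therefore
  nilpotent and \<open>f = 1 - g\<close> is invertible by a geometric series.

  For a matrix in \<open>\<A>\<close> this applies to \<open>1 - b c\<close> with \<open>b\<close>, \<open>c\<close> central and cocentral, where \<open>J\<close> is
  abelian; for an automorphism with inverse \<open>(a', b', c', d')\<close> it applies to \<open>a a' + b c' = 1\<close>.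
  Conversely, a common factor \<open>A\<close> gives the automorphism exchanging its two copies, whose diagonal
  entries are not invertible, and if \<open>A\<close> is abelian it gives the matrix in \<open>\<A>\<close> with diagonal entries
  \<open>1\<close> and off-diagonal entries the projections via \<open>A\<close>, which kills the antidiagonal of \<open>A\<close>.
\<close>

section \<open>Tensor categories and duality\<close>

text \<open>Convolution is a sum only with care: \<open>f + g\<close> is again a Hopf morphism when
  \<open>f\<close> and \<open>g\<close> commute and cocommute, and \<open>- f\<close>, that is
  \<open>S f\<close>, when \<open>f\<close> commutes and cocommutes with itself. Every sum or
  difference below is therefore accompanied by relations \<open>\<curlyvee>\<close> and
  \<open>\<curlywedge>\<close>, and these spread by one principle: a morphism that commutes with two
  summands commutes with their sum. The projection \<open>e\<close> onto \<open>J\<close> is the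
  main instance. It involves an inverse on \<open>J\<close>, so its complement has to be
  constructed: \<open>e - g = e f\<close> commutes with \<open>f\<close> and with \<open>g\<close>,
  hence with \<open>f + g = 1\<close>, and may be subtracted from \<open>f\<close>.

  Exactness of the tensor product is what makes images of Hopf morphisms Hopf algebras, since
  tensoring then preserves monos and epis.

  A matrix with central off-diagonal entries is not inverted by a formula. A partner makes the
  product diagonal with entries \<open>1 - b c\<close>, and the partner has a partner in turn, so
  that it is invertible on both sides.\<close>

context category
begin

lemma Mor_iff: "f \<in> Mor C A B \<longleftrightarrow> f \<in> Arr C \<and> Dom C f = A \<and> Cod C f = B"
  by (simp add: Mor_def)

lemma Arr_Mor: "f \<in> Arr C \<Longrightarrow> f \<in> Mor C (Dom C f) (Cod C f)"
  by (simp add: Mor_def)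

lemma Cmp_typing [simp]:
  assumes "f \<in> Arr C" "g \<in> Arr C" "Dom C g = Cod C f"
  shows "g \<cdot> f \<in> Arr C" "Dom C (g \<cdot> f) = Dom C f" "Cod C (g \<cdot> f) = Cod C g"
  using Cmp_Mor[of f "Dom C f" "Cod C f" g "Cod C g"] assms by (auto simp: Mor_def)

lemma Idn_typing [simp]:
  assumes "A \<in> Obj C"
  shows "Idn C A \<in> Arr C" "Dom C (Idn C A) = A" "Cod C (Idn C A) = A"
  using Idn_Mor[OF assms] by (auto simp: Mor_def)

lemma Dom_Cod_Obj [simp]: "f \<in> Arr C \<Longrightarrow> Dom C f \<in> Obj C" "f \<in> Arr C \<Longrightarrow> Cod C f \<in> Obj C"
  by (auto intro: Dom_Obj Cod_Obj)

lemma Cmp_Idn [simp]: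
  "f \<in> Arr C \<Longrightarrow> Cod C f = B \<Longrightarrow> Idn C B \<cdot> f = f"
  "f \<in> Arr C \<Longrightarrow> Dom C f = A \<Longrightarrow> f \<cdot> Idn C A = f"
  by (auto intro: Idn_left Idn_right Arr_Mor)

lemma Cmp_assoc' [simp]:
  "f \<in> Arr C \<Longrightarrow> g \<in> Arr C \<Longrightarrow> h \<in> Arr C \<Longrightarrow> Dom C g = Cod C f \<Longrightarrow> Dom C h = Cod C g
   \<Longrightarrow> (h \<cdot> g) \<cdot> f = h \<cdot> (g \<cdot> f)"
  by (rule Cmp_assoc) (auto simp: Mor_def)

text \<open>Right-nested compositions hide an equation \<open>g \<cdot> f = k\<close> inside \<open>g \<cdot> f \<cdot> h\<close>; this exposes it.\<close>

lemma Cmp_reassoc: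
  assumes "g \<cdot> f = k" "f \<in> Arr C" "g \<in> Arr C" "h \<in> Arr C" "Dom C g = Cod C f" "Dom C f = Cod C h"
  shows "g \<cdot> f \<cdot> h = k \<cdot> h"
  using assms(1)[symmetric] assms(2-) by simp

end

context strict_tensor_category
begin

lemma Ten_typing [simp]:
  assumes "f \<in> Arr C" "g \<in> Arr C"
  shows "f \<otimes> g \<in> Arr C" "Dom C (f \<otimes> g) = Dom C f \<odot> Dom C g" "Cod C (f \<otimes> g) = Cod C f \<odot> Cod C g"
  using Ten_Mor[OF Arr_Mor[OF assms(1)] Arr_Mor[OF assms(2)]] by (auto simp: Mor_def)

declare TenO_Obj [simp] Unit_Obj [simp] TenO_Unit_left [simp] TenO_Unit_right [simp]
  TenO_assoc [simp] Ten_assoc [simp] Ten_Unit_left [simp] Ten_Unit_right [simp]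

lemma Ten_Cmp' [simp]:
  assumes "f \<in> Arr C" "g \<in> Arr C" "f' \<in> Arr C" "g' \<in> Arr C" "Dom C g = Cod C f" "Dom C g' = Cod C f'"
  shows "(g \<otimes> g') \<cdot> (f \<otimes> f') = (g \<cdot> f) \<otimes> (g' \<cdot> f')"
  using assms by (intro Ten_Cmp[symmetric]) (auto simp: Mor_def)

lemma Ten_Cmp_reassoc [simp]:
  assumes "f \<in> Arr C" "g \<in> Arr C" "f' \<in> Arr C" "g' \<in> Arr C" "Dom C g = Cod C f" "Dom C g' = Cod C f'"
    "h \<in> Arr C" "Cod C h = Dom C f \<odot> Dom C f'"
  shows "(g \<otimes> g') \<cdot> (f \<otimes> f') \<cdot> h = ((g \<cdot> f) \<otimes> (g' \<cdot> f')) \<cdot> h"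
  using assms by (intro Cmp_reassoc) auto

lemma Idn_TenO: "A \<in> Obj C \<Longrightarrow> B \<in> Obj C \<Longrightarrow> Idn C (A \<odot> B) = Idn C A \<otimes> Idn C B"
  by (simp add: Ten_Idn)

end

section \<open>Braidings with the unit and the interchange of inner factors\<close>

context strict_braided_category
begin

lemma Brd_typing [simp]:
  assumes "A \<in> Obj C" "B \<in> Obj C"
  shows "\<tau> A B \<in> Arr C" "Dom C (\<tau> A B) = A \<odot> B" "Cod C (\<tau> A B) = B \<odot> A"
  using Brd_Mor[OF assms] by (auto simp: Mor_def)

lemma Brd_nat:
  "f \<in> Arr C \<Longrightarrow> g \<in> Arr C \<Longrightarrow> Cod C f = B \<Longrightarrow> Cod C g = B'
   \<Longrightarrow> \<tau> B B' \<cdot> (f \<otimes> g) = (g \<otimes> f) \<cdot> \<tau> (Dom C f) (Dom C g)"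
  by (rule Brd_natural) (auto simp: Mor_def)

text \<open>The hexagon with the unit in both remaining places makes this braiding idempotent, and
  an idempotent isomorphism is an identity.\<close>

lemma Brd_Unit_right [simp]: assumes "A \<in> Obj C" shows "\<tau> A (Unit C) = Idn C A"
proof -
  have "\<tau> A (Unit C) = \<tau> A (Unit C) \<cdot> \<tau> A (Unit C)"
    using hexagon_right[OF assms Unit_Obj Unit_Obj] assms by simp
  moreover obtain g where g: "mutually_inverse C (\<tau> A (Unit C)) g"
    using Brd_isomorphism[OF assms Unit_Obj] by (auto simp: is_isomorphism_def)
  ultimately show ?thesis
    using assms unfolding mutually_inverse_def Mor_def
    by (smt (verit, ccfv_SIG) Brd_typing Cmp_Idn(1) Cmp_assoc' TenO_Unit_left TenO_Unit_right Unit_Obj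
      mem_Collect_eq)
qed

lemma Brd_Unit_left [simp]: assumes "A \<in> Obj C" shows "\<tau> (Unit C) A = Idn C A"
proof -
  have "\<tau> (Unit C) A = \<tau> (Unit C) A \<cdot> \<tau> (Unit C) A"
    using hexagon_left[OF Unit_Obj Unit_Obj assms] assms by simp
  moreover obtain g where g: "mutually_inverse C (\<tau> (Unit C) A) g"
    using Brd_isomorphism[OF Unit_Obj assms] by (auto simp: is_isomorphism_def)
  ultimately show ?thesis
    using assms unfolding mutually_inverse_def Mor_def
    by (smt (verit, ccfv_SIG) Brd_typing Cmp_Idn(1) Cmp_assoc' TenO_Unit_left TenO_Unit_right Unit_Obj
      mem_Collect_eq)
qed

abbreviation mid :: "'a \<Rightarrow> 'a \<Rightarrow> 'a \<Rightarrow> 'a \<Rightarrow> 'b" where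
  "mid A B D E \<equiv> Idn C A \<otimes> \<tau> B D \<otimes> Idn C E"

lemma mid_natural:
  assumes "f \<in> Arr C" "g \<in> Arr C" "h \<in> Arr C" "k \<in> Arr C"
    "Cod C f = A" "Cod C g = B" "Cod C h = D" "Cod C k = E"
  shows "mid A B D E \<cdot> (f \<otimes> g \<otimes> h \<otimes> k) = (f \<otimes> h \<otimes> g \<otimes> k) \<cdot> mid (Dom C f) (Dom C g) (Dom C h) (Dom C k)"
proof -
  have "mid A B D E \<cdot> (f \<otimes> (g \<otimes> h) \<otimes> k) = f \<otimes> (\<tau> B D \<cdot> (g \<otimes> h)) \<otimes> k"
    using assms by (auto simp del: Ten_assoc)
  also have "\<dots> = f \<otimes> ((h \<otimes> g) \<cdot> \<tau> (Dom C g) (Dom C h)) \<otimes> k"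
    using assms Brd_nat by simp
  also have "\<dots> = (f \<otimes> (h \<otimes> g) \<otimes> k) \<cdot> mid (Dom C f) (Dom C g) (Dom C h) (Dom C k)"
    using assms by (auto simp del: Ten_assoc)
  finally show ?thesis using assms by simp
qed

text \<open>Both sides rearrange \<open>A A A B B B\<close> into \<open>A B A B A B\<close>. Once
  the hexagons have split the braidings, the two sides share the innermost braiding
  \<open>?x2\<close>; it is followed by two braidings in disjoint places, whose order does not
  matter. This is the part of the coassociativity of a tensor product that concerns the braiding
  alone.\<close>

lemma mid_coherence:
  assumes "A \<in> Obj C" "B \<in> Obj C"
  shows "(mid A A B B \<otimes> Idn C (A \<odot> B)) \<cdot> mid (A \<odot> A) A (B \<odot> B) B
    = (Idn C (A \<odot> B) \<otimes> mid A A B B) \<cdot> mid A (A \<odot> A) B (B \<odot> B)"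
proof -
  let ?I = "Idn C"
  let ?x2 = "?I (A \<odot> A) \<otimes> \<tau> A B \<otimes> ?I (B \<odot> B)"
  have "mid (A \<odot> A) A (B \<odot> B) B
      = (?I (A \<odot> A) \<otimes> ((?I B \<otimes> \<tau> A B) \<otimes> ?I B)) \<cdot> (?I (A \<odot> A) \<otimes> ((\<tau> A B \<otimes> ?I B) \<otimes> ?I B))"
    using assms by (simp add: hexagon_right del: Ten_assoc)
  then have 1: "mid (A \<odot> A) A (B \<odot> B) B = (?I A \<otimes> ?I (A \<odot> B) \<otimes> \<tau> A B \<otimes> ?I B) \<cdot> ?x2"
    using assms by (simp add: Idn_TenO)
  have "mid A (A \<odot> A) B (B \<odot> B)
      = (?I A \<otimes> ((\<tau> A B \<otimes> ?I A) \<otimes> ?I (B \<odot> B))) \<cdot> (?I A \<otimes> ((?I A \<otimes> \<tau> A B) \<otimes> ?I (B \<odot> B)))"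
    using assms by (simp add: hexagon_left del: Ten_assoc)
  then have 2: "mid A (A \<odot> A) B (B \<odot> B) = (?I A \<otimes> \<tau> A B \<otimes> ?I (A \<odot> B) \<otimes> ?I B) \<cdot> ?x2"
    using assms by (simp add: Idn_TenO)
  have 3: "mid A A B B \<otimes> Idn C (A \<odot> B) = ?I A \<otimes> \<tau> A B \<otimes> ?I (B \<odot> A) \<otimes> ?I B"
    using assms by (simp add: Idn_TenO)
  have 4: "Idn C (A \<odot> B) \<otimes> mid A A B B = ?I A \<otimes> ?I (B \<odot> A) \<otimes> \<tau> A B \<otimes> ?I B"
    using assms by (simp add: Idn_TenO)
  show ?thesis unfolding 1 2 3 4 using assms by simp
qed

end

text \<open>
  Reversing all arrows, with \<open>\<tau> B A\<close> as the braiding at \<open>A\<close>, \<open>B\<close>, exchanges algebras with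
  coalgebras and \<open>\<curlyvee>\<close> with \<open>\<curlywedge>\<close>, so only one of each pair of dual statements has to be proved.
\<close>

definition dual_cat :: "('o, 'm, 'z) braided_cat_scheme \<Rightarrow> ('o, 'm, 'z) braided_cat_scheme" where
  "dual_cat C = C\<lparr>Dom := Cod C, Cod := Dom C, Cmp := \<lambda>g f. Cmp C f g,
     Zro := \<lambda>A B. Zro C B A, Brd := \<lambda>A B. Brd C B A\<rparr>"

definition dual_hopf :: "('o, 'm) hopf \<Rightarrow> ('o, 'm) hopf" where
  "dual_hopf H = \<lparr>Car = Car H, Mul = Com H, Unt = Cou H, Com = Mul H, Cou = Unt H, Ant = Ant H\<rparr>"

lemma dual_cat_simps [simp]:
  "Obj (dual_cat C) = Obj C" "Arr (dual_cat C) = Arr C" "Dom (dual_cat C) = Cod C"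
  "Cod (dual_cat C) = Dom C" "Idn (dual_cat C) = Idn C" "Cmp (dual_cat C) g f = Cmp C f g"
  "Add (dual_cat C) = Add C" "Zro (dual_cat C) A B = Zro C B A" "TenO (dual_cat C) = TenO C"
  "Ten (dual_cat C) = Ten C" "Unit (dual_cat C) = Unit C" "Brd (dual_cat C) A B = Brd C B A"
  "dual_cat (dual_cat C) = C" "Mor (dual_cat C) A B = Mor C B A"
  by (auto simp: dual_cat_def Mor_def)

lemma dual_hopf_simps [simp]:
  "Car (dual_hopf H) = Car H" "Mul (dual_hopf H) = Com H" "Unt (dual_hopf H) = Cou H"
  "Com (dual_hopf H) = Mul H" "Cou (dual_hopf H) = Unt H" "Ant (dual_hopf H) = Ant H"
  "dual_hopf (dual_hopf H) = H"
  by (simp_all add: dual_hopf_def)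

lemma mutually_inverse_dual [simp]: "mutually_inverse (dual_cat C) f g \<longleftrightarrow> mutually_inverse C f g"
  by (auto simp: mutually_inverse_def Mor_def)

lemma is_isomorphism_dual [simp]: "is_isomorphism (dual_cat C) f \<longleftrightarrow> is_isomorphism C f"
  by (simp add: is_isomorphism_def)

lemma is_mono_dual [simp]: "is_mono (dual_cat C) f \<longleftrightarrow> is_epi C f"
  and is_epi_dual [simp]: "is_epi (dual_cat C) f \<longleftrightarrow> is_mono C f"
  by (auto simp: is_mono_def is_epi_def)

lemma is_kernel_dual [simp]: "is_kernel (dual_cat C) k f \<longleftrightarrow> is_cokernel C k f"
  and is_cokernel_dual [simp]: "is_cokernel (dual_cat C) k f \<longleftrightarrow> is_kernel C k f"
  by (auto simp: is_kernel_def is_cokernel_def)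

lemma short_exact_dual [simp]: "short_exact (dual_cat C) f g \<longleftrightarrow> short_exact C g f"
  by (auto simp: short_exact_def)

lemma Mor_group_dual [simp]: "Mor_group (dual_cat C) A B = Mor_group C B A"
  by (simp add: Mor_group_def)

text \<open>Reversing arrows exchanges the two hexagons. The braiding \<open>\<tau> B A\<close>,
  read backwards, again goes from \<open>A \<odot> B\<close> to \<open>B \<odot> A\<close>, so the
  dual braiding arises without any inversion.\<close>

lemma (in strict_braided_category) dual: "strict_braided_category (dual_cat C)"
  by unfold_locales
    (use Brd_natural Brd_isomorphism in
      \<open>auto simp: Mor_iff Ten_assoc Brd_nat Ten_Idn hexagon_left hexagon_right\<close>)

lemma (in abelian_braided_category) dual_abelian: "abelian_braided_category (dual_cat C)"
proof -
  interpret d: strict_braided_category "dual_cat C" by (rule dual)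
  have "\<exists>Z\<in>Obj C. \<forall>A\<in>Obj C. (\<exists>!f. f \<in> Mor C Z A) \<and> (\<exists>!f. f \<in> Mor C A Z)"
    using zero_object by (simp add: conj_commute)
  moreover have "\<exists>P\<in>Obj C. \<exists>i\<in>Mor C P A. \<exists>j\<in>Mor C P B. \<exists>p\<in>Mor C A P. \<exists>q\<in>Mor C B P.
      i \<cdot> p = Idn C A \<and> j \<cdot> q = Idn C B \<and> (p \<cdot> i) \<oplus> (q \<cdot> j) = Idn C P"
    if "A \<in> Obj C" "B \<in> Obj C" for A B
    using biproducts[OF that] by blast
  ultimately have "abelian_category_axioms (dual_cat C)"
    by (intro abelian_category_axioms.intro)
      (simp_all add: Mor_comm_group Cmp_Add_left Cmp_Add_right kernels cokernels mono_normal epi_normal)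
  moreover have "abelian_braided_category_axioms (dual_cat C)"
    by (intro abelian_braided_category_axioms.intro)
      (simp_all add: Ten_additive_left Ten_additive_right Ten_exact_left Ten_exact_right)
  ultimately show ?thesis
    by (intro abelian_braided_category.intro abelian_category.intro d.strict_braided_category_axioms
        d.category_axioms)
qed

section \<open>Convolution\<close>

text \<open>Hopf morphisms are split into an algebra half and a coalgebra half because duality
  exchanges the two; each result on one half then yields the result on the other.\<close>

definition alg_hom ::
  "('o, 'm, 'z) braided_cat_scheme \<Rightarrow> ('o, 'm) hopf \<Rightarrow> ('o, 'm) hopf \<Rightarrow> 'm \<Rightarrow> bool" where
  "alg_hom C A B f \<longleftrightarrow> f \<in> Mor C (Car A) (Car B) \<and>
     f \<cdot>\<^bsub>C\<^esub> \<nabla>\<^bsub>A\<^esub> = \<nabla>\<^bsub>B\<^esub> \<cdot>\<^bsub>C\<^esub> (f \<otimes>\<^bsub>C\<^esub> f) \<and> f \<cdot>\<^bsub>C\<^esub> \<eta>\<^bsub>A\<^esub> = \<eta>\<^bsub>B\<^esub>"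

definition coalg_hom ::
  "('o, 'm, 'z) braided_cat_scheme \<Rightarrow> ('o, 'm) hopf \<Rightarrow> ('o, 'm) hopf \<Rightarrow> 'm \<Rightarrow> bool" where
  "coalg_hom C A B f \<longleftrightarrow> f \<in> Mor C (Car A) (Car B) \<and>
     \<Delta>\<^bsub>B\<^esub> \<cdot>\<^bsub>C\<^esub> f = (f \<otimes>\<^bsub>C\<^esub> f) \<cdot>\<^bsub>C\<^esub> \<Delta>\<^bsub>A\<^esub> \<and> \<epsilon>\<^bsub>B\<^esub> \<cdot>\<^bsub>C\<^esub> f = \<epsilon>\<^bsub>A\<^esub>"

lemma hopf_Hom_iff: "f \<in> hopf_Hom C A B \<longleftrightarrow> alg_hom C A B f \<and> coalg_hom C A B f"
  by (auto simp: hopf_Hom_def alg_hom_def coalg_hom_def)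

lemma alg_hom_dual [simp]: "alg_hom (dual_cat C) (dual_hopf A) (dual_hopf B) f \<longleftrightarrow> coalg_hom C B A f"
  and coalg_hom_dual [simp]: "coalg_hom (dual_cat C) (dual_hopf A) (dual_hopf B) f \<longleftrightarrow> alg_hom C B A f"
  by (auto simp: alg_hom_def coalg_hom_def)

lemma hopf_Hom_dual [simp]: "hopf_Hom (dual_cat C) (dual_hopf A) (dual_hopf B) = hopf_Hom C B A"
  by (auto simp: hopf_Hom_iff)

lemma is_algebra_dual [simp]: "is_algebra (dual_cat C) (dual_hopf A) \<longleftrightarrow> is_coalgebra C A"
  and is_coalgebra_dual [simp]: "is_coalgebra (dual_cat C) (dual_hopf A) \<longleftrightarrow> is_algebra C A"
  by (auto simp: is_algebra_def is_coalgebra_def)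

lemma dual_tensor_hopf [simp]:
  "tensor_hopf (dual_cat C) (dual_hopf A) (dual_hopf B) = dual_hopf (tensor_hopf C A B)"
  by (simp add: tensor_hopf_def dual_hopf_def)

lemma algebra_typing [simp]:
  assumes "is_algebra C A"
  shows "Car A \<in> Obj C" "\<nabla>\<^bsub>A\<^esub> \<in> Arr C" "Dom C \<nabla>\<^bsub>A\<^esub> = Car A \<odot>\<^bsub>C\<^esub> Car A" "Cod C \<nabla>\<^bsub>A\<^esub> = Car A"
    "\<eta>\<^bsub>A\<^esub> \<in> Arr C" "Dom C \<eta>\<^bsub>A\<^esub> = Unit C" "Cod C \<eta>\<^bsub>A\<^esub> = Car A"
  using assms by (auto simp: is_algebra_def Mor_def)

lemma coalgebra_typing [simp]:
  assumes "is_coalgebra C A"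
  shows "Car A \<in> Obj C" "\<Delta>\<^bsub>A\<^esub> \<in> Arr C" "Dom C \<Delta>\<^bsub>A\<^esub> = Car A" "Cod C \<Delta>\<^bsub>A\<^esub> = Car A \<odot>\<^bsub>C\<^esub> Car A"
    "\<epsilon>\<^bsub>A\<^esub> \<in> Arr C" "Dom C \<epsilon>\<^bsub>A\<^esub> = Car A" "Cod C \<epsilon>\<^bsub>A\<^esub> = Unit C"
  using assms by (auto simp: is_coalgebra_def Mor_def)

lemma bialgebraD [simp]:
  assumes "is_bialgebra C H" shows "is_algebra C H" "is_coalgebra C H"
  using assms by (auto simp: is_bialgebra_def)

lemma hopf_algebraD [simp]:
  assumes "is_hopf_algebra C H"
  shows "is_bialgebra C H" "Ant H \<in> Arr C" "Dom C (Ant H) = Car H" "Cod C (Ant H) = Car H"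
  using assms by (auto simp: is_hopf_algebra_def Mor_def)

lemma hom_typing:
  "alg_hom C A B f \<Longrightarrow> f \<in> Arr C" "alg_hom C A B f \<Longrightarrow> Dom C f = Car A" "alg_hom C A B f \<Longrightarrow> Cod C f = Car B"
  "coalg_hom C A B f \<Longrightarrow> f \<in> Arr C" "coalg_hom C A B f \<Longrightarrow> Dom C f = Car A"
    "coalg_hom C A B f \<Longrightarrow> Cod C f = Car B"
  by (auto simp: alg_hom_def coalg_hom_def Mor_def)

definition conv ::
  "('o, 'm, 'z) braided_cat_scheme \<Rightarrow> ('o, 'm) hopf \<Rightarrow> ('o, 'm) hopf \<Rightarrow> 'm \<Rightarrow> 'm \<Rightarrow> 'm" where
  "conv C X A f g = \<nabla>\<^bsub>A\<^esub> \<cdot>\<^bsub>C\<^esub> (f \<otimes>\<^bsub>C\<^esub> g) \<cdot>\<^bsub>C\<^esub> \<Delta>\<^bsub>X\<^esub>"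

definition cunit ::
  "('o, 'm, 'z) braided_cat_scheme \<Rightarrow> ('o, 'm) hopf \<Rightarrow> ('o, 'm) hopf \<Rightarrow> 'm" where
  "cunit C X A = \<eta>\<^bsub>A\<^esub> \<cdot>\<^bsub>C\<^esub> \<epsilon>\<^bsub>X\<^esub>"

lemma cunit_dual [simp]: "cunit (dual_cat C) (dual_hopf A) (dual_hopf X) = cunit C X A"
  by (simp add: cunit_def)

section \<open>Monoid laws and distributivity of convolution\<close>

context strict_braided_category
begin

declare Mor_iff [simp]

abbreviation conv_syntax ("(_ \<star>\<^bsub>_,_\<^esub> _)" [66, 0, 0, 65] 65) where
  "x \<star>\<^bsub>X,A\<^esub> y \<equiv> conv C X A x y"

abbreviation "zer \<equiv> cunit C"
abbreviation "Hom \<equiv> hopf_Hom C"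
abbreviation "idm X \<equiv> Idn C (Car X)"

lemma conv_typing [simp]:
  assumes "is_coalgebra C X" "is_algebra C A" "x \<in> Arr C" "y \<in> Arr C"
    "Dom C x = Car X" "Dom C y = Car X" "Cod C x = Car A" "Cod C y = Car A"
  shows "x \<star>\<^bsub>X,A\<^esub> y \<in> Arr C" "Dom C (x \<star>\<^bsub>X,A\<^esub> y) = Car X" "Cod C (x \<star>\<^bsub>X,A\<^esub> y) = Car A"
  using assms by (auto simp: conv_def)

lemma zer_typing [simp]:
  assumes "is_coalgebra C X" "is_algebra C A"
  shows "zer X A \<in> Arr C" "Dom C (zer X A) = Car X" "Cod C (zer X A) = Car A"
  using assms by (auto simp: cunit_def)

lemma conv_assoc:
  assumes "is_coalgebra C X" "is_algebra C A" "x \<in> Arr C" "y \<in> Arr C" "z \<in> Arr C"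
    "Dom C x = Car X" "Dom C y = Car X" "Dom C z = Car X" "Cod C x = Car A" "Cod C y = Car A"
      "Cod C z = Car A"
  shows "(x \<star>\<^bsub>X,A\<^esub> y) \<star>\<^bsub>X,A\<^esub> z = x \<star>\<^bsub>X,A\<^esub> (y \<star>\<^bsub>X,A\<^esub> z)"
proof -
  let ?A = "idm A" and ?X = "idm X"
  have a: "\<nabla>\<^bsub>A\<^esub> \<cdot> (\<nabla>\<^bsub>A\<^esub> \<otimes> ?A) = \<nabla>\<^bsub>A\<^esub> \<cdot> (?A \<otimes> \<nabla>\<^bsub>A\<^esub>)"
    and c: "(\<Delta>\<^bsub>X\<^esub> \<otimes> ?X) \<cdot> \<Delta>\<^bsub>X\<^esub> = (?X \<otimes> \<Delta>\<^bsub>X\<^esub>) \<cdot> \<Delta>\<^bsub>X\<^esub>"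
    using assms(1,2) by (simp_all only: is_algebra_def is_coalgebra_def)
  have "(x \<star>\<^bsub>X,A\<^esub> y) \<star>\<^bsub>X,A\<^esub> z = \<nabla>\<^bsub>A\<^esub> \<cdot> (\<nabla>\<^bsub>A\<^esub> \<otimes> ?A) \<cdot> ((x \<otimes> y) \<otimes> z) \<cdot> (\<Delta>\<^bsub>X\<^esub> \<otimes> ?X) \<cdot> \<Delta>\<^bsub>X\<^esub>"
    using assms by (simp add: conv_def del: Ten_assoc)
  also have "\<dots> = \<nabla>\<^bsub>A\<^esub> \<cdot> (?A \<otimes> \<nabla>\<^bsub>A\<^esub>) \<cdot> (x \<otimes> y \<otimes> z) \<cdot> (?X \<otimes> \<Delta>\<^bsub>X\<^esub>) \<cdot> \<Delta>\<^bsub>X\<^esub>"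
    unfolding c using assms by (subst Cmp_reassoc[OF a]) (simp_all)
  also have "\<dots> = x \<star>\<^bsub>X,A\<^esub> (y \<star>\<^bsub>X,A\<^esub> z)"
    using assms by (simp add: conv_def)
  finally show ?thesis .
qed

lemma conv_zer [simp]:
  assumes "is_coalgebra C X" "is_algebra C A" "x \<in> Arr C" "Dom C x = Car X" "Cod C x = Car A"
  shows "zer X A \<star>\<^bsub>X,A\<^esub> x = x" "x \<star>\<^bsub>X,A\<^esub> zer X A = x"
proof -
  let ?A = "idm A" and ?X = "idm X"
  have a: "\<nabla>\<^bsub>A\<^esub> \<cdot> (\<eta>\<^bsub>A\<^esub> \<otimes> ?A) = ?A" "\<nabla>\<^bsub>A\<^esub> \<cdot> (?A \<otimes> \<eta>\<^bsub>A\<^esub>) = ?A"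
    and c: "(\<epsilon>\<^bsub>X\<^esub> \<otimes> ?X) \<cdot> \<Delta>\<^bsub>X\<^esub> = ?X" "(?X \<otimes> \<epsilon>\<^bsub>X\<^esub>) \<cdot> \<Delta>\<^bsub>X\<^esub> = ?X"
    using assms(1,2) by (simp_all only: is_algebra_def is_coalgebra_def)
  have "zer X A \<star>\<^bsub>X,A\<^esub> x = \<nabla>\<^bsub>A\<^esub> \<cdot> (\<eta>\<^bsub>A\<^esub> \<otimes> ?A) \<cdot> (Idn C (Unit C) \<otimes> x) \<cdot> (\<epsilon>\<^bsub>X\<^esub> \<otimes> ?X) \<cdot> \<Delta>\<^bsub>X\<^esub>"
    using assms by (simp add: conv_def cunit_def del: Ten_Unit_left Ten_Unit_right)
  also have "\<dots> = x"
    unfolding c using assms by (subst Cmp_reassoc[OF a(1)]) (simp_all)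
  finally show "zer X A \<star>\<^bsub>X,A\<^esub> x = x" .
  have "x \<star>\<^bsub>X,A\<^esub> zer X A = \<nabla>\<^bsub>A\<^esub> \<cdot> (?A \<otimes> \<eta>\<^bsub>A\<^esub>) \<cdot> (x \<otimes> Idn C (Unit C)) \<cdot> (?X \<otimes> \<epsilon>\<^bsub>X\<^esub>) \<cdot> \<Delta>\<^bsub>X\<^esub>"
    using assms by (simp add: conv_def cunit_def del: Ten_Unit_left Ten_Unit_right)
  also have "\<dots> = x"
    unfolding c using assms by (subst Cmp_reassoc[OF a(2)]) (simp_all)
  finally show "x \<star>\<^bsub>X,A\<^esub> zer X A = x" .
qed

text \<open>Together with its mirror image \<open>coalg_hom_conv\<close>, this is the distributivity
  of composition over convolution on which the matrix calculus rests.\<close>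

lemma alg_hom_conv:
  assumes "alg_hom C A B f" "is_coalgebra C X" "is_algebra C A" "is_algebra C B" "x \<in> Arr C" "y \<in> Arr C"
    "Dom C x = Car X" "Dom C y = Car X" "Cod C x = Car A" "Cod C y = Car A"
  shows "f \<cdot> (x \<star>\<^bsub>X,A\<^esub> y) = (f \<cdot> x) \<star>\<^bsub>X,B\<^esub> (f \<cdot> y)"
proof -
  note [simp] = hom_typing(1-3)[OF assms(1)] assms(2-)
  have *: "f \<cdot> \<nabla>\<^bsub>A\<^esub> = \<nabla>\<^bsub>B\<^esub> \<cdot> (f \<otimes> f)" using assms(1) by (simp add: alg_hom_def)
  show ?thesis unfolding conv_def by (subst Cmp_reassoc[OF *]) simp_all
qed

lemma coalg_hom_conv:
  assumes "coalg_hom C Y X f" "is_coalgebra C X" "is_coalgebra C Y" "is_algebra C A" "x \<in> Arr C"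
      "y \<in> Arr C"
    "Dom C x = Car X" "Dom C y = Car X" "Cod C x = Car A" "Cod C y = Car A"
  shows "(x \<star>\<^bsub>X,A\<^esub> y) \<cdot> f = (x \<cdot> f) \<star>\<^bsub>Y,A\<^esub> (y \<cdot> f)"
proof -
  note [simp] = hom_typing(4-6)[OF assms(1)] assms(2-)
  have *: "\<Delta>\<^bsub>X\<^esub> \<cdot> f = (f \<otimes> f) \<cdot> \<Delta>\<^bsub>Y\<^esub>" using assms(1) by (simp add: coalg_hom_def)
  show ?thesis unfolding conv_def by (simp add: *)
qed

lemma conv_dual [simp]:
  assumes "is_coalgebra C X" "is_algebra C A" "x \<in> Arr C" "y \<in> Arr C"
    "Dom C x = Car X" "Dom C y = Car X" "Cod C x = Car A" "Cod C y = Car A"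
  shows "conv (dual_cat C) (dual_hopf A) (dual_hopf X) x y = x \<star>\<^bsub>X,A\<^esub> y"
  using assms by (simp add: conv_def)

lemma alg_hom_zer:
  assumes "alg_hom C A B f" "is_coalgebra C X" "is_algebra C A" "is_algebra C B"
  shows "f \<cdot> zer X A = zer X B"
proof -
  note [simp] = hom_typing(1-3)[OF assms(1)] assms(2-)
  have *: "f \<cdot> \<eta>\<^bsub>A\<^esub> = \<eta>\<^bsub>B\<^esub>" using assms(1) by (simp add: alg_hom_def)
  show ?thesis unfolding cunit_def by (subst Cmp_reassoc[OF *]) simp_all
qed

lemma coalg_hom_zer:
  assumes "coalg_hom C Y X f" "is_coalgebra C X" "is_coalgebra C Y" "is_algebra C A"
  shows "zer X A \<cdot> f = zer Y A"
proof -
  note [simp] = hom_typing(4-6)[OF assms(1)] assms(2-)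
  have *: "\<epsilon>\<^bsub>X\<^esub> \<cdot> f = \<epsilon>\<^bsub>Y\<^esub>" using assms(1) by (simp add: coalg_hom_def)
  show ?thesis unfolding cunit_def by (simp add: *)
qed

lemma Idn_hom [simp]:
  "is_algebra C A \<Longrightarrow> alg_hom C A A (idm A)"
  "is_coalgebra C A \<Longrightarrow> coalg_hom C A A (idm A)"
  by (auto simp: alg_hom_def coalg_hom_def Ten_Idn)

lemma alg_hom_Cmp:
  assumes "alg_hom C A B f" "alg_hom C B D g" "is_algebra C A" "is_algebra C B" "is_algebra C D"
  shows "alg_hom C A D (g \<cdot> f)"
proof -
  note [simp] = hom_typing(1-3)[OF assms(1)] hom_typing(1-3)[OF assms(2)] assms(3-)
  have *: "f \<cdot> \<nabla>\<^bsub>A\<^esub> = \<nabla>\<^bsub>B\<^esub> \<cdot> (f \<otimes> f)" "g \<cdot> \<nabla>\<^bsub>B\<^esub> = \<nabla>\<^bsub>D\<^esub> \<cdot> (g \<otimes> g)" "f \<cdot> \<eta>\<^bsub>A\<^esub> = \<eta>\<^bsub>B\<^esub>" "g \<cdot> \<eta>\<^bsub>B\<^esub> = \<eta>\<^bsub>D\<^esub>"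
    using assms(1,2) by (simp_all add: alg_hom_def)
  have "g \<cdot> \<nabla>\<^bsub>B\<^esub> \<cdot> (f \<otimes> f) = \<nabla>\<^bsub>D\<^esub> \<cdot> ((g \<cdot> f) \<otimes> (g \<cdot> f))"
    by (subst Cmp_reassoc[OF *(2)]) simp_all
  then show ?thesis unfolding alg_hom_def by (simp add: *)
qed

lemma coalg_hom_Cmp:
  assumes "coalg_hom C A B f" "coalg_hom C B D g" "is_coalgebra C A" "is_coalgebra C B"
      "is_coalgebra C D"
  shows "coalg_hom C A D (g \<cdot> f)"
proof -
  interpret d: strict_braided_category "dual_cat C" by (rule dual)
  show ?thesis using d.alg_hom_Cmp[of "dual_hopf D" "dual_hopf B" g "dual_hopf A" f] assms by simp
qed

lemma hopf_Hom_Cmp: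
  assumes "f \<in> Hom A B" "g \<in> Hom B D"
    "is_algebra C A" "is_algebra C B" "is_algebra C D" "is_coalgebra C A" "is_coalgebra C B"
      "is_coalgebra C D"
  shows "g \<cdot> f \<in> Hom A D"
  using assms by (auto simp: hopf_Hom_iff intro: alg_hom_Cmp coalg_hom_Cmp)

end

section \<open>Tensor products of coalgebras\<close>

definition pr1 :: "('o, 'm, 'z) braided_cat_scheme \<Rightarrow> ('o, 'm) hopf \<Rightarrow> ('o, 'm) hopf \<Rightarrow> 'm" where
  "pr1 C A B = Idn C (Car A) \<otimes>\<^bsub>C\<^esub> \<epsilon>\<^bsub>B\<^esub>"
definition pr2 :: "('o, 'm, 'z) braided_cat_scheme \<Rightarrow> ('o, 'm) hopf \<Rightarrow> ('o, 'm) hopf \<Rightarrow> 'm" where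
  "pr2 C A B = \<epsilon>\<^bsub>A\<^esub> \<otimes>\<^bsub>C\<^esub> Idn C (Car B)"
definition in1 :: "('o, 'm, 'z) braided_cat_scheme \<Rightarrow> ('o, 'm) hopf \<Rightarrow> ('o, 'm) hopf \<Rightarrow> 'm" where
  "in1 C A B = Idn C (Car A) \<otimes>\<^bsub>C\<^esub> \<eta>\<^bsub>B\<^esub>"
definition in2 :: "('o, 'm, 'z) braided_cat_scheme \<Rightarrow> ('o, 'm) hopf \<Rightarrow> ('o, 'm) hopf \<Rightarrow> 'm" where
  "in2 C A B = \<eta>\<^bsub>A\<^esub> \<otimes>\<^bsub>C\<^esub> Idn C (Car B)"

lemma pr_dual [simp]:
  "pr1 (dual_cat C) (dual_hopf A) (dual_hopf B) = in1 C A B"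
  "pr2 (dual_cat C) (dual_hopf A) (dual_hopf B) = in2 C A B"
  "in1 (dual_cat C) (dual_hopf A) (dual_hopf B) = pr1 C A B"
  "in2 (dual_cat C) (dual_hopf A) (dual_hopf B) = pr2 C A B"
  by (simp_all add: pr1_def pr2_def in1_def in2_def)

lemma tensor_hopf_simps [simp]:
  "Car (tensor_hopf C A B) = Car A \<odot>\<^bsub>C\<^esub> Car B"
  "Unt (tensor_hopf C A B) = \<eta>\<^bsub>A\<^esub> \<otimes>\<^bsub>C\<^esub> \<eta>\<^bsub>B\<^esub>"
  "Cou (tensor_hopf C A B) = \<epsilon>\<^bsub>A\<^esub> \<otimes>\<^bsub>C\<^esub> \<epsilon>\<^bsub>B\<^esub>"
  by (simp_all add: tensor_hopf_def)

lemma unit_hopf_simps [simp]: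
  "Car (unit_hopf C) = Unit C" "Mul (unit_hopf C) = Idn C (Unit C)" "Unt (unit_hopf C) = Idn C (Unit C)"
  "Com (unit_hopf C) = Idn C (Unit C)" "Cou (unit_hopf C) = Idn C (Unit C)"
    "Ant (unit_hopf C) = Idn C (Unit C)"
  "dual_hopf (unit_hopf C) = unit_hopf C" "unit_hopf (dual_cat C) = unit_hopf C"
  by (simp_all add: unit_hopf_def dual_hopf_def)

context strict_braided_category
begin

abbreviation tensor_syntax (infixr "\<boxtimes>" 70) where
  "A \<boxtimes> B \<equiv> tensor_hopf C A B"

lemma bialgebra_axioms:
  assumes "is_bialgebra C H"
  shows "\<Delta>\<^bsub>H\<^esub> \<cdot> \<nabla>\<^bsub>H\<^esub> = (\<nabla>\<^bsub>H\<^esub> \<otimes> \<nabla>\<^bsub>H\<^esub>) \<cdot> mid (Car H) (Car H) (Car H) (Car H) \<cdot> (\<Delta>\<^bsub>H\<^esub> \<otimes> \<Delta>\<^bsub>H\<^esub>)"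
    "\<Delta>\<^bsub>H\<^esub> \<cdot> \<eta>\<^bsub>H\<^esub> = \<eta>\<^bsub>H\<^esub> \<otimes> \<eta>\<^bsub>H\<^esub>" "\<epsilon>\<^bsub>H\<^esub> \<cdot> \<nabla>\<^bsub>H\<^esub> = \<epsilon>\<^bsub>H\<^esub> \<otimes> \<epsilon>\<^bsub>H\<^esub>" "\<epsilon>\<^bsub>H\<^esub> \<cdot> \<eta>\<^bsub>H\<^esub> = Idn C (Unit C)"
  using assms unfolding is_bialgebra_def by blast+

lemma is_bialgebra_dualI:
  assumes "is_bialgebra C H"
  shows "is_bialgebra (dual_cat C) (dual_hopf H)"
proof -
  note [simp] = assms
  show ?thesis unfolding is_bialgebra_def by (simp add: bialgebra_axioms)
qed

lemma is_bialgebra_dual [simp]: "is_bialgebra (dual_cat C) (dual_hopf H) \<longleftrightarrow> is_bialgebra C H"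
proof -
  interpret d: strict_braided_category "dual_cat C" by (rule dual)
  show ?thesis using is_bialgebra_dualI[of H] d.is_bialgebra_dualI[of "dual_hopf H"] by auto
qed

lemma antipode_conv:
  assumes "is_hopf_algebra C H"
  shows "Ant H \<star>\<^bsub>H,H\<^esub> idm H = zer H H" "idm H \<star>\<^bsub>H,H\<^esub> Ant H = zer H H"
  using assms unfolding is_hopf_algebra_def conv_def cunit_def by blast+

lemma is_hopf_algebraI:
  assumes "is_bialgebra C H" "S \<in> Arr C" "Dom C S = Car H" "Cod C S = Car H" "Ant H = S"
    "S \<star>\<^bsub>H,H\<^esub> idm H = zer H H" "idm H \<star>\<^bsub>H,H\<^esub> S = zer H H"
  shows "is_hopf_algebra C H"
  using assms unfolding is_hopf_algebra_def conv_def cunit_def Mor_def by blast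

lemma is_hopf_algebra_dualI:
  assumes "is_hopf_algebra C H"
  shows "is_hopf_algebra (dual_cat C) (dual_hopf H)"
proof -
  interpret d: strict_braided_category "dual_cat C" by (rule dual)
  show ?thesis
    using assms antipode_conv[OF assms] by (intro d.is_hopf_algebraI[of _ "Ant H"]) simp_all
qed

lemma is_hopf_algebra_dual [simp]: "is_hopf_algebra (dual_cat C) (dual_hopf H) \<longleftrightarrow> is_hopf_algebra C H"
proof -
  interpret d: strict_braided_category "dual_cat C" by (rule dual)
  show ?thesis using is_hopf_algebra_dualI[of H] d.is_hopf_algebra_dualI[of "dual_hopf H"] by auto
qed

lemma tensor_coalg_hom:
  assumes f: "coalg_hom C A A' f" and g: "coalg_hom C B B' g"
    and [simp]: "is_coalgebra C A" "is_coalgebra C A'" "is_coalgebra C B" "is_coalgebra C B'"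
  shows "coalg_hom C (A \<boxtimes> B) (A' \<boxtimes> B') (f \<otimes> g)"
proof -
  note [simp] = hom_typing(4-6)[OF f] hom_typing(4-6)[OF g]
  have *: "\<Delta>\<^bsub>A'\<^esub> \<cdot> f = (f \<otimes> f) \<cdot> \<Delta>\<^bsub>A\<^esub>" "\<Delta>\<^bsub>B'\<^esub> \<cdot> g = (g \<otimes> g) \<cdot> \<Delta>\<^bsub>B\<^esub>" "\<epsilon>\<^bsub>A'\<^esub> \<cdot> f = \<epsilon>\<^bsub>A\<^esub>" "\<epsilon>\<^bsub>B'\<^esub> \<cdot> g = \<epsilon>\<^bsub>B\<^esub>"
    using f g by (simp_all add: coalg_hom_def)
  have "mid (Car A') (Car A') (Car B') (Car B') \<cdot> (\<Delta>\<^bsub>A'\<^esub> \<otimes> \<Delta>\<^bsub>B'\<^esub>) \<cdot> (f \<otimes> g)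
      = mid (Car A') (Car A') (Car B') (Car B') \<cdot> (f \<otimes> f \<otimes> g \<otimes> g) \<cdot> (\<Delta>\<^bsub>A\<^esub> \<otimes> \<Delta>\<^bsub>B\<^esub>)"
    using Ten_Cmp'[of "\<Delta>\<^bsub>A\<^esub>" "f \<otimes> f" "\<Delta>\<^bsub>B\<^esub>" "g \<otimes> g"] by (simp add: *)
  also have "\<dots> = (f \<otimes> g \<otimes> f \<otimes> g) \<cdot> mid (Car A) (Car A) (Car B) (Car B) \<cdot> (\<Delta>\<^bsub>A\<^esub> \<otimes> \<Delta>\<^bsub>B\<^esub>)"
    by (subst Cmp_reassoc[OF mid_natural]) simp_all
  finally show ?thesis unfolding coalg_hom_def by (simp add: tensor_hopf_def *)
qed

text \<open>Naturality moves the comultiplications past the inner braidings. What remains is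
  coassociativity in each factor and, for the braidings, \<open>mid_coherence\<close>.\<close>

lemma tensor_coalgebra [simp]:
  assumes [simp]: "is_coalgebra C A" "is_coalgebra C B"
  shows "is_coalgebra C (A \<boxtimes> B)"
proof -
  let ?a = "Car A" and ?b = "Car B" and ?I = "Idn C" and ?D = "Com (A \<boxtimes> B)"
  have D: "?D = mid ?a ?a ?b ?b \<cdot> (\<Delta>\<^bsub>A\<^esub> \<otimes> \<Delta>\<^bsub>B\<^esub>)" by (simp add: tensor_hopf_def)
  have A: "(\<Delta>\<^bsub>A\<^esub> \<otimes> ?I ?a) \<cdot> \<Delta>\<^bsub>A\<^esub> = (?I ?a \<otimes> \<Delta>\<^bsub>A\<^esub>) \<cdot> \<Delta>\<^bsub>A\<^esub>" "(\<epsilon>\<^bsub>A\<^esub> \<otimes> ?I ?a) \<cdot> \<Delta>\<^bsub>A\<^esub> = ?I ?a" "(?I ?a \<otimes> \<epsilon>\<^bsub>A\<^esub>) \<cdot> \<Delta>\<^bsub>A\<^esub> = ?I ?a"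
    and B: "(\<Delta>\<^bsub>B\<^esub> \<otimes> ?I ?b) \<cdot> \<Delta>\<^bsub>B\<^esub> = (?I ?b \<otimes> \<Delta>\<^bsub>B\<^esub>) \<cdot> \<Delta>\<^bsub>B\<^esub>" "(\<epsilon>\<^bsub>B\<^esub> \<otimes> ?I ?b) \<cdot> \<Delta>\<^bsub>B\<^esub> = ?I ?b"
        "(?I ?b \<otimes> \<epsilon>\<^bsub>B\<^esub>) \<cdot> \<Delta>\<^bsub>B\<^esub> = ?I ?b"
    using assms unfolding is_coalgebra_def by blast+
  have e: "?D \<otimes> ?I (?a \<odot> ?b) = (mid ?a ?a ?b ?b \<otimes> ?I (?a \<odot> ?b)) \<cdot> (\<Delta>\<^bsub>A\<^esub> \<otimes> \<Delta>\<^bsub>B\<^esub> \<otimes> ?I ?a \<otimes> ?I ?b)"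
      "?I (?a \<odot> ?b) \<otimes> ?D = (?I (?a \<odot> ?b) \<otimes> mid ?a ?a ?b ?b) \<cdot> (?I ?a \<otimes> ?I ?b \<otimes> \<Delta>\<^bsub>A\<^esub> \<otimes> \<Delta>\<^bsub>B\<^esub>)"
  proof -
    have "?D \<otimes> ?I (?a \<odot> ?b) = (mid ?a ?a ?b ?b \<otimes> ?I (?a \<odot> ?b)) \<cdot> ((\<Delta>\<^bsub>A\<^esub> \<otimes> \<Delta>\<^bsub>B\<^esub>) \<otimes> ?I (?a \<odot> ?b))"
      by (simp add: D del: Ten_assoc)
    then show "?D \<otimes> ?I (?a \<odot> ?b) = (mid ?a ?a ?b ?b \<otimes> ?I (?a \<odot> ?b)) \<cdot> (\<Delta>\<^bsub>A\<^esub> \<otimes> \<Delta>\<^bsub>B\<^esub> \<otimes> ?I ?a \<otimes> ?I ?b)"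
      by (simp add: Idn_TenO)
    have "?I (?a \<odot> ?b) \<otimes> ?D = (?I (?a \<odot> ?b) \<otimes> mid ?a ?a ?b ?b) \<cdot> (?I (?a \<odot> ?b) \<otimes> (\<Delta>\<^bsub>A\<^esub> \<otimes> \<Delta>\<^bsub>B\<^esub>))"
      by (simp add: D del: Ten_assoc)
    then show "?I (?a \<odot> ?b) \<otimes> ?D = (?I (?a \<odot> ?b) \<otimes> mid ?a ?a ?b ?b) \<cdot> (?I ?a \<otimes> ?I ?b \<otimes> \<Delta>\<^bsub>A\<^esub> \<otimes> \<Delta>\<^bsub>B\<^esub>)"
      by (simp add: Idn_TenO)
  qed
  have n: "(\<Delta>\<^bsub>A\<^esub> \<otimes> \<Delta>\<^bsub>B\<^esub> \<otimes> ?I ?a \<otimes> ?I ?b) \<cdot> mid ?a ?a ?b ?b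
      = mid (?a \<odot> ?a) ?a (?b \<odot> ?b) ?b \<cdot> (\<Delta>\<^bsub>A\<^esub> \<otimes> ?I ?a \<otimes> \<Delta>\<^bsub>B\<^esub> \<otimes> ?I ?b)"
      "(?I ?a \<otimes> ?I ?b \<otimes> \<Delta>\<^bsub>A\<^esub> \<otimes> \<Delta>\<^bsub>B\<^esub>) \<cdot> mid ?a ?a ?b ?b
        = mid ?a (?a \<odot> ?a) ?b (?b \<odot> ?b) \<cdot> (?I ?a \<otimes> \<Delta>\<^bsub>A\<^esub> \<otimes> ?I ?b \<otimes> \<Delta>\<^bsub>B\<^esub>)"
    by (subst mid_natural; simp)+
  have "(\<Delta>\<^bsub>A\<^esub> \<otimes> ?I ?a \<otimes> \<Delta>\<^bsub>B\<^esub> \<otimes> ?I ?b) \<cdot> (\<Delta>\<^bsub>A\<^esub> \<otimes> \<Delta>\<^bsub>B\<^esub>) = (?I ?a \<otimes> \<Delta>\<^bsub>A\<^esub> \<otimes> ?I ?b \<otimes> \<Delta>\<^bsub>B\<^esub>) \<cdot> (\<Delta>\<^bsub>A\<^esub> \<otimes> \<Delta>\<^bsub>B\<^esub>)"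
    using Ten_Cmp'[of "\<Delta>\<^bsub>A\<^esub>" "\<Delta>\<^bsub>A\<^esub> \<otimes> ?I ?a" "\<Delta>\<^bsub>B\<^esub>" "\<Delta>\<^bsub>B\<^esub> \<otimes> ?I ?b"] Ten_Cmp'[of "\<Delta>\<^bsub>A\<^esub>" "?I ?a \<otimes> \<Delta>\<^bsub>A\<^esub>" "\<Delta>\<^bsub>B\<^esub>"
      "?I ?b \<otimes> \<Delta>\<^bsub>B\<^esub>"]
    by (simp add: A(1) B(1))
  then have 1: "(?D \<otimes> ?I (?a \<odot> ?b)) \<cdot> ?D = (?I (?a \<odot> ?b) \<otimes> ?D) \<cdot> ?D"
    unfolding e unfolding D using Cmp_reassoc[OF n(1), of "\<Delta>\<^bsub>A\<^esub> \<otimes> \<Delta>\<^bsub>B\<^esub>"] Cmp_reassoc[OF n(2), of "\<Delta>\<^bsub>A\<^esub> \<otimes> \<Delta>\<^bsub>B\<^esub>"]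
      Cmp_reassoc[OF mid_coherence, of ?a ?b "(?I ?a \<otimes> \<Delta>\<^bsub>A\<^esub> \<otimes> ?I ?b \<otimes> \<Delta>\<^bsub>B\<^esub>) \<cdot> (\<Delta>\<^bsub>A\<^esub> \<otimes> \<Delta>\<^bsub>B\<^esub>)"]
    by (simp del: Ten_assoc Ten_Cmp' Ten_Cmp_reassoc)
  \<comment> \<open>Counits moved through the interchange turn the inner braiding into one with the
    unit, which is an identity.\<close>
  have m1: "(\<epsilon>\<^bsub>A\<^esub> \<otimes> \<epsilon>\<^bsub>B\<^esub> \<otimes> ?I ?a \<otimes> ?I ?b) \<cdot> mid ?a ?a ?b ?b = \<epsilon>\<^bsub>A\<^esub> \<otimes> ?I ?a \<otimes> \<epsilon>\<^bsub>B\<^esub> \<otimes> ?I ?b"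
  proof -
    have "(\<epsilon>\<^bsub>A\<^esub> \<otimes> \<epsilon>\<^bsub>B\<^esub> \<otimes> ?I ?a \<otimes> ?I ?b) \<cdot> mid ?a ?a ?b ?b
        = mid (Unit C) ?a (Unit C) ?b \<cdot> (\<epsilon>\<^bsub>A\<^esub> \<otimes> ?I ?a \<otimes> \<epsilon>\<^bsub>B\<^esub> \<otimes> ?I ?b)"
      by (subst mid_natural) simp_all
    also have "mid (Unit C) ?a (Unit C) ?b = ?I (?a \<odot> ?b)" by (simp add: Idn_TenO)
    finally show ?thesis by simp
  qed
  have m2: "(?I ?a \<otimes> ?I ?b \<otimes> \<epsilon>\<^bsub>A\<^esub> \<otimes> \<epsilon>\<^bsub>B\<^esub>) \<cdot> mid ?a ?a ?b ?b = ?I ?a \<otimes> \<epsilon>\<^bsub>A\<^esub> \<otimes> ?I ?b \<otimes> \<epsilon>\<^bsub>B\<^esub>"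
  proof -
    have "(?I ?a \<otimes> ?I ?b \<otimes> \<epsilon>\<^bsub>A\<^esub> \<otimes> \<epsilon>\<^bsub>B\<^esub>) \<cdot> mid ?a ?a ?b ?b
        = mid ?a (Unit C) ?b (Unit C) \<cdot> (?I ?a \<otimes> \<epsilon>\<^bsub>A\<^esub> \<otimes> ?I ?b \<otimes> \<epsilon>\<^bsub>B\<^esub>)"
      by (subst mid_natural) simp_all
    also have "mid ?a (Unit C) ?b (Unit C) = ?I (?a \<odot> ?b)" by (simp add: Idn_TenO)
    finally show ?thesis by simp
  qed
  have "(\<epsilon>\<^bsub>A\<^esub> \<otimes> ?I ?a \<otimes> \<epsilon>\<^bsub>B\<^esub> \<otimes> ?I ?b) \<cdot> (\<Delta>\<^bsub>A\<^esub> \<otimes> \<Delta>\<^bsub>B\<^esub>) = ?I ?a \<otimes> ?I ?b"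
    using Ten_Cmp'[of "\<Delta>\<^bsub>A\<^esub>" "\<epsilon>\<^bsub>A\<^esub> \<otimes> ?I ?a" "\<Delta>\<^bsub>B\<^esub>" "\<epsilon>\<^bsub>B\<^esub> \<otimes> ?I ?b"] by (simp add: A B)
  then have 2: "(\<epsilon>\<^bsub>A\<^esub> \<otimes> \<epsilon>\<^bsub>B\<^esub> \<otimes> ?I ?a \<otimes> ?I ?b) \<cdot> ?D = ?I ?a \<otimes> ?I ?b"
    unfolding D by (subst Cmp_reassoc[OF m1]) simp_all
  have "(?I ?a \<otimes> \<epsilon>\<^bsub>A\<^esub> \<otimes> ?I ?b \<otimes> \<epsilon>\<^bsub>B\<^esub>) \<cdot> (\<Delta>\<^bsub>A\<^esub> \<otimes> \<Delta>\<^bsub>B\<^esub>) = ?I ?a \<otimes> ?I ?b"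
    using Ten_Cmp'[of "\<Delta>\<^bsub>A\<^esub>" "?I ?a \<otimes> \<epsilon>\<^bsub>A\<^esub>" "\<Delta>\<^bsub>B\<^esub>" "?I ?b \<otimes> \<epsilon>\<^bsub>B\<^esub>"] by (simp add: A B)
  then have 3: "(?I ?a \<otimes> ?I ?b \<otimes> \<epsilon>\<^bsub>A\<^esub> \<otimes> \<epsilon>\<^bsub>B\<^esub>) \<cdot> ?D = ?I ?a \<otimes> ?I ?b"
    unfolding D by (subst Cmp_reassoc[OF m2]) simp_all
  have 4: "?D \<in> Arr C" "Dom C ?D = ?a \<odot> ?b" "Cod C ?D = ?a \<odot> ?b \<odot> ?a \<odot> ?b"
    by (simp_all add: D)
  show ?thesis unfolding is_coalgebra_def using 1 2 3 4 by (simp add: Idn_TenO)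
qed

lemma tensor_algebra [simp]:
  assumes "is_algebra C A" "is_algebra C B"
  shows "is_algebra C (A \<boxtimes> B)"
proof -
  interpret d: strict_braided_category "dual_cat C" by (rule dual)
  show ?thesis using d.tensor_coalgebra[of "dual_hopf A" "dual_hopf B"] assms by simp
qed

section \<open>Projections and injections of a tensor product\<close>

lemma pr_typing [simp]:
  assumes "is_coalgebra C A" "is_coalgebra C B"
  shows "pr1 C A B \<in> Arr C" "Dom C (pr1 C A B) = Car A \<odot> Car B" "Cod C (pr1 C A B) = Car A"
    "pr2 C A B \<in> Arr C" "Dom C (pr2 C A B) = Car A \<odot> Car B" "Cod C (pr2 C A B) = Car B"
  using assms by (simp_all add: pr1_def pr2_def)

lemma in_typing [simp]:
  assumes "is_algebra C A" "is_algebra C B"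
  shows "in1 C A B \<in> Arr C" "Cod C (in1 C A B) = Car A \<odot> Car B" "Dom C (in1 C A B) = Car A"
    "in2 C A B \<in> Arr C" "Cod C (in2 C A B) = Car A \<odot> Car B" "Dom C (in2 C A B) = Car B"
  using assms by (simp_all add: in1_def in2_def)

lemma unit_hopf_structure [simp]: "is_algebra C (unit_hopf C)" "is_coalgebra C (unit_hopf C)"
  by (simp_all add: is_algebra_def is_coalgebra_def)

text \<open>Identifies \<open>A\<close> with its tensor product with the unit as a coalgebra, so
  that projections and injections are tensor products of an identity with a counit or unit, and
  \<open>tensor_coalg_hom\<close> applies to them.\<close>

lemma Com_tensor_unit:
  assumes [simp]: "is_coalgebra C A"
  shows "Com (A \<boxtimes> unit_hopf C) = \<Delta>\<^bsub>A\<^esub>" "Com (unit_hopf C \<boxtimes> A) = \<Delta>\<^bsub>A\<^esub>"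
  by (simp_all add: tensor_hopf_def Idn_TenO[symmetric])

lemma Com_tensor_typing [simp]:
  assumes "is_coalgebra C A" "is_coalgebra C B"
  shows "Com (A \<boxtimes> B) \<in> Arr C" "Dom C (Com (A \<boxtimes> B)) = Car A \<odot> Car B"
    "Cod C (Com (A \<boxtimes> B)) = Car A \<odot> Car B \<odot> Car A \<odot> Car B"
  using coalgebra_typing(2-4)[OF tensor_coalgebra[OF assms]] assms by simp_all

text \<open>The counits hit either the two inner factors, where the braiding disappears, or the two
  outer ones, where it survives. This asymmetry is what translates \<open>\<curlyvee>\<close> into
  commutation under convolution.\<close>

lemma pr_Com:
  assumes [simp]: "is_coalgebra C A" "is_coalgebra C B"
  shows "(pr1 C A B \<otimes> pr2 C A B) \<cdot> Com (A \<boxtimes> B) = Idn C (Car A \<odot> Car B)"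
    and "(pr2 C A B \<otimes> pr1 C A B) \<cdot> Com (A \<boxtimes> B) = \<tau> (Car A) (Car B)"
proof -
  let ?a = "Car A" and ?b = "Car B" and ?I = "Idn C" and ?M = "mid (Car A) (Car A) (Car B) (Car B)"
  have D: "Com (A \<boxtimes> B) = ?M \<cdot> (\<Delta>\<^bsub>A\<^esub> \<otimes> \<Delta>\<^bsub>B\<^esub>)" by (simp add: tensor_hopf_def)
  have A: "(\<epsilon>\<^bsub>A\<^esub> \<otimes> ?I ?a) \<cdot> \<Delta>\<^bsub>A\<^esub> = ?I ?a" "(?I ?a \<otimes> \<epsilon>\<^bsub>A\<^esub>) \<cdot> \<Delta>\<^bsub>A\<^esub> = ?I ?a"
    and B: "(\<epsilon>\<^bsub>B\<^esub> \<otimes> ?I ?b) \<cdot> \<Delta>\<^bsub>B\<^esub> = ?I ?b" "(?I ?b \<otimes> \<epsilon>\<^bsub>B\<^esub>) \<cdot> \<Delta>\<^bsub>B\<^esub> = ?I ?b"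
    using assms unfolding is_coalgebra_def by blast+
  have "(?I ?a \<otimes> \<epsilon>\<^bsub>B\<^esub> \<otimes> \<epsilon>\<^bsub>A\<^esub> \<otimes> ?I ?b) \<cdot> ?M = mid ?a (Unit C) (Unit C) ?b \<cdot> (?I ?a \<otimes> \<epsilon>\<^bsub>A\<^esub> \<otimes> \<epsilon>\<^bsub>B\<^esub> \<otimes> ?I ?b)"
    by (subst mid_natural) simp_all
  then have "(pr1 C A B \<otimes> pr2 C A B) \<cdot> ?M = (?I ?a \<otimes> \<epsilon>\<^bsub>A\<^esub>) \<otimes> (\<epsilon>\<^bsub>B\<^esub> \<otimes> ?I ?b)"
    by (simp add: pr1_def pr2_def)
  then have "(pr1 C A B \<otimes> pr2 C A B) \<cdot> Com (A \<boxtimes> B) = ((?I ?a \<otimes> \<epsilon>\<^bsub>A\<^esub>) \<otimes> (\<epsilon>\<^bsub>B\<^esub> \<otimes> ?I ?b)) \<cdot> (\<Delta>\<^bsub>A\<^esub> \<otimes> \<Delta>\<^bsub>B\<^esub>)"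
    unfolding D by (rule Cmp_reassoc) (simp_all add: pr1_def pr2_def)
  also have "\<dots> = Idn C (Car A \<odot> Car B)"
    by (subst Ten_Cmp') (simp_all add: A B Idn_TenO)
  finally show "(pr1 C A B \<otimes> pr2 C A B) \<cdot> Com (A \<boxtimes> B) = Idn C (Car A \<odot> Car B)" .
  have "(\<epsilon>\<^bsub>A\<^esub> \<otimes> ?I ?b \<otimes> ?I ?a \<otimes> \<epsilon>\<^bsub>B\<^esub>) \<cdot> ?M = mid (Unit C) ?a ?b (Unit C) \<cdot> (\<epsilon>\<^bsub>A\<^esub> \<otimes> ?I ?a \<otimes> ?I ?b \<otimes> \<epsilon>\<^bsub>B\<^esub>)"
    by (subst mid_natural) simp_all
  then have "(pr2 C A B \<otimes> pr1 C A B) \<cdot> ?M = \<tau> ?a ?b \<cdot> ((\<epsilon>\<^bsub>A\<^esub> \<otimes> ?I ?a) \<otimes> (?I ?b \<otimes> \<epsilon>\<^bsub>B\<^esub>))"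
    by (simp add: pr1_def pr2_def)
  then have "(pr2 C A B \<otimes> pr1 C A B) \<cdot> Com (A \<boxtimes> B)
      = (\<tau> ?a ?b \<cdot> ((\<epsilon>\<^bsub>A\<^esub> \<otimes> ?I ?a) \<otimes> (?I ?b \<otimes> \<epsilon>\<^bsub>B\<^esub>))) \<cdot> (\<Delta>\<^bsub>A\<^esub> \<otimes> \<Delta>\<^bsub>B\<^esub>)"
    unfolding D by (rule Cmp_reassoc) (simp_all add: pr1_def pr2_def)
  also have "\<dots> = \<tau> ?a ?b \<cdot> ((\<epsilon>\<^bsub>A\<^esub> \<otimes> ?I ?a) \<otimes> (?I ?b \<otimes> \<epsilon>\<^bsub>B\<^esub>)) \<cdot> (\<Delta>\<^bsub>A\<^esub> \<otimes> \<Delta>\<^bsub>B\<^esub>)"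
    by simp
  also have "\<dots> = \<tau> (Car A) (Car B)"
    by (subst Ten_Cmp') (simp_all add: A B Ten_Idn)
  finally show "(pr2 C A B \<otimes> pr1 C A B) \<cdot> Com (A \<boxtimes> B) = \<tau> (Car A) (Car B)" .
qed

text \<open>Multiplying a tensor product of morphisms becomes a convolution over
  \<open>A \<boxtimes> B\<close>, in either order, so that facts about \<open>\<nabla>\<close> can
  be derived in a convolution monoid.\<close>

lemma conv_pr:
  assumes [simp]: "is_coalgebra C A" "is_coalgebra C B" "is_algebra C D" "x \<in> Arr C" "y \<in> Arr C"
    "Dom C x = Car A" "Dom C y = Car B" "Cod C x = Car D" "Cod C y = Car D"
  shows "(x \<cdot> pr1 C A B) \<star>\<^bsub>A \<boxtimes> B,D\<^esub> (y \<cdot> pr2 C A B) = \<nabla>\<^bsub>D\<^esub> \<cdot> (x \<otimes> y)"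
    and "(y \<cdot> pr2 C A B) \<star>\<^bsub>A \<boxtimes> B,D\<^esub> (x \<cdot> pr1 C A B) = \<nabla>\<^bsub>D\<^esub> \<cdot> (y \<otimes> x) \<cdot> \<tau> (Car A) (Car B)"
proof -
  have "(x \<cdot> pr1 C A B) \<star>\<^bsub>A \<boxtimes> B,D\<^esub> (y \<cdot> pr2 C A B) = \<nabla>\<^bsub>D\<^esub> \<cdot> (x \<otimes> y) \<cdot> (pr1 C A B \<otimes> pr2 C A B) \<cdot> Com (A \<boxtimes> B)"
    by (simp add: conv_def)
  then show "(x \<cdot> pr1 C A B) \<star>\<^bsub>A \<boxtimes> B,D\<^esub> (y \<cdot> pr2 C A B) = \<nabla>\<^bsub>D\<^esub> \<cdot> (x \<otimes> y)"
    by (simp only: pr_Com assms) simp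
  have "(y \<cdot> pr2 C A B) \<star>\<^bsub>A \<boxtimes> B,D\<^esub> (x \<cdot> pr1 C A B) = \<nabla>\<^bsub>D\<^esub> \<cdot> (y \<otimes> x) \<cdot> (pr2 C A B \<otimes> pr1 C A B) \<cdot> Com (A \<boxtimes> B)"
    by (simp add: conv_def)
  then show "(y \<cdot> pr2 C A B) \<star>\<^bsub>A \<boxtimes> B,D\<^esub> (x \<cdot> pr1 C A B) = \<nabla>\<^bsub>D\<^esub> \<cdot> (y \<otimes> x) \<cdot> \<tau> (Car A) (Car B)"
    by (simp only: pr_Com assms)
qed

lemma coalg_hom_unit:
  "is_coalgebra C A \<Longrightarrow> coalg_hom C A (unit_hopf C) \<epsilon>\<^bsub>A\<^esub>"
  "is_bialgebra C A \<Longrightarrow> coalg_hom C (unit_hopf C) A \<eta>\<^bsub>A\<^esub>"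
proof -
  assume [simp]: "is_coalgebra C A"
  have "\<epsilon>\<^bsub>A\<^esub> \<cdot> (idm A \<otimes> \<epsilon>\<^bsub>A\<^esub>) = \<epsilon>\<^bsub>A\<^esub> \<otimes> \<epsilon>\<^bsub>A\<^esub>"
    using Ten_Cmp'[of "idm A" "\<epsilon>\<^bsub>A\<^esub>" "\<epsilon>\<^bsub>A\<^esub>" "Idn C (Unit C)"] by simp
  from Cmp_reassoc[OF this, of "\<Delta>\<^bsub>A\<^esub>"]
  have "(\<epsilon>\<^bsub>A\<^esub> \<otimes> \<epsilon>\<^bsub>A\<^esub>) \<cdot> \<Delta>\<^bsub>A\<^esub> = \<epsilon>\<^bsub>A\<^esub> \<cdot> (idm A \<otimes> \<epsilon>\<^bsub>A\<^esub>) \<cdot> \<Delta>\<^bsub>A\<^esub>"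
    by simp
  also have "(idm A \<otimes> \<epsilon>\<^bsub>A\<^esub>) \<cdot> \<Delta>\<^bsub>A\<^esub> = idm A"
    using \<open>is_coalgebra C A\<close> unfolding is_coalgebra_def by blast
  finally show "coalg_hom C A (unit_hopf C) \<epsilon>\<^bsub>A\<^esub>"
    by (simp add: coalg_hom_def)
next
  assume "is_bialgebra C A"
  then show "coalg_hom C (unit_hopf C) A \<eta>\<^bsub>A\<^esub>"
    using bialgebra_axioms[of A] by (simp add: coalg_hom_def)
qed

lemma pr_coalg_hom:
  assumes [simp]: "is_coalgebra C A" "is_coalgebra C B"
  shows "coalg_hom C (A \<boxtimes> B) A (pr1 C A B)" "coalg_hom C (A \<boxtimes> B) B (pr2 C A B)"
  using tensor_coalg_hom[OF Idn_hom(2) coalg_hom_unit(1), of A B]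
    tensor_coalg_hom[OF coalg_hom_unit(1) Idn_hom(2), of A B]
  by (simp_all add: pr1_def pr2_def coalg_hom_def Com_tensor_unit)

lemma in_coalg_hom:
  assumes [simp]: "is_coalgebra C A" "is_coalgebra C B"
  shows "is_bialgebra C B \<Longrightarrow> coalg_hom C A (A \<boxtimes> B) (in1 C A B)"
    "is_bialgebra C A \<Longrightarrow> coalg_hom C B (A \<boxtimes> B) (in2 C A B)"
  using tensor_coalg_hom[OF Idn_hom(2) coalg_hom_unit(2), of A B]
    tensor_coalg_hom[OF coalg_hom_unit(2) Idn_hom(2), of A B]
  by (simp_all add: in1_def in2_def coalg_hom_def Com_tensor_unit)

lemma in_alg_hom:
  assumes "is_algebra C A" "is_algebra C B"
  shows "alg_hom C A (A \<boxtimes> B) (in1 C A B)" "alg_hom C B (A \<boxtimes> B) (in2 C A B)"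
proof -
  interpret d: strict_braided_category "dual_cat C" by (rule dual)
  show "alg_hom C A (A \<boxtimes> B) (in1 C A B)" "alg_hom C B (A \<boxtimes> B) (in2 C A B)"
    using d.pr_coalg_hom[of "dual_hopf A" "dual_hopf B"] assms by simp_all
qed

lemma pr_alg_hom:
  assumes "is_algebra C A" "is_algebra C B"
  shows "is_bialgebra C B \<Longrightarrow> alg_hom C (A \<boxtimes> B) A (pr1 C A B)"
    "is_bialgebra C A \<Longrightarrow> alg_hom C (A \<boxtimes> B) B (pr2 C A B)"
proof -
  interpret d: strict_braided_category "dual_cat C" by (rule dual)
  show "is_bialgebra C B \<Longrightarrow> alg_hom C (A \<boxtimes> B) A (pr1 C A B)"
    "is_bialgebra C A \<Longrightarrow> alg_hom C (A \<boxtimes> B) B (pr2 C A B)"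
    using d.in_coalg_hom[of "dual_hopf A" "dual_hopf B"] assms by simp_all
qed

lemma in_pr_hopf_Hom:
  assumes "is_bialgebra C A" "is_bialgebra C B"
  shows "in1 C A B \<in> Hom A (A \<boxtimes> B)" "in2 C A B \<in> Hom B (A \<boxtimes> B)"
    "pr1 C A B \<in> Hom (A \<boxtimes> B) A" "pr2 C A B \<in> Hom (A \<boxtimes> B) B"
  using assms by (simp_all add: hopf_Hom_iff in_alg_hom in_coalg_hom pr_alg_hom pr_coalg_hom)

lemma pr_in:
  assumes [simp]: "is_bialgebra C A" "is_bialgebra C B"
  shows "pr1 C A B \<cdot> in1 C A B = idm A" "pr2 C A B \<cdot> in2 C A B = idm B"
    "pr1 C A B \<cdot> in2 C A B = zer B A" "pr2 C A B \<cdot> in1 C A B = zer A B"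
proof -
  note [simp] = bialgebra_axioms(4)
  show "pr1 C A B \<cdot> in1 C A B = idm A" "pr2 C A B \<cdot> in2 C A B = idm B"
    by (simp_all add: pr1_def pr2_def in1_def in2_def)
  show "pr1 C A B \<cdot> in2 C A B = zer B A" "pr2 C A B \<cdot> in1 C A B = zer A B"
    using Ten_Cmp'[of "Idn C (Unit C)" "\<eta>\<^bsub>A\<^esub>" "\<epsilon>\<^bsub>B\<^esub>" "Idn C (Unit C)"]
      Ten_Cmp'[of "\<epsilon>\<^bsub>A\<^esub>" "Idn C (Unit C)" "Idn C (Unit C)" "\<eta>\<^bsub>B\<^esub>"]
    by (simp_all add: pr1_def pr2_def in1_def in2_def cunit_def)
qed

text \<open>The biproduct identity in additive notation. After \<open>conv_pr\<close> it is the dual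
  of the first part of \<open>pr_Com\<close>.\<close>

lemma in_pr_conv:
  assumes [simp]: "is_bialgebra C A" "is_bialgebra C B"
  shows "(in1 C A B \<cdot> pr1 C A B) \<star>\<^bsub>A \<boxtimes> B,A \<boxtimes> B\<^esub> (in2 C A B \<cdot> pr2 C A B) = Idn C (Car A \<odot> Car B)"
proof -
  interpret d: strict_braided_category "dual_cat C" by (rule dual)
  show ?thesis
    using d.pr_Com(1)[of "dual_hopf A" "dual_hopf B"] by (subst conv_pr(1)) simp_all
qed

end

section \<open>Commuting morphisms\<close>

text \<open>
  For unbraided domains, \<open>f \<curlyvee> g\<close> and \<open>g \<curlyvee> f\<close> are equivalent. In general both are needed: it is the
  symmetric relation which forces the factors of a tensor decomposition to be unbraided.
\<close>

definition bicommuting ::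
  "('o, 'm, 'z) braided_cat_scheme \<Rightarrow> ('o, 'm) hopf \<Rightarrow> 'm \<Rightarrow> 'm \<Rightarrow> bool" where
  "bicommuting C A f g \<longleftrightarrow> commuting C A f g \<and> commuting C A g f"

definition bicocommuting ::
  "('o, 'm, 'z) braided_cat_scheme \<Rightarrow> ('o, 'm) hopf \<Rightarrow> 'm \<Rightarrow> 'm \<Rightarrow> bool" where
  "bicocommuting C X f g \<longleftrightarrow> cocommuting C X f g \<and> cocommuting C X g f"

lemma bicommuting_sym: "bicommuting C A f g \<Longrightarrow> bicommuting C A g f"
  and bicocommuting_sym: "bicocommuting C X f g \<Longrightarrow> bicocommuting C X g f"
  by (auto simp: bicommuting_def bicocommuting_def)

lemma unbraided_dual [simp]: "unbraided (dual_cat C) A B \<longleftrightarrow> unbraided C A B"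
  by (auto simp: unbraided_def mutually_inverse_def Mor_def)

lemma unbraided_sym: "unbraided C A B \<Longrightarrow> unbraided C B A"
  by (auto simp: unbraided_def mutually_inverse_def Mor_def)

context strict_braided_category
begin

lemma Hom_typing:
  assumes "f \<in> Hom A B"
  shows "f \<in> Arr C" "Dom C f = Car A" "Cod C f = Car B"
  using assms by (auto simp: hopf_Hom_iff hom_typing)

lemma commuting_dual [simp]:
  assumes "is_coalgebra C X" "f \<in> Arr C" "g \<in> Arr C" "Dom C f = Car X" "Dom C g = Car X"
  shows "commuting (dual_cat C) (dual_hopf X) f g \<longleftrightarrow> cocommuting C X f g"
  using assms by (simp add: commuting_def cocommuting_def)

lemma bicommuting_dual [simp]:
  assumes "is_coalgebra C X" "f \<in> Arr C" "g \<in> Arr C" "Dom C f = Car X" "Dom C g = Car X"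
  shows "bicommuting (dual_cat C) (dual_hopf X) f g \<longleftrightarrow> bicocommuting C X f g"
  using assms by (simp add: bicommuting_def bicocommuting_def)

text \<open>This reduces closure properties of \<open>\<curlyvee>\<close> to computations in a monoid.\<close>

lemma commuting_iff_conv:
  assumes "is_algebra C D" "is_coalgebra C X" "is_coalgebra C Y" "f \<in> Arr C" "g \<in> Arr C"
    "Dom C f = Car X" "Dom C g = Car Y" "Cod C f = Car D" "Cod C g = Car D"
  shows "commuting C D f g \<longleftrightarrow>
    (g \<cdot> pr1 C Y X) \<star>\<^bsub>Y \<boxtimes> X,D\<^esub> (f \<cdot> pr2 C Y X) = (f \<cdot> pr2 C Y X) \<star>\<^bsub>Y \<boxtimes> X,D\<^esub> (g \<cdot> pr1 C Y X)"
  using assms by (simp add: commuting_def conv_pr)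

lemma commuting_precomp:
  assumes "commuting C D f g" and [simp]: "is_algebra C D" "f \<in> Arr C" "g \<in> Arr C" "h \<in> Arr C"
      "k \<in> Arr C"
    "Cod C f = Car D" "Cod C g = Car D" "Cod C h = Dom C f" "Cod C k = Dom C g"
  shows "commuting C D (f \<cdot> h) (g \<cdot> k)"
proof -
  have "\<nabla>\<^bsub>D\<^esub> \<cdot> ((g \<cdot> k) \<otimes> (f \<cdot> h)) = (\<nabla>\<^bsub>D\<^esub> \<cdot> (g \<otimes> f)) \<cdot> (k \<otimes> h)" by simp
  also have "\<dots> = \<nabla>\<^bsub>D\<^esub> \<cdot> (f \<otimes> g) \<cdot> \<tau> (Dom C g) (Dom C f) \<cdot> (k \<otimes> h)"
    using assms(1) unfolding commuting_def by (simp del: Ten_Cmp' Ten_Cmp_reassoc)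
  also have "\<dots> = \<nabla>\<^bsub>D\<^esub> \<cdot> (f \<otimes> g) \<cdot> (h \<otimes> k) \<cdot> \<tau> (Dom C k) (Dom C h)"
    by (simp add: Brd_nat)
  also have "\<dots> = \<nabla>\<^bsub>D\<^esub> \<cdot> ((f \<cdot> h) \<otimes> (g \<cdot> k)) \<cdot> \<tau> (Dom C k) (Dom C h)" by simp
  finally show ?thesis by (simp add: commuting_def)
qed

lemma commuting_alg_hom:
  assumes "commuting C D f g" "alg_hom C D E u" and [simp]: "is_algebra C D" "is_algebra C E"
    "f \<in> Arr C" "g \<in> Arr C" "Cod C f = Car D" "Cod C g = Car D"
  shows "commuting C E (u \<cdot> f) (u \<cdot> g)"
proof -
  note [simp] = hom_typing(1-3)[OF assms(2)]
  have u: "\<nabla>\<^bsub>E\<^esub> \<cdot> (u \<otimes> u) = u \<cdot> \<nabla>\<^bsub>D\<^esub>" using assms(2) by (simp add: alg_hom_def)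
  have *: "\<nabla>\<^bsub>E\<^esub> \<cdot> ((u \<cdot> x) \<otimes> (u \<cdot> y)) = u \<cdot> \<nabla>\<^bsub>D\<^esub> \<cdot> (x \<otimes> y)"
    if "x \<in> Arr C" "y \<in> Arr C" "Cod C x = Car D" "Cod C y = Car D" for x y
    using Cmp_reassoc[OF u, of "x \<otimes> y"] that by simp
  have **: "\<nabla>\<^bsub>E\<^esub> \<cdot> ((u \<cdot> f) \<otimes> (u \<cdot> g)) \<cdot> t = u \<cdot> \<nabla>\<^bsub>D\<^esub> \<cdot> (f \<otimes> g) \<cdot> t"
    if "t \<in> Arr C" "Cod C t = Dom C f \<odot> Dom C g" for t
    using Cmp_reassoc[OF *, of f g t] that by simp
  show ?thesis using assms(1) unfolding commuting_def by (simp add: * **)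
qed

lemma conv_commutes_mult:
  assumes "h \<star>\<^bsub>X,A\<^esub> f = f \<star>\<^bsub>X,A\<^esub> h" "h \<star>\<^bsub>X,A\<^esub> g = g \<star>\<^bsub>X,A\<^esub> h"
    and [simp]: "is_coalgebra C X" "is_algebra C A" "f \<in> Arr C" "g \<in> Arr C" "h \<in> Arr C"
    "Dom C f = Car X" "Dom C g = Car X" "Dom C h = Car X" "Cod C f = Car A" "Cod C g = Car A"
      "Cod C h = Car A"
  shows "h \<star>\<^bsub>X,A\<^esub> (f \<star>\<^bsub>X,A\<^esub> g) = (f \<star>\<^bsub>X,A\<^esub> g) \<star>\<^bsub>X,A\<^esub> h"
proof -
  have "h \<star>\<^bsub>X,A\<^esub> (f \<star>\<^bsub>X,A\<^esub> g) = (h \<star>\<^bsub>X,A\<^esub> f) \<star>\<^bsub>X,A\<^esub> g" by (simp add: conv_assoc)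
  also have "\<dots> = f \<star>\<^bsub>X,A\<^esub> (h \<star>\<^bsub>X,A\<^esub> g)" unfolding assms(1) by (simp add: conv_assoc)
  also have "\<dots> = (f \<star>\<^bsub>X,A\<^esub> g) \<star>\<^bsub>X,A\<^esub> h" unfolding assms(2) by (simp add: conv_assoc)
  finally show ?thesis .
qed

lemma commuting_conv_left:
  assumes "commuting C D f h" "commuting C D g h"
    and [simp]: "is_algebra C D" "is_coalgebra C X" "is_coalgebra C Y" "f \<in> Arr C" "g \<in> Arr C"
        "h \<in> Arr C"
    "Dom C f = Car X" "Dom C g = Car X" "Dom C h = Car Y" "Cod C f = Car D" "Cod C g = Car D"
      "Cod C h = Car D"
  shows "commuting C D (f \<star>\<^bsub>X,D\<^esub> g) h"
  using assms(1,2) conv_commutes_mult[of "Y \<boxtimes> X" D "h \<cdot> pr1 C Y X" "f \<cdot> pr2 C Y X" "g \<cdot> pr2 C Y X"]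
  by (simp add: commuting_iff_conv[of D X Y] coalg_hom_conv[OF pr_coalg_hom(2)[of Y X], of D f g])

lemma commuting_conv_right:
  assumes "commuting C D h f" "commuting C D h g"
    and [simp]: "is_algebra C D" "is_coalgebra C X" "is_coalgebra C Y" "f \<in> Arr C" "g \<in> Arr C"
        "h \<in> Arr C"
    "Dom C f = Car X" "Dom C g = Car X" "Dom C h = Car Y" "Cod C f = Car D" "Cod C g = Car D"
      "Cod C h = Car D"
  shows "commuting C D h (f \<star>\<^bsub>X,D\<^esub> g)"
  using assms(1,2) conv_commutes_mult[of "X \<boxtimes> Y" D "h \<cdot> pr2 C X Y" "f \<cdot> pr1 C X Y" "g \<cdot> pr1 C X Y"]
  by (simp add: commuting_iff_conv[of D Y X] coalg_hom_conv[OF pr_coalg_hom(1)[of X Y], of D f g])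

lemma commuting_swap:
  assumes "commuting C D f g" "unbraided C (Dom C f) (Dom C g)" and [simp]: "is_algebra C D" "f \<in> Arr C"
      "g \<in> Arr C"
    "Cod C f = Car D" "Cod C g = Car D"
  shows "commuting C D g f"
proof -
  have t: "\<tau> (Dom C g) (Dom C f) \<cdot> \<tau> (Dom C f) (Dom C g) = Idn C (Dom C f \<odot> Dom C g)"
    using assms(2) by (simp add: unbraided_def mutually_inverse_def)
  have "\<nabla>\<^bsub>D\<^esub> \<cdot> (g \<otimes> f) \<cdot> \<tau> (Dom C f) (Dom C g) = (\<nabla>\<^bsub>D\<^esub> \<cdot> (g \<otimes> f)) \<cdot> \<tau> (Dom C f) (Dom C g)" by simp
  also have "\<dots> = (\<nabla>\<^bsub>D\<^esub> \<cdot> (f \<otimes> g) \<cdot> \<tau> (Dom C g) (Dom C f)) \<cdot> \<tau> (Dom C f) (Dom C g)"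
    using assms(1) by (simp only: commuting_def)
  also have "\<dots> = \<nabla>\<^bsub>D\<^esub> \<cdot> (f \<otimes> g)" by (simp add: t)
  finally show ?thesis by (simp add: commuting_def)
qed

lemma bicommuting_precomp:
  assumes "bicommuting C D f g" "is_algebra C D" "f \<in> Arr C" "g \<in> Arr C" "h \<in> Arr C" "k \<in> Arr C"
    "Cod C f = Car D" "Cod C g = Car D" "Cod C h = Dom C f" "Cod C k = Dom C g"
  shows "bicommuting C D (f \<cdot> h) (g \<cdot> k)"
  using assms by (auto simp: bicommuting_def intro: commuting_precomp)

lemma bicommuting_alg_hom:
  assumes "bicommuting C D f g" "alg_hom C D E u" "is_algebra C D" "is_algebra C E"
    "f \<in> Arr C" "g \<in> Arr C" "Cod C f = Car D" "Cod C g = Car D"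
  shows "bicommuting C E (u \<cdot> f) (u \<cdot> g)"
  using assms by (auto simp: bicommuting_def intro: commuting_alg_hom)

lemma bicommuting_conv:
  assumes "bicommuting C D f h" "bicommuting C D g h"
    "is_algebra C D" "is_coalgebra C X" "is_coalgebra C Y" "f \<in> Arr C" "g \<in> Arr C" "h \<in> Arr C"
    "Dom C f = Car X" "Dom C g = Car X" "Dom C h = Car Y" "Cod C f = Car D" "Cod C g = Car D"
      "Cod C h = Car D"
  shows "bicommuting C D (f \<star>\<^bsub>X,D\<^esub> g) h"
  using assms commuting_conv_left[of D f h g X Y] commuting_conv_right[of D h f g X Y]
    by (simp add: bicommuting_def)

lemma bicommutingI_unbraided:
  assumes "commuting C D f g" "unbraided C (Dom C f) (Dom C g)" "is_algebra C D" "f \<in> Arr C" "g \<in> Arr C"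
    "Cod C f = Car D" "Cod C g = Car D"
  shows "bicommuting C D f g"
  using assms commuting_swap[OF assms] by (simp add: bicommuting_def)

lemma bicocommuting_postcomp:
  assumes "bicocommuting C X f g" "is_coalgebra C X" "f \<in> Arr C" "g \<in> Arr C" "h \<in> Arr C" "k \<in> Arr C"
    "Dom C f = Car X" "Dom C g = Car X" "Dom C h = Cod C f" "Dom C k = Cod C g"
  shows "bicocommuting C X (h \<cdot> f) (k \<cdot> g)"
proof -
  interpret d: strict_braided_category "dual_cat C" by (rule dual)
  show ?thesis using d.bicommuting_precomp[of "dual_hopf X" f g h k] assms by simp
qed

lemma bicocommuting_coalg_hom:
  assumes "bicocommuting C X f g" "coalg_hom C Y X u" "is_coalgebra C X" "is_coalgebra C Y"
    "f \<in> Arr C" "g \<in> Arr C" "Dom C f = Car X" "Dom C g = Car X"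
  shows "bicocommuting C Y (f \<cdot> u) (g \<cdot> u)"
proof -
  interpret d: strict_braided_category "dual_cat C" by (rule dual)
  show ?thesis
    using d.bicommuting_alg_hom[of "dual_hopf X" f g "dual_hopf Y" u] assms hom_typing(4-6)[OF assms(2)]
      by simp
qed

lemma bicocommuting_conv:
  assumes "bicocommuting C X f h" "bicocommuting C X g h"
    "is_coalgebra C X" "is_algebra C D" "is_algebra C E" "f \<in> Arr C" "g \<in> Arr C" "h \<in> Arr C"
    "Cod C f = Car D" "Cod C g = Car D" "Cod C h = Car E" "Dom C f = Car X" "Dom C g = Car X"
      "Dom C h = Car X"
  shows "bicocommuting C X (f \<star>\<^bsub>X,D\<^esub> g) h"
proof -
  interpret d: strict_braided_category "dual_cat C" by (rule dual)
  show ?thesis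
    using d.bicommuting_conv[of "dual_hopf X" f h g "dual_hopf D" "dual_hopf E"] assms by simp
qed

lemma bicocommutingI_unbraided:
  assumes "cocommuting C X f g" "unbraided C (Cod C f) (Cod C g)" "is_coalgebra C X" "f \<in> Arr C"
      "g \<in> Arr C"
    "Dom C f = Car X" "Dom C g = Car X"
  shows "bicocommuting C X f g"
proof -
  interpret d: strict_braided_category "dual_cat C" by (rule dual)
  show ?thesis using d.bicommutingI_unbraided[of "dual_hopf X" f g] assms by simp
qed

text \<open>The braiding introduced by \<open>\<curlywedge>\<close> passes through the pair of
  morphisms by naturality and is then absorbed by \<open>\<curlyvee>\<close>.\<close>

lemma conv_commute:
  assumes "bicommuting C A f g" "bicocommuting C X f g"
    and [simp]: "is_coalgebra C X" "is_algebra C A" "f \<in> Arr C" "g \<in> Arr C"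
    "Dom C f = Car X" "Dom C g = Car X" "Cod C f = Car A" "Cod C g = Car A"
  shows "f \<star>\<^bsub>X,A\<^esub> g = g \<star>\<^bsub>X,A\<^esub> f"
proof -
  have 1: "(f \<otimes> g) \<cdot> \<Delta>\<^bsub>X\<^esub> = \<tau> (Car A) (Car A) \<cdot> (g \<otimes> f) \<cdot> \<Delta>\<^bsub>X\<^esub>"
    using assms(2)[unfolded bicocommuting_def cocommuting_def, THEN conjunct2] by simp
  have n: "\<tau> (Car A) (Car A) \<cdot> (g \<otimes> f) = (f \<otimes> g) \<cdot> \<tau> (Car X) (Car X)"
    by (simp add: Brd_nat)
  have 2: "(f \<otimes> g) \<cdot> \<Delta>\<^bsub>X\<^esub> = (f \<otimes> g) \<cdot> \<tau> (Car X) (Car X) \<cdot> \<Delta>\<^bsub>X\<^esub>"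
    unfolding 1 by (subst Cmp_reassoc[OF n]) simp_all
  have "\<nabla>\<^bsub>A\<^esub> \<cdot> (g \<otimes> f) = \<nabla>\<^bsub>A\<^esub> \<cdot> (f \<otimes> g) \<cdot> \<tau> (Car X) (Car X)"
    using assms(1)[unfolded bicommuting_def commuting_def, THEN conjunct1] by simp
  then have "\<nabla>\<^bsub>A\<^esub> \<cdot> (g \<otimes> f) \<cdot> \<Delta>\<^bsub>X\<^esub> = (\<nabla>\<^bsub>A\<^esub> \<cdot> (f \<otimes> g) \<cdot> \<tau> (Car X) (Car X)) \<cdot> \<Delta>\<^bsub>X\<^esub>"
    by (rule Cmp_reassoc) simp_all
  also have "\<dots> = \<nabla>\<^bsub>A\<^esub> \<cdot> (f \<otimes> g) \<cdot> \<Delta>\<^bsub>X\<^esub>" by (simp only: 2) simp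
  finally show ?thesis by (simp add: conv_def)
qed

text \<open>In a product of four factors the inner two may be multiplied first, and there
  \<open>commuting\<close> exchanges \<open>i\<close> and \<open>j\<close>. This is how two
  commuting morphisms combine to one on the tensor product.\<close>

lemma alg_hom_Mul:
  assumes i: "alg_hom C A D i" and j: "alg_hom C B D j" and c: "commuting C D i j"
    and [simp]: "is_algebra C A" "is_algebra C B" "is_algebra C D"
  shows "alg_hom C (A \<boxtimes> B) D (\<nabla>\<^bsub>D\<^esub> \<cdot> (i \<otimes> j))"
proof -
  let ?d = "idm D"
  note [simp] = hom_typing(1-3)[OF i] hom_typing(1-3)[OF j]
  have a: "\<nabla>\<^bsub>D\<^esub> \<cdot> (\<nabla>\<^bsub>D\<^esub> \<otimes> ?d) = \<nabla>\<^bsub>D\<^esub> \<cdot> (?d \<otimes> \<nabla>\<^bsub>D\<^esub>)" and u: "\<nabla>\<^bsub>D\<^esub> \<cdot> (\<eta>\<^bsub>D\<^esub> \<otimes> ?d) = ?d"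
    using \<open>is_algebra C D\<close> unfolding is_algebra_def by blast+
  have hi: "i \<cdot> \<nabla>\<^bsub>A\<^esub> = \<nabla>\<^bsub>D\<^esub> \<cdot> (i \<otimes> i)" "i \<cdot> \<eta>\<^bsub>A\<^esub> = \<eta>\<^bsub>D\<^esub>" using i by (simp_all add: alg_hom_def)
  have hj: "j \<cdot> \<nabla>\<^bsub>B\<^esub> = \<nabla>\<^bsub>D\<^esub> \<cdot> (j \<otimes> j)" "j \<cdot> \<eta>\<^bsub>B\<^esub> = \<eta>\<^bsub>D\<^esub>" using j by (simp_all add: alg_hom_def)
  have four: "\<nabla>\<^bsub>D\<^esub> \<cdot> (\<nabla>\<^bsub>D\<^esub> \<otimes> \<nabla>\<^bsub>D\<^esub>) = \<nabla>\<^bsub>D\<^esub> \<cdot> (?d \<otimes> \<nabla>\<^bsub>D\<^esub>) \<cdot> (?d \<otimes> \<nabla>\<^bsub>D\<^esub> \<otimes> ?d)"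
  proof -
    have "\<nabla>\<^bsub>D\<^esub> \<cdot> (\<nabla>\<^bsub>D\<^esub> \<otimes> \<nabla>\<^bsub>D\<^esub>) = \<nabla>\<^bsub>D\<^esub> \<cdot> (?d \<otimes> \<nabla>\<^bsub>D\<^esub>) \<cdot> (\<nabla>\<^bsub>D\<^esub> \<otimes> (?d \<otimes> ?d))"
      by (simp add: Ten_Idn)
    also have "\<dots> = (\<nabla>\<^bsub>D\<^esub> \<cdot> (\<nabla>\<^bsub>D\<^esub> \<otimes> ?d)) \<cdot> (\<nabla>\<^bsub>D\<^esub> \<otimes> (?d \<otimes> ?d))"
      unfolding a by simp
    also have "\<dots> = \<nabla>\<^bsub>D\<^esub> \<cdot> ((\<nabla>\<^bsub>D\<^esub> \<cdot> (\<nabla>\<^bsub>D\<^esub> \<otimes> ?d)) \<otimes> ?d)"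
      by (simp flip: Ten_assoc)
    also have "\<dots> = \<nabla>\<^bsub>D\<^esub> \<cdot> ((\<nabla>\<^bsub>D\<^esub> \<cdot> (?d \<otimes> \<nabla>\<^bsub>D\<^esub>)) \<otimes> ?d)"
      by (simp only: a)
    also have "\<dots> = (\<nabla>\<^bsub>D\<^esub> \<cdot> (\<nabla>\<^bsub>D\<^esub> \<otimes> ?d)) \<cdot> ((?d \<otimes> \<nabla>\<^bsub>D\<^esub>) \<otimes> ?d)"
      by (simp del: Ten_assoc)
    also have "\<dots> = \<nabla>\<^bsub>D\<^esub> \<cdot> (?d \<otimes> \<nabla>\<^bsub>D\<^esub>) \<cdot> (?d \<otimes> \<nabla>\<^bsub>D\<^esub> \<otimes> ?d)"
      unfolding a by simp
    finally show ?thesis .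
  qed
  \<comment> \<open>Used with \<open>(x, y)\<close> equal to \<open>(i, j)\<close> before the
    exchange and to \<open>(j, i)\<close> after it.\<close>
  have four': "\<nabla>\<^bsub>D\<^esub> \<cdot> ((\<nabla>\<^bsub>D\<^esub> \<cdot> (i \<otimes> x)) \<otimes> (\<nabla>\<^bsub>D\<^esub> \<cdot> (y \<otimes> j))) = \<nabla>\<^bsub>D\<^esub> \<cdot> (?d \<otimes> \<nabla>\<^bsub>D\<^esub>) \<cdot> (i \<otimes> (\<nabla>\<^bsub>D\<^esub> \<cdot> (x \<otimes> y)) \<otimes> j)"
    if "x \<in> Arr C" "y \<in> Arr C" "Cod C x = Car D" "Cod C y = Car D" for x y
  proof -
    have "\<nabla>\<^bsub>D\<^esub> \<cdot> ((\<nabla>\<^bsub>D\<^esub> \<cdot> (i \<otimes> x)) \<otimes> (\<nabla>\<^bsub>D\<^esub> \<cdot> (y \<otimes> j))) = \<nabla>\<^bsub>D\<^esub> \<cdot> (\<nabla>\<^bsub>D\<^esub> \<otimes> \<nabla>\<^bsub>D\<^esub>) \<cdot> ((i \<otimes> x) \<otimes> (y \<otimes> j))"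
      using that by (simp del: Ten_assoc)
    also have "\<dots> = \<nabla>\<^bsub>D\<^esub> \<cdot> (?d \<otimes> \<nabla>\<^bsub>D\<^esub>) \<cdot> (?d \<otimes> \<nabla>\<^bsub>D\<^esub> \<otimes> ?d) \<cdot> (i \<otimes> (x \<otimes> y) \<otimes> j)"
      using that by (subst Cmp_reassoc[OF four]) simp_all
    also have "\<dots> = \<nabla>\<^bsub>D\<^esub> \<cdot> (?d \<otimes> \<nabla>\<^bsub>D\<^esub>) \<cdot> (i \<otimes> (\<nabla>\<^bsub>D\<^esub> \<cdot> (x \<otimes> y)) \<otimes> j)"
      using that by (simp del: Ten_assoc)
    finally show ?thesis .
  qed
  have "(\<nabla>\<^bsub>D\<^esub> \<cdot> (i \<otimes> j)) \<cdot> \<nabla>\<^bsub>A \<boxtimes> B\<^esub>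
      = \<nabla>\<^bsub>D\<^esub> \<cdot> ((\<nabla>\<^bsub>D\<^esub> \<cdot> (i \<otimes> i)) \<otimes> (\<nabla>\<^bsub>D\<^esub> \<cdot> (j \<otimes> j))) \<cdot> mid (Car A) (Car B) (Car A) (Car B)"
    by (simp add: tensor_hopf_def hi hj)
  also have "\<dots> = (\<nabla>\<^bsub>D\<^esub> \<cdot> (?d \<otimes> \<nabla>\<^bsub>D\<^esub>) \<cdot> (i \<otimes> (\<nabla>\<^bsub>D\<^esub> \<cdot> (i \<otimes> j)) \<otimes> j)) \<cdot> mid (Car A) (Car B) (Car A) (Car B)"
    by (rule Cmp_reassoc[OF four']) simp_all
  also have "\<dots> = \<nabla>\<^bsub>D\<^esub> \<cdot> (?d \<otimes> \<nabla>\<^bsub>D\<^esub>) \<cdot> (i \<otimes> (\<nabla>\<^bsub>D\<^esub> \<cdot> (i \<otimes> j) \<cdot> \<tau> (Car B) (Car A)) \<otimes> j)"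
    by (simp del: Ten_assoc)
  also have "\<dots> = \<nabla>\<^bsub>D\<^esub> \<cdot> (?d \<otimes> \<nabla>\<^bsub>D\<^esub>) \<cdot> (i \<otimes> (\<nabla>\<^bsub>D\<^esub> \<cdot> (j \<otimes> i)) \<otimes> j)"
    using c by (simp add: commuting_def)
  also have "\<dots> = \<nabla>\<^bsub>D\<^esub> \<cdot> ((\<nabla>\<^bsub>D\<^esub> \<cdot> (i \<otimes> j)) \<otimes> (\<nabla>\<^bsub>D\<^esub> \<cdot> (i \<otimes> j)))"
    by (subst four') simp_all
  finally have "(\<nabla>\<^bsub>D\<^esub> \<cdot> (i \<otimes> j)) \<cdot> \<nabla>\<^bsub>A \<boxtimes> B\<^esub> = \<nabla>\<^bsub>D\<^esub> \<cdot> ((\<nabla>\<^bsub>D\<^esub> \<cdot> (i \<otimes> j)) \<otimes> (\<nabla>\<^bsub>D\<^esub> \<cdot> (i \<otimes> j)))" .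
  moreover have "(\<nabla>\<^bsub>D\<^esub> \<cdot> (i \<otimes> j)) \<cdot> \<eta>\<^bsub>A \<boxtimes> B\<^esub> = \<eta>\<^bsub>D\<^esub>"
  proof -
    have "\<nabla>\<^bsub>D\<^esub> \<cdot> (\<eta>\<^bsub>D\<^esub> \<otimes> \<eta>\<^bsub>D\<^esub>) = \<nabla>\<^bsub>D\<^esub> \<cdot> (\<eta>\<^bsub>D\<^esub> \<otimes> ?d) \<cdot> (Idn C (Unit C) \<otimes> \<eta>\<^bsub>D\<^esub>)"
      by (simp del: Ten_Unit_left)
    also have "\<dots> = \<eta>\<^bsub>D\<^esub>" by (subst Cmp_reassoc[OF u]) simp_all
    finally show ?thesis by (simp add: hi hj)
  qed
  ultimately show ?thesis by (simp add: alg_hom_def)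
qed

lemma coalg_hom_Com:
  assumes "coalg_hom C D A i" "coalg_hom C D B j" "cocommuting C D i j"
    and "is_coalgebra C A" "is_coalgebra C B" "is_coalgebra C D"
  shows "coalg_hom C D (A \<boxtimes> B) ((i \<otimes> j) \<cdot> \<Delta>\<^bsub>D\<^esub>)"
proof -
  interpret d: strict_braided_category "dual_cat C" by (rule dual)
  show ?thesis
    using d.alg_hom_Mul[of "dual_hopf A" "dual_hopf D" i "dual_hopf B" j] assms
      hom_typing(4-6)[OF assms(1)] hom_typing(4-6)[OF assms(2)] by simp
qed

text \<open>A rereading of the bialgebra axiom; read in the dual category it says that
  \<open>\<Delta>\<close> is an algebra morphism.\<close>

lemma coalg_hom_Mul_self: "is_bialgebra C D \<Longrightarrow> coalg_hom C (D \<boxtimes> D) D \<nabla>\<^bsub>D\<^esub>"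
  using bialgebra_axioms[of D] by (simp add: coalg_hom_def tensor_hopf_def)

lemma coalg_hom_Mul:
  assumes "coalg_hom C A D i" "coalg_hom C B D j" "is_coalgebra C A" "is_coalgebra C B"
      "is_bialgebra C D"
  shows "coalg_hom C (A \<boxtimes> B) D (\<nabla>\<^bsub>D\<^esub> \<cdot> (i \<otimes> j))"
  using assms by (intro coalg_hom_Cmp[OF tensor_coalg_hom coalg_hom_Mul_self]) simp_all

lemma alg_hom_Com:
  assumes "alg_hom C D A i" "alg_hom C D B j" "is_algebra C A" "is_algebra C B" "is_bialgebra C D"
  shows "alg_hom C D (A \<boxtimes> B) ((i \<otimes> j) \<cdot> \<Delta>\<^bsub>D\<^esub>)"
proof -
  interpret d: strict_braided_category "dual_cat C" by (rule dual)
  show ?thesis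
    using d.coalg_hom_Mul[of "dual_hopf A" "dual_hopf D" i "dual_hopf B" j] assms
      hom_typing(1-3)[OF assms(1)] hom_typing(1-3)[OF assms(2)] by simp
qed

text \<open>The sum is the composite of \<open>\<Delta>\<close>, an algebra morphism by the
  bialgebra axiom, with the morphism that the commuting pair \<open>f\<close>, \<open>g\<close>
  induces on \<open>H \<boxtimes> H\<close>.\<close>

lemma alg_hom_conv_prod:
  assumes f: "alg_hom C H L f" and g: "alg_hom C H L g" and c: "commuting C L f g"
    and [simp]: "is_bialgebra C H" "is_algebra C L"
  shows "alg_hom C H L (f \<star>\<^bsub>H,L\<^esub> g)"
proof -
  have "alg_hom C H (H \<boxtimes> H) ((idm H \<otimes> idm H) \<cdot> \<Delta>\<^bsub>H\<^esub>)"
    by (rule alg_hom_Com) simp_all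
  then have "alg_hom C H (H \<boxtimes> H) \<Delta>\<^bsub>H\<^esub>" by (simp add: Ten_Idn)
  then have "alg_hom C H L ((\<nabla>\<^bsub>L\<^esub> \<cdot> (f \<otimes> g)) \<cdot> \<Delta>\<^bsub>H\<^esub>)"
    by (rule alg_hom_Cmp[OF _ alg_hom_Mul[OF f g c]]) simp_all
  then show ?thesis using hom_typing(1-3)[OF f] hom_typing(1-3)[OF g] by (simp add: conv_def)
qed

lemma coalg_hom_conv_prod:
  assumes "coalg_hom C H L f" "coalg_hom C H L g" "cocommuting C H f g" "is_coalgebra C H"
      "is_bialgebra C L"
  shows "coalg_hom C H L (f \<star>\<^bsub>H,L\<^esub> g)"
proof -
  interpret d: strict_braided_category "dual_cat C" by (rule dual)
  show ?thesis
    using d.alg_hom_conv_prod[of "dual_hopf L" "dual_hopf H" f g] assms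
      hom_typing(4-6)[OF assms(1)] hom_typing(4-6)[OF assms(2)] by simp
qed

lemma hopf_Hom_conv:
  assumes "f \<in> Hom H L" "g \<in> Hom H L" "bicommuting C L f g" "bicocommuting C H f g"
    "is_bialgebra C H" "is_bialgebra C L"
  shows "f \<star>\<^bsub>H,L\<^esub> g \<in> Hom H L"
  using assms by (simp add: hopf_Hom_iff alg_hom_conv_prod coalg_hom_conv_prod bicommuting_def
    bicocommuting_def)

lemma zer_hopf_Hom:
  assumes [simp]: "is_bialgebra C H" "is_bialgebra C L"
  shows "zer H L \<in> Hom H L"
proof -
  interpret d: strict_braided_category "dual_cat C" by (rule dual)
  have "coalg_hom C H L (zer H L)"
    unfolding cunit_def by (rule coalg_hom_Cmp[OF coalg_hom_unit]) simp_all
  moreover have "alg_hom C H L (zer H L)"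
    using d.coalg_hom_Cmp[OF d.coalg_hom_unit, of "dual_hopf L" "dual_hopf H"] d.unit_hopf_structure
    by (simp add: cunit_def)
  ultimately show ?thesis by (simp add: hopf_Hom_iff)
qed

section \<open>Convolution inverses and the antipode\<close>

lemma conv_inverse_unique:
  assumes "y \<star>\<^bsub>X,A\<^esub> x = zer X A" "x \<star>\<^bsub>X,A\<^esub> z = zer X A"
    and [simp]: "is_coalgebra C X" "is_algebra C A" "x \<in> Arr C" "y \<in> Arr C" "z \<in> Arr C"
    "Dom C x = Car X" "Dom C y = Car X" "Dom C z = Car X" "Cod C x = Car A" "Cod C y = Car A"
      "Cod C z = Car A"
  shows "y = z"
proof -
  have "y = y \<star>\<^bsub>X,A\<^esub> (x \<star>\<^bsub>X,A\<^esub> z)" by (simp add: assms(2))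
  also have "\<dots> = (y \<star>\<^bsub>X,A\<^esub> x) \<star>\<^bsub>X,A\<^esub> z" by (simp add: conv_assoc)
  also have "\<dots> = z" by (simp add: assms(1))
  finally show ?thesis .
qed

lemma antipode_conv_hom:
  assumes "coalg_hom C X H f" and [simp]: "is_hopf_algebra C H" "is_coalgebra C X"
  shows "(Ant H \<cdot> f) \<star>\<^bsub>X,H\<^esub> f = zer X H" "f \<star>\<^bsub>X,H\<^esub> (Ant H \<cdot> f) = zer X H"
  using coalg_hom_conv[OF assms(1), of H "Ant H" "idm H"] coalg_hom_conv[OF assms(1), of H "idm H"
    "Ant H"]
    hom_typing(4-6)[OF assms(1)] coalg_hom_zer[OF assms(1), of H] antipode_conv[of H]
  by simp_all

lemma conv_antipode_hom:
  assumes "alg_hom C H A f" and [simp]: "is_hopf_algebra C H" "is_algebra C A"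
  shows "(f \<cdot> Ant H) \<star>\<^bsub>H,A\<^esub> f = zer H A" "f \<star>\<^bsub>H,A\<^esub> (f \<cdot> Ant H) = zer H A"
  using alg_hom_conv[OF assms(1), of H "Ant H" "idm H"] alg_hom_conv[OF assms(1), of H "idm H" "Ant H"]
    hom_typing(1-3)[OF assms(1)] alg_hom_zer[OF assms(1), of H] antipode_conv[of H]
  by simp_all

text \<open>Both sides are convolution inverses of \<open>f\<close>, one by distributivity on the
  left and one on the right.\<close>

lemma hopf_Hom_antipode:
  assumes f: "f \<in> Hom H L" and [simp]: "is_hopf_algebra C H" "is_hopf_algebra C L"
  shows "f \<cdot> Ant H = Ant L \<cdot> f"
  using f Hom_typing[OF f]
  by (intro conv_inverse_unique[of H L "f \<cdot> Ant H" f "Ant L \<cdot> f"] conv_antipode_hom antipode_conv_hom)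
    (simp_all add: hopf_Hom_iff)

lemma conv_cancel_left:
  assumes "f \<star>\<^bsub>X,H\<^esub> x = f \<star>\<^bsub>X,H\<^esub> y" "coalg_hom C X H f" and [simp]: "is_hopf_algebra C H" "is_coalgebra C X"
    "x \<in> Arr C" "y \<in> Arr C" "Dom C x = Car X" "Dom C y = Car X" "Cod C x = Car H" "Cod C y = Car H"
  shows "x = y"
proof -
  note [simp] = hom_typing(4-6)[OF assms(2)]
  have "(Ant H \<cdot> f) \<star>\<^bsub>X,H\<^esub> (f \<star>\<^bsub>X,H\<^esub> x) = (Ant H \<cdot> f) \<star>\<^bsub>X,H\<^esub> (f \<star>\<^bsub>X,H\<^esub> y)"
    by (simp only: assms(1))
  then have "((Ant H \<cdot> f) \<star>\<^bsub>X,H\<^esub> f) \<star>\<^bsub>X,H\<^esub> x = ((Ant H \<cdot> f) \<star>\<^bsub>X,H\<^esub> f) \<star>\<^bsub>X,H\<^esub> y"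
    by (simp add: conv_assoc)
  then show ?thesis by (simp add: antipode_conv_hom[OF assms(2)])
qed

lemma conv_cancel_right:
  assumes "x \<star>\<^bsub>X,H\<^esub> f = y \<star>\<^bsub>X,H\<^esub> f" "coalg_hom C X H f" and [simp]: "is_hopf_algebra C H" "is_coalgebra C X"
    "x \<in> Arr C" "y \<in> Arr C" "Dom C x = Car X" "Dom C y = Car X" "Cod C x = Car H" "Cod C y = Car H"
  shows "x = y"
proof -
  note [simp] = hom_typing(4-6)[OF assms(2)]
  have "(x \<star>\<^bsub>X,H\<^esub> f) \<star>\<^bsub>X,H\<^esub> (Ant H \<cdot> f) = (y \<star>\<^bsub>X,H\<^esub> f) \<star>\<^bsub>X,H\<^esub> (Ant H \<cdot> f)"
    by (simp only: assms(1))
  then show ?thesis by (simp add: conv_assoc antipode_conv_hom[OF assms(2)])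
qed

text \<open>An antipode reverses products in general, and the self-commutation of \<open>f\<close>
  compensates for this. Over \<open>H \<boxtimes> H\<close> both \<open>S f \<nabla>\<close> and
  \<open>\<nabla> (S f \<otimes> S f)\<close> are convolution inverses of \<open>f \<nabla>\<close>,
  hence equal.\<close>

lemma alg_hom_antipode:
  assumes f: "f \<in> Hom H L" and c: "commuting C L f f"
    and [simp]: "is_hopf_algebra C H" "is_hopf_algebra C L"
  shows "alg_hom C H L (Ant L \<cdot> f)"
proof -
  note [simp] = Hom_typing[OF f]
  have f': "alg_hom C H L f" "coalg_hom C H L f" using f by (simp_all add: hopf_Hom_iff)
  let ?T = "H \<boxtimes> H" and ?p = "pr1 C H H" and ?q = "pr2 C H H" and ?S = "Ant L \<cdot> f"
  have S: "?S = f \<cdot> Ant H" using hopf_Hom_antipode[OF f] by simp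
  have mul: "coalg_hom C ?T L (f \<cdot> \<nabla>\<^bsub>H\<^esub>)"
    by (rule coalg_hom_Cmp[OF coalg_hom_Mul_self f'(2)]) simp_all
  have p: "coalg_hom C ?T L (f \<cdot> ?p)" "coalg_hom C ?T L (f \<cdot> ?q)"
    by (rule coalg_hom_Cmp[OF pr_coalg_hom(1) f'(2)] coalg_hom_Cmp[OF pr_coalg_hom(2) f'(2)]; simp)+
  \<comment> \<open>Since \<open>f\<close> commutes with itself, it commutes with
    \<open>f \<cdot> Ant H\<close>, which is \<open>?S\<close>. The resulting exchange lets the four
    summands below cancel in pairs.\<close>
  have "commuting C L (f \<cdot> idm H) (f \<cdot> Ant H)"
    by (rule commuting_precomp[OF c]) simp_all
  then have "commuting C L f ?S" by (simp add: S)
  then have comm: "(?S \<cdot> ?p) \<star>\<^bsub>?T,L\<^esub> (f \<cdot> ?q) = (f \<cdot> ?q) \<star>\<^bsub>?T,L\<^esub> (?S \<cdot> ?p)"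
    by (subst (asm) commuting_iff_conv[of L H H]) simp_all
  have "(Ant L \<cdot> f \<cdot> \<nabla>\<^bsub>H\<^esub>) = (?S \<cdot> ?p) \<star>\<^bsub>?T,L\<^esub> (?S \<cdot> ?q)"
  proof (rule conv_inverse_unique[of ?T L _ "f \<cdot> \<nabla>\<^bsub>H\<^esub>"])
    show "(Ant L \<cdot> f \<cdot> \<nabla>\<^bsub>H\<^esub>) \<star>\<^bsub>?T,L\<^esub> (f \<cdot> \<nabla>\<^bsub>H\<^esub>) = zer ?T L"
      by (rule antipode_conv_hom[OF mul]) simp_all
    have "f \<cdot> \<nabla>\<^bsub>H\<^esub> = (f \<cdot> ?p) \<star>\<^bsub>?T,L\<^esub> (f \<cdot> ?q)"
      using f'(1) by (simp add: conv_pr alg_hom_def)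
    then have "(f \<cdot> \<nabla>\<^bsub>H\<^esub>) \<star>\<^bsub>?T,L\<^esub> ((?S \<cdot> ?p) \<star>\<^bsub>?T,L\<^esub> (?S \<cdot> ?q))
        = (f \<cdot> ?p) \<star>\<^bsub>?T,L\<^esub> ((f \<cdot> ?q) \<star>\<^bsub>?T,L\<^esub> (?S \<cdot> ?p)) \<star>\<^bsub>?T,L\<^esub> (?S \<cdot> ?q)"
      by (simp add: conv_assoc)
    also have "\<dots> = ((f \<cdot> ?p) \<star>\<^bsub>?T,L\<^esub> (?S \<cdot> ?p)) \<star>\<^bsub>?T,L\<^esub> ((f \<cdot> ?q) \<star>\<^bsub>?T,L\<^esub> (?S \<cdot> ?q))"
      unfolding comm[symmetric] by (simp add: conv_assoc)
    also have "\<dots> = zer ?T L"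
      using antipode_conv_hom(2)[OF p(1)] antipode_conv_hom(2)[OF p(2)] by simp
    finally show "(f \<cdot> \<nabla>\<^bsub>H\<^esub>) \<star>\<^bsub>?T,L\<^esub> ((?S \<cdot> ?p) \<star>\<^bsub>?T,L\<^esub> (?S \<cdot> ?q)) = zer ?T L" .
  qed simp_all
  also have "\<dots> = \<nabla>\<^bsub>L\<^esub> \<cdot> (?S \<otimes> ?S)" by (rule conv_pr) simp_all
  finally have 1: "Ant L \<cdot> f \<cdot> \<nabla>\<^bsub>H\<^esub> = \<nabla>\<^bsub>L\<^esub> \<cdot> (?S \<otimes> ?S)" .
  have e: "coalg_hom C (unit_hopf C) L (f \<cdot> \<eta>\<^bsub>H\<^esub>)"
    by (rule coalg_hom_Cmp[OF coalg_hom_unit(2) f'(2)]) simp_all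
  \<comment> \<open>On the unit coalgebra \<open>f \<eta>\<close> is the zero of the convolution
    monoid, so its negative is zero as well.\<close>
  have fe: "f \<cdot> \<eta>\<^bsub>H\<^esub> = zer (unit_hopf C) L" using f'(1) by (simp add: alg_hom_def cunit_def)
  have "(Ant L \<cdot> f \<cdot> \<eta>\<^bsub>H\<^esub>) \<star>\<^bsub>unit_hopf C,L\<^esub> (f \<cdot> \<eta>\<^bsub>H\<^esub>) = zer (unit_hopf C) L"
    by (rule antipode_conv_hom[OF e]) simp_all
  then have "Ant L \<cdot> f \<cdot> \<eta>\<^bsub>H\<^esub> = zer (unit_hopf C) L" unfolding fe by simp
  then have "Ant L \<cdot> f \<cdot> \<eta>\<^bsub>H\<^esub> = \<eta>\<^bsub>L\<^esub>" by (simp add: cunit_def)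
  with 1 show ?thesis by (simp add: alg_hom_def)
qed

lemma hopf_Hom_Ant:
  assumes f: "f \<in> Hom H L" "bicommuting C L f f" "bicocommuting C H f f"
    and [simp]: "is_hopf_algebra C H" "is_hopf_algebra C L"
  shows "Ant L \<cdot> f \<in> Hom H L"
proof -
  note [simp] = Hom_typing[OF f(1)]
  interpret d: strict_braided_category "dual_cat C" by (rule dual)
  have "alg_hom C H L (Ant L \<cdot> f)" using f by (intro alg_hom_antipode) (simp_all add: bicommuting_def)
  moreover have "coalg_hom C H L (f \<cdot> Ant H)"
    using d.alg_hom_antipode[of f "dual_hopf L" "dual_hopf H"] f by (simp add: bicocommuting_def)
  ultimately show ?thesis using hopf_Hom_antipode[OF f(1)] by (simp add: hopf_Hom_iff)
qed

end

section \<open>Complementary endomorphisms\<close>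

definition complementary :: "('o, 'm, 'z) braided_cat_scheme \<Rightarrow> ('o, 'm) hopf \<Rightarrow> 'm \<Rightarrow> 'm \<Rightarrow> bool" where
  "complementary C H f g \<longleftrightarrow> f \<in> hopf_Hom C H H \<and> g \<in> hopf_Hom C H H \<and>
     conv C H H f g = Idn C (Car H) \<and> bicommuting C H f g \<and> bicocommuting C H f g"

primrec cpow :: "('o, 'm, 'z) braided_cat_scheme \<Rightarrow> 'o \<Rightarrow> 'm \<Rightarrow> nat \<Rightarrow> 'm" where
  "cpow C A g 0 = Idn C A"
| "cpow C A g (Suc n) = g \<cdot>\<^bsub>C\<^esub> cpow C A g n"

context strict_braided_category
begin

section \<open>Isomorphisms, inverses of Hopf morphisms, and powers\<close>

lemma mutually_inverse_iff:
  "mutually_inverse C f g \<longleftrightarrow> f \<in> Arr C \<and> g \<in> Arr C \<and> Dom C g = Cod C f \<and> Cod C g = Dom C f \<and>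
     g \<cdot> f = Idn C (Dom C f) \<and> f \<cdot> g = Idn C (Cod C f)"
  by (auto simp: mutually_inverse_def)

lemma Cmp_cancel_left:
  assumes "h \<cdot> f = Idn C X" "f \<cdot> x = f \<cdot> y" "f \<in> Arr C" "h \<in> Arr C" "x \<in> Arr C" "y \<in> Arr C"
    "Dom C f = X" "Dom C h = Cod C f" "Cod C x = X" "Cod C y = X"
  shows "x = y"
proof -
  have "(h \<cdot> f) \<cdot> x = (h \<cdot> f) \<cdot> y" using assms(2-) by simp
  then show ?thesis using assms by simp
qed

lemma isomorphismI_left_right:
  assumes "g \<cdot> f = Idn C (Dom C f)" "f \<cdot> h = Idn C (Cod C f)" "f \<in> Arr C" "g \<in> Arr C" "h \<in> Arr C"
    "Dom C g = Cod C f" "Cod C g = Dom C f" "Dom C h = Cod C f" "Cod C h = Dom C f"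
  shows "mutually_inverse C f g"
proof -
  have "g = g \<cdot> f \<cdot> h" using assms by simp
  also have "\<dots> = (g \<cdot> f) \<cdot> h" using assms(3-) by simp
  also have "\<dots> = h" using assms by simp
  finally have "g = h" .
  then show ?thesis using assms by (simp add: mutually_inverse_iff)
qed

lemma is_isomorphism_Idn: "A \<in> Obj C \<Longrightarrow> is_isomorphism C (Idn C A)"
  unfolding is_isomorphism_def by (rule exI[of _ "Idn C A"]) (simp add: mutually_inverse_iff)

lemma is_isomorphism_Cmp:
  assumes "is_isomorphism C f" "is_isomorphism C g" "Dom C g = Cod C f"
  shows "is_isomorphism C (g \<cdot> f)"
proof -
  obtain f' g' where *: "mutually_inverse C f f'" "mutually_inverse C g g'" using assms
    by (auto simp: is_isomorphism_def)
  note ** = *[unfolded mutually_inverse_iff]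
  have "f' \<cdot> g' \<cdot> g \<cdot> f = Idn C (Dom C f)"
    using ** assms(3) Cmp_reassoc[of g' g "Idn C (Dom C g)" f] by simp
  moreover have "g \<cdot> f \<cdot> f' \<cdot> g' = Idn C (Cod C g)"
    using ** assms(3) Cmp_reassoc[of f f' "Idn C (Cod C f)" g'] by simp
  ultimately have "mutually_inverse C (g \<cdot> f) (f' \<cdot> g')"
    using ** assms(3) by (simp add: mutually_inverse_iff)
  then show ?thesis by (auto simp: is_isomorphism_def)
qed

lemma alg_hom_inverse:
  assumes f: "alg_hom C A B f" "mutually_inverse C f g" and [simp]: "is_algebra C A" "is_algebra C B"
  shows "alg_hom C B A g"
proof -
  note [simp] = hom_typing(1-3)[OF f(1)]
  have [simp]: "g \<in> Arr C" "Dom C g = Car B" "Cod C g = Car A" and gf: "g \<cdot> f = idm A"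
      and fg: "f \<cdot> g = idm B"
    using f(2) by (simp_all add: mutually_inverse_iff)
  have m: "f \<cdot> \<nabla>\<^bsub>A\<^esub> = \<nabla>\<^bsub>B\<^esub> \<cdot> (f \<otimes> f)" and u: "f \<cdot> \<eta>\<^bsub>A\<^esub> = \<eta>\<^bsub>B\<^esub>" using f(1) by (simp_all add: alg_hom_def)
  have "f \<cdot> g \<cdot> \<nabla>\<^bsub>B\<^esub> = f \<cdot> \<nabla>\<^bsub>A\<^esub> \<cdot> (g \<otimes> g)"
    using Cmp_reassoc[OF fg, of "\<nabla>\<^bsub>B\<^esub>"] Cmp_reassoc[OF m, of "g \<otimes> g"] by (simp add: fg Ten_Idn)
  then have "g \<cdot> \<nabla>\<^bsub>B\<^esub> = \<nabla>\<^bsub>A\<^esub> \<cdot> (g \<otimes> g)" by (rule Cmp_cancel_left[OF gf]) simp_all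
  moreover have "g \<cdot> \<eta>\<^bsub>B\<^esub> = \<eta>\<^bsub>A\<^esub>"
    unfolding u[symmetric] by (subst Cmp_reassoc[OF gf]) simp_all
  ultimately show ?thesis by (simp add: alg_hom_def)
qed

lemma hopf_Hom_inverse:
  assumes "f \<in> Hom A B" "mutually_inverse C f g"
    "is_algebra C A" "is_algebra C B" "is_coalgebra C A" "is_coalgebra C B"
  shows "g \<in> Hom B A"
proof -
  interpret d: strict_braided_category "dual_cat C" by (rule dual)
  have "mutually_inverse C g f" using assms(2) by (auto simp: mutually_inverse_def)
  then show ?thesis
    using assms alg_hom_inverse[of A B f g] d.alg_hom_inverse[of "dual_hopf B" "dual_hopf A" f g]
    by (simp add: hopf_Hom_iff)
qed

lemma hopf_AutI:
  assumes "f \<in> Hom A A" "is_isomorphism C f" "is_algebra C A" "is_coalgebra C A"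
  shows "f \<in> hopf_Aut C A"
  using assms hopf_Hom_inverse[of f A A] by (auto simp: hopf_Aut_def hopf_Iso_def is_isomorphism_def)

lemma Idn_hopf_Hom [simp]: "is_bialgebra C H \<Longrightarrow> idm H \<in> Hom H H"
  by (simp add: hopf_Hom_iff)

lemma Hom_comp:
  assumes "f \<in> Hom A B" "g \<in> Hom B D" "is_bialgebra C A" "is_bialgebra C B" "is_bialgebra C D"
  shows "g \<cdot> f \<in> Hom A D"
  using assms(3-) by (intro hopf_Hom_Cmp[OF assms(1,2)]) simp_all

lemma HomD: "f \<in> Hom A B \<Longrightarrow> alg_hom C A B f" "f \<in> Hom A B \<Longrightarrow> coalg_hom C A B f"
  by (simp_all add: hopf_Hom_iff)

lemma cpow_typing [simp]:
  assumes "g \<in> Arr C" "Dom C g = A" "Cod C g = A"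
  shows "cpow C A g n \<in> Arr C" "Dom C (cpow C A g n) = A" "Cod C (cpow C A g n) = A"
proof -
  have "A \<in> Obj C" using assms by auto
  then have "cpow C A g n \<in> Arr C \<and> Dom C (cpow C A g n) = A \<and> Cod C (cpow C A g n) = A"
    by (induction n) (use assms in simp_all)
  then show "cpow C A g n \<in> Arr C" "Dom C (cpow C A g n) = A" "Cod C (cpow C A g n) = A" by auto
qed

lemma cpow_hopf_Hom:
  assumes "g \<in> Hom H H" "is_bialgebra C H"
  shows "cpow C (Car H) g n \<in> Hom H H"
  by (induction n) (use assms in \<open>simp_all add: Hom_comp\<close>)

lemma cpow_commute:
  assumes "f \<cdot> g = g \<cdot> f" "f \<in> Arr C" "Dom C f = A" "Cod C f = A" "g \<in> Arr C" "Dom C g = A" "Cod C g = A"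
  shows "f \<cdot> cpow C A g n = cpow C A g n \<cdot> f"
proof (induction n)
  case 0
  then show ?case using assms by simp
next
  case (Suc n)
  have "f \<cdot> g \<cdot> cpow C A g n = (g \<cdot> f) \<cdot> cpow C A g n"
    by (rule Cmp_reassoc[OF assms(1)]) (use assms in simp_all)
  then show ?case using assms Suc by simp
qed

lemma cpow_Suc_right:
  assumes "g \<in> Arr C" "Dom C g = A" "Cod C g = A"
  shows "cpow C A g n \<cdot> g = cpow C A g (Suc n)"
  using cpow_commute[of g g A n] assms by simp

section \<open>Complements of powers, of central endomorphisms and of retracts\<close>

lemma complementaryD:
  assumes "complementary C H f g"
  shows "f \<in> Hom H H" "g \<in> Hom H H" "f \<star>\<^bsub>H,H\<^esub> g = idm H"
    "bicommuting C H f g" "bicocommuting C H f g"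
  using assms by (auto simp: complementary_def)

lemma complementary_sym:
  assumes "complementary C H f g" and [simp]: "is_bialgebra C H"
  shows "complementary C H g f"
proof -
  note D = complementaryD[OF assms(1)]
  have "f \<star>\<^bsub>H,H\<^esub> g = g \<star>\<^bsub>H,H\<^esub> f"
    by (rule conv_commute) (use Hom_typing[OF D(1)] Hom_typing[OF D(2)] D in simp_all)
  then show ?thesis using D by (simp add: complementary_def bicommuting_sym bicocommuting_sym)
qed

text \<open>Composing \<open>f + g = 1\<close> with \<open>f\<close> on either side gives
  \<open>f f + f g = f = f f + g f\<close>, and \<open>f f\<close> cancels.\<close>

lemma complementary_commute:
  assumes "complementary C H f g" and [simp]: "is_hopf_algebra C H"
  shows "f \<cdot> g = g \<cdot> f"
proof -
  note D = complementaryD[OF assms(1)]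
  note [simp] = Hom_typing[OF D(1)] Hom_typing[OF D(2)]
  have "(f \<cdot> f) \<star>\<^bsub>H,H\<^esub> (f \<cdot> g) = f \<cdot> (f \<star>\<^bsub>H,H\<^esub> g)"
    by (rule alg_hom_conv[symmetric]) (use HomD[OF D(1)] in simp_all)
  also have "\<dots> = (f \<star>\<^bsub>H,H\<^esub> g) \<cdot> f" by (simp add: D(3))
  also have "\<dots> = (f \<cdot> f) \<star>\<^bsub>H,H\<^esub> (g \<cdot> f)"
    by (rule coalg_hom_conv) (use HomD[OF D(1)] in simp_all)
  finally show ?thesis
    by (rule conv_cancel_left) (use HomD(2)[OF Hom_comp[OF D(1) D(1)]] in simp_all)
qed

text \<open>The complement of \<open>g\<^sup>n\<^sup>+\<^sup>1\<close> is \<open>f + f g + \<dots> + f g\<^sup>n\<close>.\<close>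

lemma complementary_cpow:
  assumes c: "complementary C H f g" and [simp]: "is_hopf_algebra C H"
  shows "\<exists>f'. complementary C H f' (cpow C (Car H) g (Suc n))"
proof -
  note D = complementaryD[OF c]
  note [simp] = Hom_typing[OF D(1)] Hom_typing[OF D(2)]
  let ?I = "idm H" and ?g = "cpow C (Car H) g"
  have pow [simp]: "?g k \<in> Hom H H" for k by (rule cpow_hopf_Hom) (use D in simp_all)
  have comm: "f \<cdot> ?g k = ?g k \<cdot> f" for k
    by (rule cpow_commute) (simp_all add: complementary_commute[OF c])
  \<comment> \<open>The invariant asks for commutation with \<open>g\<close> itself and not with its
    power: this form is inherited by the next summand, and commutation with the power follows from
    it at the end.\<close>
  have "\<exists>f'. f' \<in> Hom H H \<and> f' \<star>\<^bsub>H,H\<^esub> ?g (Suc n) = ?I \<and> bicommuting C H f' g \<and> bicocommuting C H f' g"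
  proof (induction n)
    case 0
    then show ?case using D by (intro exI[of _ f]) simp
  next
    case (Suc n)
    then obtain f' where f': "f' \<in> Hom H H" "f' \<star>\<^bsub>H,H\<^esub> ?g (Suc n) = ?I"
      "bicommuting C H f' g" "bicocommuting C H f' g" by blast
    note [simp] = Hom_typing[OF f'(1)]
    let ?h = "f \<cdot> ?g (Suc n)"
    have h: "?h \<in> Hom H H" by (rule Hom_comp[OF pow D(1)]) simp_all
    note [simp] = Hom_typing[OF h, simplified]
    \<comment> \<open>The summand \<open>f g\<^sup>n\<^sup>+\<^sup>1\<close> is written once with
      \<open>g\<close> leftmost and once with \<open>g\<close> rightmost, because
      \<open>\<curlyvee>\<close> is stable under precomposition and \<open>\<curlywedge>\<close>
      under postcomposition.\<close>
    have h1: "?h = g \<cdot> ?g n \<cdot> f" unfolding comm by simp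
    have h2: "?h = (f \<cdot> ?g n) \<cdot> g" using cpow_Suc_right[of g "Car H" n] by simp
    have "bicommuting C H (f' \<cdot> ?I) (g \<cdot> ?g n \<cdot> f)" by (rule bicommuting_precomp[OF f'(3)]) simp_all
    then have c1: "bicommuting C H f' ?h" unfolding h1 by simp
    have "bicocommuting C H (?I \<cdot> f') ((f \<cdot> ?g n) \<cdot> g)"
      by (rule bicocommuting_postcomp[OF f'(4)]) simp_all
    then have c2: "bicocommuting C H f' ?h" unfolding h2 by simp
    have "bicommuting C H (f \<cdot> ?g (Suc n)) (g \<cdot> ?I)" by (rule bicommuting_precomp[OF D(4)]) simp_all
    then have c3: "bicommuting C H ?h g" by simp
    have "bicocommuting C H (?g (Suc n) \<cdot> f) (?I \<cdot> g)" by (rule bicocommuting_postcomp[OF D(5)]) simp_all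
    then have c4: "bicocommuting C H ?h g" unfolding comm by simp
    \<comment> \<open>The telescoping step: composing \<open>f + g = 1\<close> with a power of
      \<open>g\<close> splits that power into the new summand and the next power.\<close>
    have "(f \<star>\<^bsub>H,H\<^esub> g) \<cdot> ?g (Suc n) = ?h \<star>\<^bsub>H,H\<^esub> ?g (Suc (Suc n))"
      using coalg_hom_conv[OF HomD(2)[OF pow[of "Suc n"]], of H f g] by simp
    then have "?h \<star>\<^bsub>H,H\<^esub> ?g (Suc (Suc n)) = ?g (Suc n)" by (simp add: D(3))
    then have "(f' \<star>\<^bsub>H,H\<^esub> ?h) \<star>\<^bsub>H,H\<^esub> ?g (Suc (Suc n)) = ?I"
      using f'(2) by (subst conv_assoc) simp_all
    moreover have "f' \<star>\<^bsub>H,H\<^esub> ?h \<in> Hom H H"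
      by (rule hopf_Hom_conv[OF f'(1) h c1 c2]) simp_all
    moreover have "bicommuting C H (f' \<star>\<^bsub>H,H\<^esub> ?h) g"
      by (rule bicommuting_conv[OF f'(3) c3]) simp_all
    moreover have "bicocommuting C H (f' \<star>\<^bsub>H,H\<^esub> ?h) g"
      by (rule bicocommuting_conv[OF f'(4) c4]) simp_all
    ultimately show ?case by blast
  qed
  then obtain f' where f': "f' \<in> Hom H H" "f' \<star>\<^bsub>H,H\<^esub> ?g (Suc n) = ?I"
    "bicommuting C H f' g" "bicocommuting C H f' g" by blast
  note [simp] = Hom_typing[OF f'(1)]
  have "bicommuting C H (f' \<cdot> ?I) (g \<cdot> ?g n)" by (rule bicommuting_precomp[OF f'(3)]) simp_all
  moreover have "bicocommuting C H (?I \<cdot> f') (?g n \<cdot> g)"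
    by (rule bicocommuting_postcomp[OF f'(4)]) simp_all
  ultimately have "complementary C H f' (?g (Suc n))"
    using f' pow[of "Suc n"] cpow_Suc_right[of g "Car H" n] by (simp add: complementary_def)
  then show ?thesis by blast
qed

text \<open>The inverse is the geometric series \<open>1 + g + \<dots> + g\<^sup>n\<^sup>-\<^sup>1\<close>.\<close>

lemma complementary_nilpotent:
  assumes c: "complementary C H f g" and [simp]: "is_hopf_algebra C H"
      and nil: "cpow C (Car H) g n = zer H H"
  shows "is_isomorphism C f"
proof -
  note D = complementaryD[OF c]
  note [simp] = Hom_typing[OF D(1)] Hom_typing[OF D(2)]
  let ?I = "idm H" and ?g = "cpow C (Car H) g"
  have pow [simp]: "?g k \<in> Hom H H" for k by (rule cpow_hopf_Hom) (use D in simp_all)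
  \<comment> \<open>The witness \<open>r\<close> is the partial sum of the first \<open>k\<close>
    powers of \<open>g\<close>, with \<open>f r = r f = 1 - g\<^sup>k\<close>. It is kept as a bare
    morphism, since only an inverse of \<open>f\<close> in the category is sought.\<close>
  have "\<exists>r \<in> Arr C. Dom C r = Car H \<and> Cod C r = Car H \<and> (f \<cdot> r) \<star>\<^bsub>H,H\<^esub> ?g k = ?I \<and> (r \<cdot> f) \<star>\<^bsub>H,H\<^esub> ?g k
      = ?I" for k
  proof (induction k)
    case 0
    then show ?case
      by (intro bexI[of _ "zer H H"])
        (simp_all add: alg_hom_zer[OF HomD(1)[OF D(1)]] coalg_hom_zer[OF HomD(2)[OF D(1)]])
  next
    case (Suc k)
    then obtain r where r: "r \<in> Arr C" "Dom C r = Car H" "Cod C r = Car H"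
      "(f \<cdot> r) \<star>\<^bsub>H,H\<^esub> ?g k = ?I" "(r \<cdot> f) \<star>\<^bsub>H,H\<^esub> ?g k = ?I" by blast
    note [simp] = r(1-3)
    have "(f \<star>\<^bsub>H,H\<^esub> g) \<cdot> ?g k = (f \<cdot> ?g k) \<star>\<^bsub>H,H\<^esub> ?g (Suc k)"
      using coalg_hom_conv[OF HomD(2)[OF pow[of k]], of H f g] by simp
    then have 1: "(f \<cdot> ?g k) \<star>\<^bsub>H,H\<^esub> ?g (Suc k) = ?g k" by (simp add: D(3))
    have "?g k \<cdot> (f \<star>\<^bsub>H,H\<^esub> g) = (?g k \<cdot> f) \<star>\<^bsub>H,H\<^esub> ?g (Suc k)"
      using alg_hom_conv[OF HomD(1)[OF pow[of k]], of H f g] cpow_Suc_right[of g "Car H" k] by simp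
    then have 2: "(?g k \<cdot> f) \<star>\<^bsub>H,H\<^esub> ?g (Suc k) = ?g k" by (simp add: D(3))
    have "f \<cdot> (r \<star>\<^bsub>H,H\<^esub> ?g k) = (f \<cdot> r) \<star>\<^bsub>H,H\<^esub> (f \<cdot> ?g k)"
      by (rule alg_hom_conv[OF HomD(1)[OF D(1)]]) simp_all
    then have "(f \<cdot> (r \<star>\<^bsub>H,H\<^esub> ?g k)) \<star>\<^bsub>H,H\<^esub> ?g (Suc k) = (f \<cdot> r) \<star>\<^bsub>H,H\<^esub> ((f \<cdot> ?g k) \<star>\<^bsub>H,H\<^esub> ?g (Suc k))"
      by (simp add: conv_assoc)
    then have 3: "(f \<cdot> (r \<star>\<^bsub>H,H\<^esub> ?g k)) \<star>\<^bsub>H,H\<^esub> ?g (Suc k) = ?I" by (simp only: 1 r)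
    have "(r \<star>\<^bsub>H,H\<^esub> ?g k) \<cdot> f = (r \<cdot> f) \<star>\<^bsub>H,H\<^esub> (?g k \<cdot> f)"
      by (rule coalg_hom_conv[OF HomD(2)[OF D(1)]]) simp_all
    then have "((r \<star>\<^bsub>H,H\<^esub> ?g k) \<cdot> f) \<star>\<^bsub>H,H\<^esub> ?g (Suc k) = (r \<cdot> f) \<star>\<^bsub>H,H\<^esub> ((?g k \<cdot> f) \<star>\<^bsub>H,H\<^esub> ?g (Suc k))"
      by (simp add: conv_assoc)
    then have "((r \<star>\<^bsub>H,H\<^esub> ?g k) \<cdot> f) \<star>\<^bsub>H,H\<^esub> ?g (Suc k) = ?I" by (simp only: 2 r)
    with 3 show ?case by (intro bexI[of _ "r \<star>\<^bsub>H,H\<^esub> ?g k"]) simp_all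
  qed
  from this[of n] obtain r where "r \<in> Arr C" "Dom C r = Car H" "Cod C r = Car H" "f \<cdot> r = ?I"
      "r \<cdot> f = ?I"
    unfolding nil by auto
  then have "mutually_inverse C f r" by (simp add: mutually_inverse_iff)
  then show ?thesis by (auto simp: is_isomorphism_def)
qed

text \<open>Commuting with the identity implies commuting with \<open>x\<close> itself, so the
  negative of \<open>x\<close> is a Hopf morphism. It is central because the antipode can be moved
  to the other side of \<open>x\<close>.\<close>

lemma central_antipode:
  assumes x: "x \<in> Hom H H" "bicommuting C H x (idm H)" "bicocommuting C H x (idm H)"
    and [simp]: "is_hopf_algebra C H"
  shows "Ant H \<cdot> x \<in> Hom H H" "bicommuting C H (Ant H \<cdot> x) (idm H)"
    "bicocommuting C H (Ant H \<cdot> x) (idm H)"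
proof -
  note [simp] = Hom_typing[OF x(1)]
  let ?I = "idm H"
  have "bicommuting C H (x \<cdot> ?I) (?I \<cdot> x)" by (rule bicommuting_precomp[OF x(2)]) simp_all
  moreover have "bicocommuting C H (?I \<cdot> x) (x \<cdot> ?I)" by (rule bicocommuting_postcomp[OF x(3)]) simp_all
  ultimately show "Ant H \<cdot> x \<in> Hom H H" using x(1) by (intro hopf_Hom_Ant) simp_all
  have "bicommuting C H (x \<cdot> Ant H) (?I \<cdot> ?I)" by (rule bicommuting_precomp[OF x(2)]) simp_all
  then show "bicommuting C H (Ant H \<cdot> x) ?I" by (simp add: hopf_Hom_antipode[OF x(1)])
  have "bicocommuting C H (Ant H \<cdot> x) (?I \<cdot> ?I)" by (rule bicocommuting_postcomp[OF x(3)]) simp_all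
  then show "bicocommuting C H (Ant H \<cdot> x) ?I" by simp
qed

text \<open>The complement is \<open>1 - x\<close>, which is a Hopf morphism because
  \<open>- x\<close> commutes and cocommutes with the identity.\<close>

lemma complementary_central:
  assumes x: "x \<in> Hom H H" "bicommuting C H x (idm H)" "bicocommuting C H x (idm H)"
    and [simp]: "is_hopf_algebra C H"
  shows "complementary C H (idm H \<star>\<^bsub>H,H\<^esub> (Ant H \<cdot> x)) x"
proof -
  note [simp] = Hom_typing[OF x(1)]
  let ?I = "idm H" and ?y = "Ant H \<cdot> x"
  have y: "?y \<in> Hom H H" "bicommuting C H ?y ?I" "bicocommuting C H ?y ?I"
    using central_antipode[OF x] by simp_all
  have "?I \<star>\<^bsub>H,H\<^esub> ?y \<in> Hom H H"
    using y by (intro hopf_Hom_conv) (simp_all add: bicommuting_sym bicocommuting_sym)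
  moreover have "(?I \<star>\<^bsub>H,H\<^esub> ?y) \<star>\<^bsub>H,H\<^esub> x = ?I"
    using antipode_conv_hom(1)[OF HomD(2)[OF x(1)]] by (simp add: conv_assoc)
  moreover have "bicommuting C H ?y x" "bicocommuting C H ?y x"
    using bicommuting_precomp[OF y(2), of ?I x] bicocommuting_postcomp[OF y(3), of ?I x] by simp_all
  then have "bicommuting C H (?I \<star>\<^bsub>H,H\<^esub> ?y) x" "bicocommuting C H (?I \<star>\<^bsub>H,H\<^esub> ?y) x"
    using x by (auto intro!: bicommuting_conv bicocommuting_conv simp: bicommuting_sym bicocommuting_sym)
  ultimately show ?thesis using x(1) by (simp add: complementary_def)
qed

text \<open>
  Put \<open>e = i p'\<close> and \<open>z = e f\<close>. As \<open>e\<close> and \<open>g = i p\<close> divide each other, \<open>e = z + g\<close>, and \<open>z\<close> commutes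
  with both \<open>f\<close> and \<open>g\<close>, hence with \<open>f + g = 1\<close>. So \<open>e' = f - z\<close> is again a Hopf morphism.
\<close>

lemma complementary_retract:
  assumes c: "complementary C H f (i \<cdot> p)" and i: "i \<in> Hom J H" and p: "p \<in> Hom H J"
    and iso: "is_isomorphism C (p \<cdot> i)" and [simp]: "is_hopf_algebra C H" "is_hopf_algebra C J"
  shows "\<exists>p' e'. p' \<in> Hom H J \<and> p' \<cdot> i = idm J \<and> complementary C H e' (i \<cdot> p')"
proof -
  note D = complementaryD[OF c]
  note [simp] = Hom_typing[OF D(1)] Hom_typing[OF i] Hom_typing[OF p]
  obtain u where u: "mutually_inverse C (p \<cdot> i) u" using iso by (auto simp: is_isomorphism_def)
  have uHom: "u \<in> Hom J J"
    by (rule hopf_Hom_inverse[OF Hom_comp[OF i p] u]) simp_all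
  note [simp] = Hom_typing[OF uHom]
  have u1: "u \<cdot> p \<cdot> i = idm J" and u2: "p \<cdot> i \<cdot> u = idm J"
    using u by (simp_all add: mutually_inverse_iff)
  have u2': "p \<cdot> i \<cdot> u \<cdot> x = x" if "x \<in> Arr C" "Cod C x = Car J" for x
    using Cmp_reassoc[of p "i \<cdot> u" "idm J" x] u2 that by simp
  have u1': "u \<cdot> p \<cdot> i \<cdot> x = x" if "x \<in> Arr C" "Cod C x = Car J" for x
    using Cmp_reassoc[of u "p \<cdot> i" "idm J" x] u1 that by simp
  let ?I = "idm H"
  define g where "g = i \<cdot> p"
  define e where "e = i \<cdot> u \<cdot> p"
  \<comment> \<open>With \<open>u\<close> the inverse of \<open>p i\<close>, the idempotent onto
    \<open>J\<close> is \<open>e = i u p\<close>, and \<open>w\<close> is chosen so that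
    \<open>e = g w = w g\<close>. Hence \<open>e\<close> inherits from \<open>g\<close> the
    relations with \<open>f\<close>.\<close>
  define w where "w = i \<cdot> u \<cdot> u \<cdot> p"
  have p': "u \<cdot> p \<in> Hom H J" by (rule Hom_comp[OF p uHom]) simp_all
  have g: "g \<in> Hom H H" unfolding g_def by (rule Hom_comp[OF p i]) simp_all
  have e: "e \<in> Hom H H" unfolding e_def by (rule Hom_comp[OF p' i]) simp_all
  have [simp]: "w \<in> Arr C" "Dom C w = Car H" "Cod C w = Car H" unfolding w_def by simp_all
  note [simp] = Hom_typing[OF g] Hom_typing[OF e]
  have eg: "e \<cdot> g = g" "g \<cdot> e = g" and ew: "g \<cdot> w = e" "w \<cdot> g = e"
    unfolding e_def g_def w_def by (simp_all add: u1' u2')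
  note D = D[folded g_def]
  \<comment> \<open>Composing \<open>e\<close> with \<open>f + g = 1\<close> on either side and
    using \<open>e g = g = g e\<close> gives \<open>e f + g = e = f e + g\<close>; cancelling
    \<open>g\<close> yields \<open>e f = f e\<close>.\<close>
  have e1: "e = (e \<cdot> f) \<star>\<^bsub>H,H\<^esub> g"
    using alg_hom_conv[OF HomD(1)[OF e], of H f g] by (simp add: D(3) eg)
  have e2: "e = (f \<cdot> e) \<star>\<^bsub>H,H\<^esub> g"
    using coalg_hom_conv[OF HomD(2)[OF e], of H f g] by (simp add: D(3) eg)
  have ef: "e \<cdot> f = f \<cdot> e"
    by (rule conv_cancel_right[OF trans[OF e1[symmetric] e2] HomD(2)[OF g]]) simp_all
  have "bicommuting C H (g \<cdot> w) (f \<cdot> ?I)"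
    by (rule bicommuting_precomp[OF bicommuting_sym[OF D(4)]]) simp_all
  then have b1: "bicommuting C H e f" by (simp add: ew)
  have "bicocommuting C H (w \<cdot> g) (?I \<cdot> f)"
    by (rule bicocommuting_postcomp[OF bicocommuting_sym[OF D(5)]]) simp_all
  then have b2: "bicocommuting C H e f" by (simp add: ew)
  define z where "z = e \<cdot> f"
  have z: "z \<in> Hom H H" unfolding z_def by (rule Hom_comp[OF D(1) e]) simp_all
  note [simp] = Hom_typing[OF z]
  \<comment> \<open>As \<open>z\<close> is both \<open>e f\<close> and \<open>f e\<close>, the
    relation of \<open>f\<close> with \<open>e\<close> handles the summand \<open>f\<close>, and
    that of \<open>g\<close> with \<open>f\<close> handles the summand \<open>g\<close>.\<close>
  have "bicommuting C H (f \<cdot> ?I) z" "bicommuting C H (g \<cdot> ?I) z"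
    unfolding z_def
    using bicommuting_precomp[OF bicommuting_sym[OF b1], of ?I f]
      bicommuting_precomp[OF bicommuting_sym[OF D(4)], of ?I e]
    by (simp_all add: ef)
  then have "bicommuting C H (f \<star>\<^bsub>H,H\<^esub> g) z"
    by (intro bicommuting_conv[of H f z g H H]) simp_all
  then have z1: "bicommuting C H z ?I" by (simp add: D(3) bicommuting_sym)
  have "bicocommuting C H (?I \<cdot> f) (f \<cdot> e)" "bicocommuting C H (?I \<cdot> g) (e \<cdot> f)"
    by (rule bicocommuting_postcomp[OF bicocommuting_sym[OF b2]]
      bicocommuting_postcomp[OF bicocommuting_sym[OF D(5)]]; simp)+
  then have "bicocommuting C H (f \<star>\<^bsub>H,H\<^esub> g) z"
    by (intro bicocommuting_conv[of H f z g H H]) (simp_all add: z_def ef)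
  then have z2: "bicocommuting C H z ?I" by (simp add: D(3) bicocommuting_sym)
  let ?y = "Ant H \<cdot> z"
  have y: "?y \<in> Hom H H" "bicommuting C H ?y ?I" "bicocommuting C H ?y ?I"
    using central_antipode[OF z z1 z2] by simp_all
  have yc: "bicommuting C H ?y x" "bicocommuting C H ?y x" if "x \<in> Arr C" "Dom C x = Car H"
      "Cod C x = Car H" for x
    using bicommuting_precomp[OF y(2), of ?I x] bicocommuting_postcomp[OF y(3), of ?I x] that by simp_all
  \<comment> \<open>The difference \<open>f - z\<close>, so that
    \<open>e' + e = (f - z) + (z + g) = f + g = 1\<close>.\<close>
  define e' where "e' = f \<star>\<^bsub>H,H\<^esub> ?y"
  have e': "e' \<in> Hom H H" unfolding e'_def
    by (rule hopf_Hom_conv[OF D(1) y(1) bicommuting_sym[OF yc(1)] bicocommuting_sym[OF yc(2)]]) simp_all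
  have "e' \<star>\<^bsub>H,H\<^esub> e = f \<star>\<^bsub>H,H\<^esub> ((?y \<star>\<^bsub>H,H\<^esub> z) \<star>\<^bsub>H,H\<^esub> g)"
    unfolding e'_def by (subst e1) (simp add: conv_assoc z_def)
  then have "e' \<star>\<^bsub>H,H\<^esub> e = ?I"
    using antipode_conv_hom(1)[OF HomD(2)[OF z]] by (simp add: D(3))
  moreover have "bicommuting C H e' e" unfolding e'_def
    by (rule bicommuting_conv[OF bicommuting_sym[OF b1] yc(1)]) simp_all
  moreover have "bicocommuting C H e' e" unfolding e'_def
    by (rule bicocommuting_conv[OF bicocommuting_sym[OF b2] yc(2)]) simp_all
  ultimately have "complementary C H e' (i \<cdot> u \<cdot> p)" using e e' unfolding e_def
    by (simp add: complementary_def)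
  then show ?thesis using p' u1 by (intro exI[of _ "u \<cdot> p"] exI[of _ e']) simp
qed

text \<open>Compose \<open>e' + i p = 1\<close> with \<open>i\<close> on the right and with
  \<open>p\<close> on the left, then cancel \<open>i\<close> and \<open>p\<close>. Composing it with
  \<open>e'\<close> on the left now leaves \<open>e' e' = e'\<close>.\<close>

lemma complementary_idempotent:
  assumes c: "complementary C H e' (i \<cdot> p)" and i: "i \<in> Hom J H" and p: "p \<in> Hom H J"
    and pi: "p \<cdot> i = idm J" and [simp]: "is_hopf_algebra C H" "is_hopf_algebra C J"
  shows "e' \<cdot> i = zer J H" "p \<cdot> e' = zer H J" "e' \<cdot> e' = e'"
proof -
  note D = complementaryD[OF c]
  note [simp] = Hom_typing[OF D(1)] Hom_typing[OF i] Hom_typing[OF p]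
  have pi': "p \<cdot> i \<cdot> x = x" if "x \<in> Arr C" "Cod C x = Car J" for x
    using Cmp_reassoc[OF pi, of x] that by simp
  have "(e' \<cdot> i) \<star>\<^bsub>J,H\<^esub> i = (e' \<star>\<^bsub>H,H\<^esub> (i \<cdot> p)) \<cdot> i"
    using coalg_hom_conv[OF HomD(2)[OF i], of H e' "i \<cdot> p"] by (simp add: pi)
  then have "(e' \<cdot> i) \<star>\<^bsub>J,H\<^esub> i = zer J H \<star>\<^bsub>J,H\<^esub> i" by (simp add: D(3))
  then show 1: "e' \<cdot> i = zer J H" by (rule conv_cancel_right[OF _ HomD(2)[OF i]]) simp_all
  have "(p \<cdot> e') \<star>\<^bsub>H,J\<^esub> p = p \<cdot> (e' \<star>\<^bsub>H,H\<^esub> (i \<cdot> p))"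
    using alg_hom_conv[OF HomD(1)[OF p], of H e' "i \<cdot> p"] by (simp add: pi')
  then have "(p \<cdot> e') \<star>\<^bsub>H,J\<^esub> p = zer H J \<star>\<^bsub>H,J\<^esub> p" by (simp add: D(3))
  then show "p \<cdot> e' = zer H J" by (rule conv_cancel_right[OF _ HomD(2)[OF p]]) simp_all
  have "e' \<cdot> i \<cdot> p = zer H H"
    using Cmp_reassoc[OF 1, of p] coalg_hom_zer[OF HomD(2)[OF p], of H] by simp
  then show "e' \<cdot> e' = e'"
    using alg_hom_conv[OF HomD(1)[OF D(1)], of H e' "i \<cdot> p"] by (simp add: D(3))
qed

text \<open>An internal splitting becomes an external one through the inverse pair
  \<open>\<nabla> (i \<otimes> j)\<close> and \<open>(p \<otimes> q) \<Delta>\<close>. That the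
  factors are unbraided is a consequence: both orders of \<open>\<curlyvee>\<close> hold for
  \<open>i\<close> and \<open>j\<close>, and \<open>\<nabla> (i \<otimes> j)\<close> can be
  cancelled.\<close>

lemma tensor_decomposition:
  assumes i: "i \<in> Hom A H" and p: "p \<in> Hom H A" and j: "j \<in> Hom B H" and q: "q \<in> Hom H B"
    and pi: "p \<cdot> i = idm A" and qj: "q \<cdot> j = idm B" and pj: "p \<cdot> j = zer B A" and qi: "q \<cdot> i = zer A B"
    and ij: "(i \<cdot> p) \<star>\<^bsub>H,H\<^esub> (j \<cdot> q) = idm H" and c: "bicommuting C H i j"
    and [simp]: "is_hopf_algebra C A" "is_hopf_algebra C B" "is_hopf_algebra C H"
  shows "unbraided C (Car A) (Car B)" "hopf_isomorphic C H (A \<boxtimes> B)"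
proof -
  note [simp] = Hom_typing[OF i] Hom_typing[OF p] Hom_typing[OF j] Hom_typing[OF q]
  let ?t = "\<nabla>\<^bsub>H\<^esub> \<cdot> (i \<otimes> j)" and ?s = "(p \<otimes> q) \<cdot> \<Delta>\<^bsub>H\<^esub>" and ?T = "A \<boxtimes> B"
  have t_alg: "alg_hom C ?T H ?t"
    using c by (intro alg_hom_Mul HomD[OF i] HomD[OF j]) (simp_all add: bicommuting_def)
  have t_coalg: "coalg_hom C ?T H ?t"
    by (intro coalg_hom_Mul HomD[OF i] HomD[OF j]) simp_all
  have t: "?t = (i \<cdot> pr1 C A B) \<star>\<^bsub>?T,H\<^esub> (j \<cdot> pr2 C A B)" by (rule conv_pr(1)[symmetric]) simp_all
  have pi': "p \<cdot> i \<cdot> x = x" if "x \<in> Arr C" "Cod C x = Car A" for x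
    using Cmp_reassoc[OF pi, of x] that by simp
  have qj': "q \<cdot> j \<cdot> x = x" if "x \<in> Arr C" "Cod C x = Car B" for x
    using Cmp_reassoc[OF qj, of x] that by simp
  have pj': "p \<cdot> j \<cdot> pr2 C A B = zer ?T A"
    using Cmp_reassoc[OF pj, of "pr2 C A B"] coalg_hom_zer[OF pr_coalg_hom(2)[of A B], of A] by simp
  have qi': "q \<cdot> i \<cdot> pr1 C A B = zer ?T B"
    using Cmp_reassoc[OF qi, of "pr1 C A B"] coalg_hom_zer[OF pr_coalg_hom(1)[of A B], of B] by simp
  have "p \<cdot> ?t = pr1 C A B"
    unfolding t by (subst alg_hom_conv[OF HomD(1)[OF p]]) (simp_all add: pi' pj')
  moreover have "q \<cdot> ?t = pr2 C A B"
    unfolding t by (subst alg_hom_conv[OF HomD(1)[OF q]]) (simp_all add: qj' qi')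
  moreover have "?s \<cdot> ?t = ((p \<cdot> ?t) \<otimes> (q \<cdot> ?t)) \<cdot> Com ?T"
  proof -
    have "\<Delta>\<^bsub>H\<^esub> \<cdot> ?t = (?t \<otimes> ?t) \<cdot> Com ?T" using t_coalg by (simp add: coalg_hom_def)
    then show ?thesis by (simp del: Ten_assoc)
  qed
  ultimately have st: "?s \<cdot> ?t = Idn C (Car ?T)" by (simp only: pr_Com) (simp add: pr_Com)
  have ts: "?t \<cdot> ?s = idm H" using ij by (simp add: conv_def)
  have mi: "mutually_inverse C ?t ?s" using st ts by (simp add: mutually_inverse_iff)
  have tHom: "?t \<in> hopf_Hom C ?T H" using t_alg t_coalg by (simp add: hopf_Hom_iff)
  have "?s \<in> Hom H ?T" by (rule hopf_Hom_inverse[OF tHom mi]) simp_all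
  moreover have "mutually_inverse C ?s ?t" using mi by (auto simp: mutually_inverse_iff)
  ultimately have "?s \<in> hopf_Iso C H ?T" using tHom by (auto simp: hopf_Iso_def)
  then show "hopf_isomorphic C H ?T" by (auto simp: hopf_isomorphic_def)
  have c1: "\<nabla>\<^bsub>H\<^esub> \<cdot> (j \<otimes> i) = \<nabla>\<^bsub>H\<^esub> \<cdot> (i \<otimes> j) \<cdot> \<tau> (Car B) (Car A)"
    using c[unfolded bicommuting_def commuting_def, THEN conjunct1] by simp
  have c2: "\<nabla>\<^bsub>H\<^esub> \<cdot> (i \<otimes> j) = \<nabla>\<^bsub>H\<^esub> \<cdot> (j \<otimes> i) \<cdot> \<tau> (Car A) (Car B)"
    using c[unfolded bicommuting_def commuting_def, THEN conjunct2] by simp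
  \<comment> \<open>Applying \<open>\<curlyvee>\<close> in both orders inserts two successive
    braidings after \<open>?t\<close>; as \<open>?t\<close> has a left inverse, the double braiding
    is an identity.\<close>
  have "?t \<cdot> Idn C (Car A \<odot> Car B) = (\<nabla>\<^bsub>H\<^esub> \<cdot> (j \<otimes> i)) \<cdot> \<tau> (Car A) (Car B)"
    using c2 by simp
  also have "\<dots> = ?t \<cdot> \<tau> (Car B) (Car A) \<cdot> \<tau> (Car A) (Car B)"
    unfolding c1 by simp
  finally have "Idn C (Car A \<odot> Car B) = \<tau> (Car B) (Car A) \<cdot> \<tau> (Car A) (Car B)"
    by (rule Cmp_cancel_left[rotated, where h = ?s and X = "Car A \<odot> Car B"]) (use st in simp_all)
  \<comment> \<open>Only one composite of the two braidings is known so far. Invertibility of the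
    braiding supplies the other.\<close>
  moreover obtain k where "mutually_inverse C (\<tau> (Car A) (Car B)) k"
    using Brd_isomorphism[of "Car A" "Car B"] by (auto simp: is_isomorphism_def)
  ultimately show "unbraided C (Car A) (Car B)"
    unfolding unbraided_def
    by (intro isomorphismI_left_right[where h = k]) (simp_all add: mutually_inverse_iff)
qed

end

section \<open>Images of Hopf morphisms\<close>

context category
begin

lemma is_mono_Cmp:
  assumes "is_mono C f" "is_mono C g" "Dom C g = Cod C f"
  shows "is_mono C (g \<cdot> f)"
  unfolding is_mono_def
proof (intro conjI allI ballI impI)
  show "g \<cdot> f \<in> Arr C" using assms by (simp add: is_mono_def)
  fix X h k assume h: "h \<in> Mor C X (Dom C (g \<cdot> f))" and k: "k \<in> Mor C X (Dom C (g \<cdot> f))"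
      and eq: "(g \<cdot> f) \<cdot> h = (g \<cdot> f) \<cdot> k"
  have [simp]: "f \<in> Arr C" "g \<in> Arr C" using assms by (auto simp: is_mono_def)
  note [simp] = assms(3)
  have *: "h \<in> Arr C" "k \<in> Arr C" "Dom C h = X" "Dom C k = X" "Cod C h = Dom C f" "Cod C k = Dom C f"
    using h k by (simp_all add: Mor_iff)
  then have "g \<cdot> f \<cdot> h = g \<cdot> f \<cdot> k" using eq by simp
  then have "f \<cdot> h = f \<cdot> k" using assms(2) * by (auto simp: is_mono_def Mor_iff)
  then show "h = k" using assms(1) * by (auto simp: is_mono_def Mor_iff)
qed

lemma mono_cancel:
  assumes "is_mono C m" "m \<cdot> x = m \<cdot> y" "x \<in> Arr C" "y \<in> Arr C" "Dom C x = Dom C y" "Cod C x = Dom C m"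
      "Cod C y = Dom C m"
  shows "x = y"
  using assms by (auto simp: is_mono_def Mor_iff)

lemma epi_cancel:
  assumes "is_epi C e" "x \<cdot> e = y \<cdot> e" "x \<in> Arr C" "y \<in> Arr C" "Cod C x = Cod C y" "Dom C x = Cod C e"
      "Dom C y = Cod C e"
  shows "x = y"
  using assms by (auto simp: is_epi_def Mor_iff)

end

section \<open>Zero morphisms, image factorization and diagonal fill-in in an abelian
  category\<close>

context abelian_category
begin

lemma Zro_Mor:
  assumes "A \<in> Obj C" "B \<in> Obj C"
  shows "Zro C A B \<in> Mor C A B" "f \<in> Mor C A B \<Longrightarrow> f \<oplus> Zro C A B = f"
proof -
  interpret g: comm_group "Mor_group C A B" by (rule Mor_comm_group[OF assms])
  show "Zro C A B \<in> Mor C A B" "f \<in> Mor C A B \<Longrightarrow> f \<oplus> Zro C A B = f"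
    using g.one_closed g.r_one by (simp_all add: Mor_group_def)
qed

lemma Add_self_Zro:
  assumes "A \<in> Obj C" "B \<in> Obj C" "f \<in> Mor C A B" "f \<oplus> f = f"
  shows "f = Zro C A B"
proof -
  interpret g: comm_group "Mor_group C A B" by (rule Mor_comm_group[OF assms(1,2)])
  show ?thesis using g.l_cancel_one[of f f] assms by (simp add: Mor_group_def)
qed

lemma Add_diff:
  assumes "A \<in> Obj C" "B \<in> Obj C" "f \<in> Mor C A B" "g \<in> Mor C A B"
  shows "\<exists>d \<in> Mor C A B. f = d \<oplus> g"
proof -
  let ?G = "Mor_group C A B"
  interpret g: comm_group ?G by (rule Mor_comm_group[OF assms(1,2)])
  have G: "f \<in> carrier ?G" "g \<in> carrier ?G" using assms by (simp_all add: Mor_group_def)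
  let ?d = "monoid.mult ?G f (inv\<^bsub>?G\<^esub> g)"
  have "?d \<in> carrier ?G" "monoid.mult ?G ?d g = f" using G by (simp_all add: g.m_assoc)
  then show ?thesis by (intro bexI[of _ ?d]) (simp_all add: Mor_group_def)
qed

lemma Add_Zro_left:
  assumes "A \<in> Obj C" "B \<in> Obj C" "f \<in> Mor C A B"
  shows "Zro C A B \<oplus> f = f"
proof -
  interpret g: comm_group "Mor_group C A B" by (rule Mor_comm_group[OF assms(1,2)])
  show ?thesis using g.l_one[of f] assms(3) by (simp add: Mor_group_def)
qed

lemma Cmp_Zro:
  assumes "f \<in> Mor C A B"
  shows "D \<in> Obj C \<Longrightarrow> f \<cdot> Zro C D A = Zro C D B" "D \<in> Obj C \<Longrightarrow> Zro C B D \<cdot> f = Zro C A D"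
proof -
  have o: "A \<in> Obj C" "B \<in> Obj C" using assms by (auto simp: Mor_iff)
  show "f \<cdot> Zro C D A = Zro C D B" if D: "D \<in> Obj C"
  proof (rule Add_self_Zro)
    show "f \<cdot> Zro C D A \<oplus> f \<cdot> Zro C D A = f \<cdot> Zro C D A"
      using Cmp_Add_right[OF Zro_Mor(1) Zro_Mor(1) assms, of D] Zro_Mor[OF D o(1)] D o by simp
    show "f \<cdot> Zro C D A \<in> Mor C D B" using Cmp_Mor[OF Zro_Mor(1) assms] D o by simp
  qed (use D o in simp_all)
  show "Zro C B D \<cdot> f = Zro C A D" if D: "D \<in> Obj C"
  proof (rule Add_self_Zro)
    show "Zro C B D \<cdot> f \<oplus> Zro C B D \<cdot> f = Zro C B D \<cdot> f"
      using Cmp_Add_left[OF assms Zro_Mor(1) Zro_Mor(1), of D] Zro_Mor[OF o(2) D] D o by simp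
    show "Zro C B D \<cdot> f \<in> Mor C A D" using Cmp_Mor[OF assms Zro_Mor(1)] D o by simp
  qed (use D o in simp_all)
qed

lemma is_kernel_mono:
  assumes k: "is_kernel C k f"
  shows "is_mono C k"
  unfolding is_mono_def
proof (intro conjI allI ballI impI)
  have [simp]: "k \<in> Arr C" "f \<in> Arr C" "Cod C k = Dom C f" using k by (auto simp: is_kernel_def)
  show "k \<in> Arr C" by simp
  fix X g h assume g: "g \<in> Mor C X (Dom C k)" and h: "h \<in> Mor C X (Dom C k)" and eq: "k \<cdot> g = k \<cdot> h"
  have [simp]: "g \<in> Arr C" "Dom C g = X" "Cod C g = Dom C k" using g by (auto simp: Mor_iff)
  have "f \<cdot> k \<cdot> g = (f \<cdot> k) \<cdot> g" by simp
  also have "\<dots> = Zro C (Dom C k) (Cod C f) \<cdot> g" using k by (simp add: is_kernel_def)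
  also have "\<dots> = Zro C X (Cod C f)" by (rule Cmp_Zro(2)[OF g]) simp
  finally have "\<exists>!u. u \<in> Mor C X (Dom C k) \<and> k \<cdot> u = k \<cdot> g"
    using k unfolding is_kernel_def by (auto simp: Mor_iff)
  then show "g = h" using g h eq by metis
qed

text \<open>Morphisms between fixed objects form a group, so cancellation need only be tested
  against zero.\<close>

lemma is_epiI:
  assumes p: "p \<in> Mor C A B" and z: "\<And>X t. t \<in> Mor C B X \<Longrightarrow> t \<cdot> p = Zro C A X \<Longrightarrow> t = Zro C B X"
  shows "is_epi C p"
  unfolding is_epi_def
proof (intro conjI allI ballI impI)
  show "p \<in> Arr C" using p by (simp add: Mor_iff)
  fix X g h assume "g \<in> Mor C (Cod C p) X" "h \<in> Mor C (Cod C p) X" and eq: "g \<cdot> p = h \<cdot> p"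
  then have g: "g \<in> Mor C B X" and h: "h \<in> Mor C B X" using p by (simp_all add: Mor_iff)
  then have o: "B \<in> Obj C" "X \<in> Obj C" "A \<in> Obj C" using p by (auto simp: Mor_iff)
  obtain d where d: "d \<in> Mor C B X" "g = d \<oplus> h" using Add_diff[OF o(1,2) g h] by blast
  interpret gr: comm_group "Mor_group C A X" by (rule Mor_comm_group[OF o(3,2)])
  have dp: "d \<cdot> p \<in> Mor C A X" "h \<cdot> p \<in> Mor C A X" using Cmp_Mor[OF p] d h by simp_all
  have "d \<cdot> p \<oplus> h \<cdot> p = h \<cdot> p" using Cmp_Add_left[OF p d(1) h] d(2) eq by simp
  then have "d \<cdot> p = Zro C A X"
    using gr.r_cancel_one[of "h \<cdot> p" "d \<cdot> p"] dp by (simp add: Mor_group_def)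
  then have "d = Zro C B X" by (rule z[OF d(1)])
  then show "g = h" using d Add_Zro_left[OF o(1,2) h] by simp
qed

lemma mono_is_kernel_of_cokernel:
  assumes "is_mono C k" "is_cokernel C q k"
  shows "is_kernel C k q"
proof -
  obtain f where f: "is_kernel C k f" using mono_normal[OF assms(1)] by blast
  note q = assms(2)[unfolded is_cokernel_def]
  note k = f[unfolded is_kernel_def]
  have [simp]: "f \<in> Arr C" "k \<in> Arr C" "q \<in> Arr C" "Cod C k = Dom C f" "Dom C q = Dom C f" using k q
    by auto
  have "f \<in> Mor C (Cod C k) (Cod C f)" by (simp add: Mor_iff)
  then obtain f' where f': "f' \<in> Mor C (Cod C q) (Cod C f)" "f' \<cdot> q = f" using q k by blast
  have "\<exists>!u. u \<in> Mor C X (Dom C k) \<and> k \<cdot> u = g" if g: "g \<in> Mor C X (Dom C q)"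
      "q \<cdot> g = Zro C X (Cod C q)" for X g
  proof -
    have g': "g \<in> Arr C" "Dom C g = X" "Cod C g = Dom C f" "X \<in> Obj C" using g by (auto simp: Mor_iff)
    have "f \<cdot> g = (f' \<cdot> q) \<cdot> g" by (simp only: f'(2))
    also have "\<dots> = f' \<cdot> q \<cdot> g" by (rule Cmp_assoc') (use f'(1) g' in \<open>simp_all add: Mor_iff\<close>)
    also have "\<dots> = Zro C X (Cod C f)" unfolding g(2) by (rule Cmp_Zro(1)[OF f'(1) g'(4)])
    finally show ?thesis using k g by simp
  qed
  then show ?thesis using q by (simp add: is_kernel_def)
qed

lemma mono_short_exact: "is_mono C k \<Longrightarrow> \<exists>q. short_exact C k q"
  using cokernels[of k] mono_is_kernel_of_cokernel by (auto simp: short_exact_def is_mono_def)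

text \<open>The image \<open>i\<close> is the kernel of the cokernel \<open>q\<close> of
  \<open>f\<close>. To see that the induced \<open>p\<close> is epi, let \<open>t p = 0\<close> and
  \<open>k = ker t\<close>. The mono \<open>i k\<close> is the kernel of some \<open>s\<close>; this
  \<open>s\<close> kills \<open>f\<close>, so it factors through \<open>q\<close> and kills
  \<open>i\<close>. Hence \<open>i\<close> factors through \<open>i k\<close>, so \<open>k\<close>
  has a right inverse and \<open>t = 0\<close>.\<close>

lemma image_factorization:
  assumes f: "f \<in> Arr C"
  shows "\<exists>i p. i \<in> Arr C \<and> p \<in> Arr C \<and> Dom C i = Cod C p \<and> f = i \<cdot> p \<and> is_mono C i \<and> is_epi C p"
proof -
  obtain q where q: "is_cokernel C q f" using cokernels[OF f] by blast
  have [simp]: "q \<in> Arr C" "Dom C q = Cod C f" "f \<in> Arr C" using q f by (auto simp: is_cokernel_def)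
  obtain i where i: "is_kernel C i q" using kernels[of q] by auto
  have [simp]: "i \<in> Arr C" "Cod C i = Cod C f" using i by (auto simp: is_kernel_def)
  have mi: "is_mono C i" using i by (rule is_kernel_mono)
  have "f \<in> Mor C (Dom C f) (Dom C q)" "q \<cdot> f = Zro C (Dom C f) (Cod C q)" using q
    by (auto simp: Mor_iff is_cokernel_def)
  then obtain p where p: "p \<in> Mor C (Dom C f) (Dom C i)" "i \<cdot> p = f" using i unfolding is_kernel_def
    by blast
  have [simp]: "p \<in> Arr C" "Dom C p = Dom C f" "Cod C p = Dom C i" using p by (auto simp: Mor_iff)
  have "is_epi C p"
  proof (rule is_epiI[OF p(1)])
    fix X t assume t: "t \<in> Mor C (Dom C i) X" and tp: "t \<cdot> p = Zro C (Dom C f) X"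
    have [simp]: "t \<in> Arr C" "Dom C t = Dom C i" "Cod C t = X" using t by (auto simp: Mor_iff)
    have X: "X \<in> Obj C" using Dom_Cod_Obj(2)[of t] by simp
    obtain k where k: "is_kernel C k t" using kernels[of t] by auto
    have [simp]: "k \<in> Arr C" "Cod C k = Dom C i" using k by (auto simp: is_kernel_def)
    have "p \<in> Mor C (Dom C f) (Dom C t)" "t \<cdot> p = Zro C (Dom C f) (Cod C t)" using p(1) tp by simp_all
    then obtain p' where p': "p' \<in> Mor C (Dom C f) (Dom C k)" "k \<cdot> p' = p"
      using k unfolding is_kernel_def by blast
    have [simp]: "p' \<in> Arr C" "Dom C p' = Dom C f" "Cod C p' = Dom C k" using p' by (auto simp: Mor_iff)
    have "is_mono C (i \<cdot> k)" by (rule is_mono_Cmp[OF is_kernel_mono[OF k] mi]) simp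
    then obtain s where s: "is_kernel C (i \<cdot> k) s" using mono_normal by blast
    have [simp]: "s \<in> Arr C" "Dom C s = Cod C f" using s by (auto simp: is_kernel_def)
    have so: "Cod C s \<in> Obj C" "Dom C f \<in> Obj C" "Dom C i \<in> Obj C" by simp_all
    have sik: "(s \<cdot> i \<cdot> k) = Zro C (Dom C k) (Cod C s)" using s by (simp add: is_kernel_def)
    have "s \<cdot> f = (s \<cdot> i \<cdot> k) \<cdot> p'" unfolding p(2)[symmetric] p'(2)[symmetric] by simp
    also have "\<dots> = Zro C (Dom C f) (Cod C s)" unfolding sik using Cmp_Zro(2)[OF p'(1) so(1)] .
    finally have "s \<cdot> f = Zro C (Dom C f) (Cod C s)" .
    moreover have "s \<in> Mor C (Cod C f) (Cod C s)" by (simp add: Mor_iff)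
    ultimately obtain s' where s': "s' \<in> Mor C (Cod C q) (Cod C s)" "s' \<cdot> q = s"
      using q unfolding is_cokernel_def by blast
    have [simp]: "s' \<in> Arr C" "Dom C s' = Cod C q" "Cod C s' = Cod C s" using s' by (auto simp: Mor_iff)
    have "s \<cdot> i = s' \<cdot> q \<cdot> i" unfolding s'(2)[symmetric] by simp
    also have "\<dots> = Zro C (Dom C i) (Cod C s)"
      using i Cmp_Zro(1)[OF s'(1) so(3)] by (simp add: is_kernel_def)
    finally have "s \<cdot> i = Zro C (Dom C i) (Cod C s)" .
    moreover have "i \<in> Mor C (Dom C i) (Dom C s)" by (simp add: Mor_iff)
    ultimately obtain m where m: "m \<in> Mor C (Dom C i) (Dom C (i \<cdot> k))" "(i \<cdot> k) \<cdot> m = i"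
      using s unfolding is_kernel_def by blast
    have [simp]: "m \<in> Arr C" "Dom C m = Dom C i" "Cod C m = Dom C k" using m by (auto simp: Mor_iff)
    have "k \<cdot> m = Idn C (Dom C i)" by (rule mono_cancel[OF mi]) (use m in simp_all)
    then have "t = (t \<cdot> k) \<cdot> m" by simp
    also have "t \<cdot> k = Zro C (Dom C k) X" using k by (simp add: is_kernel_def)
    finally show "t = Zro C (Dom C i) X" using Cmp_Zro(2)[OF m(1) X] by simp
  qed
  then show ?thesis using mi p(2) by (intro exI[of _ i] exI[of _ p]) simp
qed

text \<open>The epi \<open>e\<close> is a cokernel of some \<open>r\<close>, so \<open>a\<close>
  descends along \<open>e\<close> as soon as it kills \<open>r\<close>, which can be checked after
  the mono \<open>m\<close>.\<close>

lemma epi_mono_diagonal: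
  assumes e: "is_epi C e" and m: "is_mono C m" and sq: "m \<cdot> a = b \<cdot> e"
    and [simp]: "a \<in> Arr C" "b \<in> Arr C" "Dom C a = Dom C e" "Cod C a = Dom C m" "Dom C b = Cod C e"
        "Cod C b = Cod C m"
  shows "\<exists>d \<in> Mor C (Cod C e) (Dom C m). d \<cdot> e = a \<and> m \<cdot> d = b"
proof -
  obtain r where r: "is_cokernel C e r" using epi_normal[OF e] by blast
  have [simp]: "e \<in> Arr C" "m \<in> Arr C" "r \<in> Arr C" "Cod C r = Dom C e" using e m r
    by (auto simp: is_epi_def is_mono_def is_cokernel_def)
  have er: "e \<cdot> r = Zro C (Dom C r) (Cod C e)" using r by (simp add: is_cokernel_def)
  have o: "Dom C r \<in> Obj C" "Cod C b \<in> Obj C" "Dom C m \<in> Obj C"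
    by (simp, simp only: Dom_Cod_Obj \<open>b \<in> Arr C\<close>, simp)
  have "m \<cdot> a \<cdot> r = (b \<cdot> e) \<cdot> r" unfolding sq[symmetric] by simp
  also have "\<dots> = b \<cdot> Zro C (Dom C r) (Cod C e)" by (simp add: er)
  also have "\<dots> = Zro C (Dom C r) (Cod C m)" by (rule Cmp_Zro(1)) (use o in \<open>simp_all add: Mor_iff\<close>)
  also have "\<dots> = m \<cdot> Zro C (Dom C r) (Dom C m)"
    by (rule Cmp_Zro(1)[symmetric]) (use o in \<open>simp_all add: Mor_iff\<close>)
  finally have "a \<cdot> r = Zro C (Dom C r) (Dom C m)"
    by (rule mono_cancel[OF m]) (use Zro_Mor(1)[OF o(1,3)] in \<open>simp_all add: Mor_iff\<close>)
  moreover have "a \<in> Mor C (Cod C r) (Dom C m)" by (simp add: Mor_iff)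
  ultimately obtain d where d: "d \<in> Mor C (Cod C e) (Dom C m)" "d \<cdot> e = a"
    using r unfolding is_cokernel_def by blast
  then have t: "d \<in> Arr C" "Dom C d = Cod C e" "Cod C d = Dom C m" by (simp_all add: Mor_iff)
  then have "(m \<cdot> d) \<cdot> e = m \<cdot> d \<cdot> e" by simp
  also have "\<dots> = b \<cdot> e" unfolding d(2) by (rule sq)
  finally have "m \<cdot> d = b" by (rule epi_cancel[OF e]) (use t in simp_all)
  then show ?thesis using d by blast
qed

end

section \<open>Hopf structure on images\<close>

context abelian_braided_category
begin

text \<open>Exactness of the tensor product enters here: a mono starts a short exact sequence with
  its cokernel, tensoring keeps the sequence exact, and kernels are monos.\<close>

lemma is_mono_Ten_Idn:
  assumes "is_mono C i" "X \<in> Obj C"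
  shows "is_mono C (i \<otimes> Idn C X)" "is_mono C (Idn C X \<otimes> i)"
proof -
  obtain q where "short_exact C i q" using mono_short_exact[OF assms(1)] by blast
  then have "short_exact C (i \<otimes> Idn C X) (q \<otimes> Idn C X)" "short_exact C (Idn C X \<otimes> i) (Idn C X \<otimes> q)"
    using Ten_exact_left Ten_exact_right assms(2) by blast+
  then show "is_mono C (i \<otimes> Idn C X)" "is_mono C (Idn C X \<otimes> i)"
    by (auto simp: short_exact_def intro: is_kernel_mono)
qed

lemma is_mono_Ten:
  assumes "is_mono C i" "is_mono C j"
  shows "is_mono C (i \<otimes> j)"
proof -
  have [simp]: "i \<in> Arr C" "j \<in> Arr C" using assms by (simp_all add: is_mono_def)
  have "is_mono C ((i \<otimes> Idn C (Cod C j)) \<cdot> (Idn C (Dom C i) \<otimes> j))"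
    by (rule is_mono_Cmp) (simp_all add: assms is_mono_Ten_Idn)
  then show ?thesis by simp
qed

lemma is_epi_Ten:
  assumes "is_epi C i" "is_epi C j"
  shows "is_epi C (i \<otimes> j)"
proof -
  interpret d: abelian_braided_category "dual_cat C" by (rule dual_abelian)
  show ?thesis using d.is_mono_Ten[of i j] assms by simp
qed

lemma alg_hom_mono_factor:
  assumes h: "alg_hom C X L (i \<cdot> h)" and i: "alg_hom C J L i" and m: "is_mono C i"
    and [simp]: "h \<in> Arr C" "Dom C h = Car X" "Cod C h = Car J" "is_algebra C X" "is_algebra C L"
        "is_algebra C J"
  shows "alg_hom C X J h"
proof -
  note [simp] = hom_typing(1-3)[OF i]
  have I: "i \<cdot> \<nabla>\<^bsub>J\<^esub> = \<nabla>\<^bsub>L\<^esub> \<cdot> (i \<otimes> i)" "i \<cdot> \<eta>\<^bsub>J\<^esub> = \<eta>\<^bsub>L\<^esub>" using i by (simp_all add: alg_hom_def)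
  have "i \<cdot> h \<cdot> \<nabla>\<^bsub>X\<^esub> = i \<cdot> \<nabla>\<^bsub>J\<^esub> \<cdot> (h \<otimes> h)"
    using h Cmp_reassoc[OF I(1), of "h \<otimes> h"] by (simp add: alg_hom_def)
  then have "h \<cdot> \<nabla>\<^bsub>X\<^esub> = \<nabla>\<^bsub>J\<^esub> \<cdot> (h \<otimes> h)" by (rule mono_cancel[OF m]) simp_all
  moreover have "i \<cdot> h \<cdot> \<eta>\<^bsub>X\<^esub> = i \<cdot> \<eta>\<^bsub>J\<^esub>" using h I by (simp add: alg_hom_def)
  then have "h \<cdot> \<eta>\<^bsub>X\<^esub> = \<eta>\<^bsub>J\<^esub>" by (rule mono_cancel[OF m]) simp_all
  ultimately show ?thesis by (simp add: alg_hom_def)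
qed

text \<open>In contrast to the algebra case, comultiplicativity is obtained by cancelling
  \<open>i \<otimes> i\<close>, which is mono by exactness.\<close>

lemma coalg_hom_mono_factor:
  assumes h: "coalg_hom C X L (i \<cdot> h)" and i: "coalg_hom C J L i" and m: "is_mono C i"
    and [simp]: "h \<in> Arr C" "Dom C h = Car X" "Cod C h = Car J" "is_coalgebra C X" "is_coalgebra C L"
        "is_coalgebra C J"
  shows "coalg_hom C X J h"
proof -
  note [simp] = hom_typing(4-6)[OF i]
  have I: "\<Delta>\<^bsub>L\<^esub> \<cdot> i = (i \<otimes> i) \<cdot> \<Delta>\<^bsub>J\<^esub>" "\<epsilon>\<^bsub>L\<^esub> \<cdot> i = \<epsilon>\<^bsub>J\<^esub>" using i by (simp_all add: coalg_hom_def)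
  have H: "\<Delta>\<^bsub>L\<^esub> \<cdot> i \<cdot> h = ((i \<cdot> h) \<otimes> (i \<cdot> h)) \<cdot> \<Delta>\<^bsub>X\<^esub>" "\<epsilon>\<^bsub>L\<^esub> \<cdot> i \<cdot> h = \<epsilon>\<^bsub>X\<^esub>"
    using h by (simp_all add: coalg_hom_def)
  have "(i \<otimes> i) \<cdot> \<Delta>\<^bsub>J\<^esub> \<cdot> h = (i \<otimes> i) \<cdot> (h \<otimes> h) \<cdot> \<Delta>\<^bsub>X\<^esub>"
    using Cmp_reassoc[OF I(1), of h] H(1) by simp
  then have "\<Delta>\<^bsub>J\<^esub> \<cdot> h = (h \<otimes> h) \<cdot> \<Delta>\<^bsub>X\<^esub>" by (rule mono_cancel[OF is_mono_Ten[OF m m]]) simp_all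
  moreover have "\<epsilon>\<^bsub>J\<^esub> \<cdot> h = \<epsilon>\<^bsub>X\<^esub>" using Cmp_reassoc[OF I(2), of h] H(2) by simp
  ultimately show ?thesis by (simp add: coalg_hom_def)
qed

lemma hopf_Hom_mono_factor:
  assumes "i \<cdot> h \<in> Hom X L" "i \<in> Hom J L" "is_mono C i"
    "h \<in> Arr C" "Dom C h = Car X" "Cod C h = Car J" "is_bialgebra C X" "is_bialgebra C L"
      "is_bialgebra C J"
  shows "h \<in> Hom X J"
  using assms alg_hom_mono_factor[of X L i h J] coalg_hom_mono_factor[of X L i h J]
    by (simp add: hopf_Hom_iff)

lemma hopf_Hom_epi_factor:
  assumes "h \<cdot> p \<in> Hom L X" "p \<in> Hom L J" "is_epi C p"
    "h \<in> Arr C" "Cod C h = Car X" "Dom C h = Car J" "is_bialgebra C X" "is_bialgebra C L"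
      "is_bialgebra C J"
  shows "h \<in> Hom J X"
proof -
  interpret d: abelian_braided_category "dual_cat C" by (rule dual_abelian)
  show ?thesis
    using d.hopf_Hom_mono_factor[of p h "dual_hopf X" "dual_hopf L" "dual_hopf J"] assms by simp
qed

lemma is_algebra_mono:
  assumes i: "alg_hom C J L i" and m: "is_mono C i" and [simp]: "is_algebra C L"
    "\<nabla>\<^bsub>J\<^esub> \<in> Arr C" "Dom C \<nabla>\<^bsub>J\<^esub> = Car J \<odot> Car J" "Cod C \<nabla>\<^bsub>J\<^esub> = Car J"
    "\<eta>\<^bsub>J\<^esub> \<in> Arr C" "Dom C \<eta>\<^bsub>J\<^esub> = Unit C" "Cod C \<eta>\<^bsub>J\<^esub> = Car J"
  shows "is_algebra C J"
proof -
  note [simp] = hom_typing(1-3)[OF i]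
  let ?j = "idm J" and ?l = "idm L"
  have [simp]: "Car J \<in> Obj C" using Dom_Cod_Obj(1)[of i] by simp
  have I: "i \<cdot> \<nabla>\<^bsub>J\<^esub> = \<nabla>\<^bsub>L\<^esub> \<cdot> (i \<otimes> i)" "i \<cdot> \<eta>\<^bsub>J\<^esub> = \<eta>\<^bsub>L\<^esub>" using i by (simp_all add: alg_hom_def)
  have a: "\<nabla>\<^bsub>L\<^esub> \<cdot> (\<nabla>\<^bsub>L\<^esub> \<otimes> ?l) = \<nabla>\<^bsub>L\<^esub> \<cdot> (?l \<otimes> \<nabla>\<^bsub>L\<^esub>)" "\<nabla>\<^bsub>L\<^esub> \<cdot> (\<eta>\<^bsub>L\<^esub> \<otimes> ?l) = ?l" "\<nabla>\<^bsub>L\<^esub> \<cdot> (?l \<otimes> \<eta>\<^bsub>L\<^esub>) = ?l"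
    using \<open>is_algebra C L\<close> unfolding is_algebra_def by blast+
  have step: "i \<cdot> \<nabla>\<^bsub>J\<^esub> \<cdot> x = \<nabla>\<^bsub>L\<^esub> \<cdot> (i \<otimes> i) \<cdot> x" if "x \<in> Arr C" "Cod C x = Car J \<odot> Car J" for x
    using Cmp_reassoc[OF I(1), of x] that by simp
  have "i \<cdot> \<nabla>\<^bsub>J\<^esub> \<cdot> (\<nabla>\<^bsub>J\<^esub> \<otimes> ?j) = \<nabla>\<^bsub>L\<^esub> \<cdot> (\<nabla>\<^bsub>L\<^esub> \<otimes> ?l) \<cdot> ((i \<otimes> i) \<otimes> i)"
    by (simp add: step I del: Ten_assoc)
  also have "\<dots> = (\<nabla>\<^bsub>L\<^esub> \<cdot> (?l \<otimes> \<nabla>\<^bsub>L\<^esub>)) \<cdot> (i \<otimes> i \<otimes> i)"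
    by (subst Cmp_reassoc[OF a(1)]) simp_all
  also have "\<dots> = i \<cdot> \<nabla>\<^bsub>J\<^esub> \<cdot> (?j \<otimes> \<nabla>\<^bsub>J\<^esub>)"
    by (simp add: step I)
  finally have 1: "\<nabla>\<^bsub>J\<^esub> \<cdot> (\<nabla>\<^bsub>J\<^esub> \<otimes> ?j) = \<nabla>\<^bsub>J\<^esub> \<cdot> (?j \<otimes> \<nabla>\<^bsub>J\<^esub>)" by (rule mono_cancel[OF m]) simp_all
  have "i \<cdot> \<nabla>\<^bsub>J\<^esub> \<cdot> (\<eta>\<^bsub>J\<^esub> \<otimes> ?j) = \<nabla>\<^bsub>L\<^esub> \<cdot> (\<eta>\<^bsub>L\<^esub> \<otimes> ?l) \<cdot> (Idn C (Unit C) \<otimes> i)"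
    by (simp add: step I del: Ten_Unit_left)
  also have "\<dots> = i \<cdot> ?j" by (subst Cmp_reassoc[OF a(2)]) simp_all
  finally have 2: "\<nabla>\<^bsub>J\<^esub> \<cdot> (\<eta>\<^bsub>J\<^esub> \<otimes> ?j) = ?j" by (rule mono_cancel[OF m]) simp_all
  have "i \<cdot> \<nabla>\<^bsub>J\<^esub> \<cdot> (?j \<otimes> \<eta>\<^bsub>J\<^esub>) = \<nabla>\<^bsub>L\<^esub> \<cdot> (?l \<otimes> \<eta>\<^bsub>L\<^esub>) \<cdot> (i \<otimes> Idn C (Unit C))"
    by (simp add: step I del: Ten_Unit_right)
  also have "\<dots> = i \<cdot> ?j" by (subst Cmp_reassoc[OF a(3)]) simp_all
  finally have 3: "\<nabla>\<^bsub>J\<^esub> \<cdot> (?j \<otimes> \<eta>\<^bsub>J\<^esub>) = ?j" by (rule mono_cancel[OF m]) simp_all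
  show ?thesis unfolding is_algebra_def using 1 2 3 by simp
qed

lemma is_coalgebra_epi:
  assumes "coalg_hom C H J p" "is_epi C p" "is_coalgebra C H"
    "\<Delta>\<^bsub>J\<^esub> \<in> Arr C" "Dom C \<Delta>\<^bsub>J\<^esub> = Car J" "Cod C \<Delta>\<^bsub>J\<^esub> = Car J \<odot> Car J"
    "\<epsilon>\<^bsub>J\<^esub> \<in> Arr C" "Dom C \<epsilon>\<^bsub>J\<^esub> = Car J" "Cod C \<epsilon>\<^bsub>J\<^esub> = Unit C"
  shows "is_coalgebra C J"
proof -
  interpret d: abelian_braided_category "dual_cat C" by (rule dual_abelian)
  show ?thesis using d.is_algebra_mono[of "dual_hopf J" "dual_hopf H" p] assms by simp
qed

lemma is_bialgebraI:
  assumes [simp]: "is_algebra C D" "is_coalgebra C D"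
    and "coalg_hom C (D \<boxtimes> D) D \<nabla>\<^bsub>D\<^esub>" "coalg_hom C (unit_hopf C) D \<eta>\<^bsub>D\<^esub>"
  shows "is_bialgebra C D"
proof -
  have "\<Delta>\<^bsub>D\<^esub> \<cdot> \<nabla>\<^bsub>D\<^esub> = (\<nabla>\<^bsub>D\<^esub> \<otimes> \<nabla>\<^bsub>D\<^esub>) \<cdot> Com (D \<boxtimes> D)" "\<epsilon>\<^bsub>D\<^esub> \<cdot> \<nabla>\<^bsub>D\<^esub> = \<epsilon>\<^bsub>D\<^esub> \<otimes> \<epsilon>\<^bsub>D\<^esub>"
    using assms(3) unfolding coalg_hom_def by simp_all
  moreover have "\<Delta>\<^bsub>D\<^esub> \<cdot> \<eta>\<^bsub>D\<^esub> = \<eta>\<^bsub>D\<^esub> \<otimes> \<eta>\<^bsub>D\<^esub>" "\<epsilon>\<^bsub>D\<^esub> \<cdot> \<eta>\<^bsub>D\<^esub> = Idn C (Unit C)"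
    using assms(4) unfolding coalg_hom_def by simp_all
  ultimately show ?thesis unfolding is_bialgebra_def tensor_hopf_def using assms(1,2) by simp
qed

text \<open>The structure maps come from diagonal fill-ins between \<open>p\<close> or
  \<open>p \<otimes> p\<close> and \<open>i\<close> or \<open>i \<otimes> i\<close>. The algebra
  axioms are then reflected along the mono \<open>i\<close>, the coalgebra axioms pushed along the
  epi \<open>p\<close>, and the bialgebra and antipode axioms follow by cancelling
  \<open>i\<close>.\<close>

lemma hopf_image:
  assumes f: "f \<in> Hom H L" and [simp]: "is_hopf_algebra C H" "is_hopf_algebra C L"
  shows "\<exists>J i p. is_hopf_algebra C J \<and> i \<in> Hom J L \<and> p \<in> Hom H J \<and>
    is_mono C i \<and> is_epi C p \<and> f = i \<cdot> p"
proof -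
  note [simp] = Hom_typing[OF f]
  have F: "f \<cdot> \<nabla>\<^bsub>H\<^esub> = \<nabla>\<^bsub>L\<^esub> \<cdot> (f \<otimes> f)" "f \<cdot> \<eta>\<^bsub>H\<^esub> = \<eta>\<^bsub>L\<^esub>" "\<Delta>\<^bsub>L\<^esub> \<cdot> f = (f \<otimes> f) \<cdot> \<Delta>\<^bsub>H\<^esub>" "\<epsilon>\<^bsub>L\<^esub> \<cdot> f = \<epsilon>\<^bsub>H\<^esub>"
    using f by (simp_all add: hopf_Hom_def)
  obtain i p where i [simp]: "i \<in> Arr C" and p [simp]: "p \<in> Arr C" and "Dom C i = Cod C p"
      and ip: "f = i \<cdot> p"
    and m: "is_mono C i" and e: "is_epi C p" using image_factorization[of f] by auto
  define c where "c = Cod C p"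
  have [simp]: "Cod C p = c" "Dom C i = c" "Dom C p = Car H" "Cod C i = Car L" "c \<in> Obj C"
    using \<open>Dom C i = Cod C p\<close> Hom_typing[OF f] unfolding ip c_def by simp_all
  have F': "i \<cdot> p \<cdot> \<nabla>\<^bsub>H\<^esub> = \<nabla>\<^bsub>L\<^esub> \<cdot> ((i \<cdot> p) \<otimes> (i \<cdot> p))" "i \<cdot> p \<cdot> \<eta>\<^bsub>H\<^esub> = \<eta>\<^bsub>L\<^esub>"
    "\<Delta>\<^bsub>L\<^esub> \<cdot> i \<cdot> p = ((i \<cdot> p) \<otimes> (i \<cdot> p)) \<cdot> \<Delta>\<^bsub>H\<^esub>" "\<epsilon>\<^bsub>L\<^esub> \<cdot> i \<cdot> p = \<epsilon>\<^bsub>H\<^esub>" "i \<cdot> p \<cdot> Ant H = Ant L \<cdot> i \<cdot> p"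
    using F hopf_Hom_antipode[OF f] unfolding ip by simp_all
  note ii = is_mono_Ten[OF m m] and pp = is_epi_Ten[OF e e]
  obtain mu where mu: "mu \<in> Arr C" "Dom C mu = c \<odot> c" "Cod C mu = c" "mu \<cdot> (p \<otimes> p) = p \<cdot> \<nabla>\<^bsub>H\<^esub>"
      "i \<cdot> mu = \<nabla>\<^bsub>L\<^esub> \<cdot> (i \<otimes> i)"
    using epi_mono_diagonal[OF pp m, of "p \<cdot> \<nabla>\<^bsub>H\<^esub>" "\<nabla>\<^bsub>L\<^esub> \<cdot> (i \<otimes> i)"] F' by (auto simp del: Ten_assoc)
  obtain de where de: "de \<in> Arr C" "Dom C de = c" "Cod C de = c \<odot> c" "de \<cdot> p = (p \<otimes> p) \<cdot> \<Delta>\<^bsub>H\<^esub>"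
      "(i \<otimes> i) \<cdot> de = \<Delta>\<^bsub>L\<^esub> \<cdot> i"
    using epi_mono_diagonal[OF e ii, of "(p \<otimes> p) \<cdot> \<Delta>\<^bsub>H\<^esub>" "\<Delta>\<^bsub>L\<^esub> \<cdot> i"] F' by (auto simp del: Ten_assoc)
  obtain s where s: "s \<in> Arr C" "Dom C s = c" "Cod C s = c" "s \<cdot> p = p \<cdot> Ant H" "i \<cdot> s = Ant L \<cdot> i"
    using epi_mono_diagonal[OF e m, of "p \<cdot> Ant H" "Ant L \<cdot> i"] F' by auto
  \<comment> \<open>Unit and counit need no fill-in: the unit is pushed forward from
    \<open>H\<close>, the counit restricted from \<open>L\<close>.\<close>
  define J where "J = \<lparr>Car = c, Mul = mu, Unt = p \<cdot> \<eta>\<^bsub>H\<^esub>, Com = de, Cou = \<epsilon>\<^bsub>L\<^esub> \<cdot> i, Ant = s\<rparr>"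
  have J [simp]: "Car J = c" "Mul J = mu" "Unt J = p \<cdot> \<eta>\<^bsub>H\<^esub>" "Com J = de" "Cou J = \<epsilon>\<^bsub>L\<^esub> \<cdot> i" "Ant J = s"
    by (simp_all add: J_def)
  note [simp] = mu(1-3) de(1-3) s(1-3)
  have ia: "alg_hom C J L i" using mu(5) F'(2) by (simp add: alg_hom_def)
  have ic: "coalg_hom C J L i" using de(5) by (simp add: coalg_hom_def)
  have pa: "alg_hom C H J p" using mu(4) by (simp add: alg_hom_def)
  have pc: "coalg_hom C H J p" using de(4) F'(4) by (simp add: coalg_hom_def)
  have [simp]: "is_algebra C J" by (rule is_algebra_mono[OF ia m]) simp_all
  have [simp]: "is_coalgebra C J" by (rule is_coalgebra_epi[OF pc e]) simp_all
  have "coalg_hom C (J \<boxtimes> J) L (\<nabla>\<^bsub>L\<^esub> \<cdot> (i \<otimes> i))"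
    by (rule coalg_hom_Mul[OF ic ic]) simp_all
  then have "coalg_hom C (J \<boxtimes> J) L (i \<cdot> mu)" by (simp add: mu(5))
  then have "coalg_hom C (J \<boxtimes> J) J mu" by (rule coalg_hom_mono_factor[OF _ ic m]) simp_all
  moreover have "coalg_hom C (unit_hopf C) L (i \<cdot> p \<cdot> \<eta>\<^bsub>H\<^esub>)" using F'(2) coalg_hom_unit(2)[of L] by simp
  then have "coalg_hom C (unit_hopf C) J (p \<cdot> \<eta>\<^bsub>H\<^esub>)" by (rule coalg_hom_mono_factor[OF _ ic m]) simp_all
  ultimately have bi: "is_bialgebra C J"
    by (intro is_bialgebraI) simp_all
  have "i \<cdot> (s \<star>\<^bsub>J,J\<^esub> Idn C c) = i \<cdot> zer J J"
    using alg_hom_conv[OF ia, of J s "Idn C c"] antipode_conv_hom(1)[OF ic] alg_hom_zer[OF ia, of J]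
      by (simp add: s(5))
  then have S1: "s \<star>\<^bsub>J,J\<^esub> Idn C c = zer J J" by (rule mono_cancel[OF m]) simp_all
  have "i \<cdot> (Idn C c \<star>\<^bsub>J,J\<^esub> s) = i \<cdot> zer J J"
    using alg_hom_conv[OF ia, of J "Idn C c" s] antipode_conv_hom(2)[OF ic] alg_hom_zer[OF ia, of J]
      by (simp add: s(5))
  then have S2: "Idn C c \<star>\<^bsub>J,J\<^esub> s = zer J J" by (rule mono_cancel[OF m]) simp_all
  have "is_hopf_algebra C J" using S1 S2 by (intro is_hopf_algebraI[of J s] bi) simp_all
  then show ?thesis using ia ic pa pc m e ip
    by (intro exI[of _ J] exI[of _ i] exI[of _ p]) (simp add: hopf_Hom_iff)
qed

section \<open>Tensor factors and the Fitting decomposition\<close>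

text \<open>The complementary factor is the image \<open>B\<close> of the idempotent complement
  \<open>e'\<close>. Idempotence turns the image factorization \<open>e' = j q\<close> into a
  splitting, \<open>q j = 1\<close>, and \<open>tensor_decomposition\<close> applies.\<close>

lemma tensor_factorI:
  assumes c: "complementary C H f (i \<cdot> p)" and i: "i \<in> Hom J H" and p: "p \<in> Hom H J"
    and iso: "is_isomorphism C (p \<cdot> i)" and [simp]: "is_hopf_algebra C H" "is_hopf_algebra C J"
  shows "tensor_factor C J H"
proof -
  obtain p' e' where p': "p' \<in> Hom H J" "p' \<cdot> i = idm J" and e': "complementary C H e' (i \<cdot> p')"
    using complementary_retract[OF c i p iso] by auto
  note D = complementaryD[OF e']
  note [simp] = Hom_typing[OF D(1)] Hom_typing[OF i] Hom_typing[OF p'(1)]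
  have e'_eqs: "e' \<cdot> i = zer J H" "p' \<cdot> e' = zer H J" "e' \<cdot> e' = e'"
    using complementary_idempotent[OF e' i p'] by simp_all
  obtain B j q where B [simp]: "is_hopf_algebra C B" and j: "j \<in> Hom B H" and q: "q \<in> Hom H B"
    and jm: "is_mono C j" and qe: "is_epi C q" and jq: "e' = j \<cdot> q"
    using hopf_image[OF D(1)] by auto
  note [simp] = Hom_typing[OF j] Hom_typing[OF q]
  \<comment> \<open>Idempotence of \<open>j q\<close> gives \<open>q j = 1\<close> after cancelling
    the mono \<open>j\<close> on the left and the epi \<open>q\<close> on the right.\<close>
  have "j \<cdot> q \<cdot> j \<cdot> q = j \<cdot> q" using e'_eqs(3) unfolding jq by simp
  then have "q \<cdot> j \<cdot> q = q" by (rule mono_cancel[OF jm]) simp_all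
  then have "(q \<cdot> j) \<cdot> q = idm B \<cdot> q" by simp
  then have qj: "q \<cdot> j = idm B" by (rule epi_cancel[OF qe]) simp_all
  have "(p' \<cdot> j) \<cdot> q = zer B J \<cdot> q"
    using e'_eqs(2) coalg_hom_zer[OF HomD(2)[OF q], of J] unfolding jq by simp
  then have pj: "p' \<cdot> j = zer B J" by (rule epi_cancel[OF qe]) simp_all
  have "j \<cdot> q \<cdot> i = j \<cdot> zer J B"
    using e'_eqs(1) alg_hom_zer[OF HomD(1)[OF j], of J] unfolding jq by simp
  then have qi: "q \<cdot> i = zer J B" by (rule mono_cancel[OF jm]) simp_all
  have "bicommuting C H ((i \<cdot> p') \<cdot> i) (e' \<cdot> j)"
    by (rule bicommuting_precomp[OF bicommuting_sym[OF D(4)]]) simp_all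
  then have ij: "bicommuting C H i j" by (simp add: p' qj jq)
  have "(i \<cdot> p') \<star>\<^bsub>H,H\<^esub> (j \<cdot> q) = idm H"
    using complementaryD(3)[OF complementary_sym[OF e']] by (simp add: jq)
  from tensor_decomposition[OF i p'(1) j q p'(2) qj pj qi this ij] show ?thesis
    unfolding tensor_factor_def by (intro conjI exI[of _ B]) simp_all
qed

lemma is_isomorphism_cpow:
  assumes "is_isomorphism C w" "Dom C w = A" "Cod C w = A"
  shows "is_isomorphism C (cpow C A w n)"
proof (induction n)
  case 0
  have "w \<in> Arr C" using assms by (auto simp: is_isomorphism_def mutually_inverse_iff)
  then have "A \<in> Obj C" using assms by auto
  then show ?case by (simp add: is_isomorphism_Idn)
next
  case (Suc n)
  have "w \<in> Arr C" using assms by (auto simp: is_isomorphism_def mutually_inverse_iff)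
  then show ?case using is_isomorphism_Cmp[OF Suc assms(1)] assms by simp
qed

lemma is_mono_Cmp_right:
  assumes "is_mono C (g \<cdot> f)" "f \<in> Arr C" "g \<in> Arr C" "Dom C g = Cod C f"
  shows "is_mono C f"
  unfolding is_mono_def
proof (intro conjI allI ballI impI)
  fix X h k assume "h \<in> Mor C X (Dom C f)" "k \<in> Mor C X (Dom C f)" and eq: "f \<cdot> h = f \<cdot> k"
  then have *: "h \<in> Arr C" "Dom C h = X" "Cod C h = Dom C f" "k \<in> Arr C" "Dom C k = X"
      "Cod C k = Dom C f" by simp_all
  have "(g \<cdot> f) \<cdot> h = g \<cdot> f \<cdot> h" using * assms by simp
  also have "\<dots> = (g \<cdot> f) \<cdot> k" unfolding eq using * assms by simp
  finally show "h = k" by (rule mono_cancel[OF assms(1)]) (use * assms in simp_all)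
qed (use assms in simp)

lemma is_epi_Cmp_left:
  assumes "is_epi C (g \<cdot> f)" "f \<in> Arr C" "g \<in> Arr C" "Dom C g = Cod C f"
  shows "is_epi C g"
proof -
  interpret d: abelian_braided_category "dual_cat C" by (rule dual_abelian)
  show ?thesis using d.is_mono_Cmp_right[of f g] assms by simp
qed

text \<open>
  Let \<open>J\<^sub>n\<close> be the image of \<open>g\<^sup>n\<close>. The inclusions \<open>J\<^sub>n\<^sub>+\<^sub>1 \<rightarrow> J\<^sub>n\<close> form a chain of Hopf subalgebras and
  the restrictions \<open>J\<^sub>n \<rightarrow> J\<^sub>n\<^sub>+\<^sub>1\<close> of \<open>g\<close> a chain of quotients; both are eventually invertible.
\<close>

lemma fitting:
  assumes g: "g \<in> Hom H H" and dcc: "both_chain_conditions C H" and [simp]: "is_hopf_algebra C H"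
  shows "\<exists>n J i p. is_hopf_algebra C J \<and> i \<in> Hom J H \<and> p \<in> Hom H J \<and>
    cpow C (Car H) g (Suc n) = i \<cdot> p \<and> is_isomorphism C (p \<cdot> i) \<and> is_isomorphism C (p \<cdot> g \<cdot> i)"
proof -
  note [simp] = Hom_typing[OF g]
  let ?g = "cpow C (Car H) g"
  \<comment> \<open>At \<open>n = 0\<close> the image is taken to be \<open>H\<close> itself and not
    merely an isomorphic copy, because the chains in the chain conditions start literally at
    \<open>H\<close>.\<close>
  have "\<exists>J i p. is_hopf_algebra C J \<and> i \<in> Hom J H \<and> p \<in> Hom H J \<and>
      is_mono C i \<and> is_epi C p \<and> ?g n = i \<cdot> p \<and> (n = 0 \<longrightarrow> J = H)" for n
  proof (cases "n = 0")
    case True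
    have "is_mono C (idm H)" "is_epi C (idm H)"
      by (auto simp: is_mono_def is_epi_def)
    then show ?thesis using True by (intro exI[of _ H] exI[of _ "idm H"]) simp
  next
    case False
    then show ?thesis using hopf_image[OF cpow_hopf_Hom[OF g], of n] by auto
  qed
  then obtain J i p where JH [simp]: "\<And>n. is_hopf_algebra C (J n)" and i: "\<And>n. i n \<in> Hom (J n) H"
    and p: "\<And>n. p n \<in> Hom H (J n)" and im: "\<And>n. is_mono C (i n)" and pe: "\<And>n. is_epi C (p n)"
    and ip: "\<And>n. ?g n = i n \<cdot> p n" and J0: "J 0 = H"
    by metis
  note [simp] = Hom_typing[OF i] Hom_typing[OF p]
  \<comment> \<open>The inclusion of consecutive images arises from writing the next power as
    \<open>g\<^sup>n g\<close>; the restriction of \<open>g\<close> constructed after it arises from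
    writing that power as \<open>g g\<^sup>n\<close>.\<close>
  have "\<exists>t. t \<in> Arr C \<and> Dom C t = Car (J (Suc n)) \<and> Cod C t = Car (J n) \<and> i n \<cdot> t = i (Suc n)" for n
  proof -
    have "i n \<cdot> p n \<cdot> g = (i n \<cdot> p n) \<cdot> g" by simp
    also have "\<dots> = i (Suc n) \<cdot> p (Suc n)"
      unfolding ip[symmetric] by (rule cpow_Suc_right) simp_all
    finally show ?thesis
      using epi_mono_diagonal[OF pe im, of n "p n \<cdot> g" "i (Suc n)" "Suc n"] by auto
  qed
  then obtain t where t: "\<And>n. t n \<in> Arr C" "\<And>n. Dom C (t n) = Car (J (Suc n))"
      "\<And>n. Cod C (t n) = Car (J n)"
    and it: "\<And>n. i n \<cdot> t n = i (Suc n)" by metis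
  have "\<exists>s. s \<in> Arr C \<and> Dom C s = Car (J n) \<and> Cod C s = Car (J (Suc n)) \<and> s \<cdot> p n = p (Suc n)
      \<and> i (Suc n) \<cdot> s = g \<cdot> i n" for n
  proof -
    have "i (Suc n) \<cdot> p (Suc n) = g \<cdot> i n \<cdot> p n" unfolding ip[symmetric] by simp
    then have "i (Suc n) \<cdot> p (Suc n) = (g \<cdot> i n) \<cdot> p n" by simp
    then show ?thesis
      using epi_mono_diagonal[OF pe im, of "Suc n" "p (Suc n)" "g \<cdot> i n" n] by auto
  qed
  then obtain s where s: "\<And>n. s n \<in> Arr C" "\<And>n. Dom C (s n) = Car (J n)"
      "\<And>n. Cod C (s n) = Car (J (Suc n))"
    and sp: "\<And>n. s n \<cdot> p n = p (Suc n)" and si: "\<And>n. i (Suc n) \<cdot> s n = g \<cdot> i n" by metis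
  note [simp] = t s
  have "hopf_subalgebra C (J (Suc n)) (t n) (J n)" for n
    unfolding hopf_subalgebra_def
    using hopf_Hom_mono_factor[of "i n" "t n" "J (Suc n)" H "J n"] is_mono_Cmp_right[of "i n" "t n"] im i
    by (simp add: it)
  then obtain N1 where N1: "\<And>n. n \<ge> N1 \<Longrightarrow> is_isomorphism C (t n)"
    using dcc J0 unfolding both_chain_conditions_def dcc_hopf_subalgebras_def by blast
  have "hopf_quotient C (J n) (s n) (J (Suc n))" for n
    unfolding hopf_quotient_def
    using hopf_Hom_epi_factor[of "s n" "p n" H "J (Suc n)" "J n"] is_epi_Cmp_left[of "s n" "p n"] pe p
    by (simp add: sp)
  then obtain N2 where N2: "\<And>n. n \<ge> N2 \<Longrightarrow> is_isomorphism C (s n)"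
    using dcc J0 unfolding both_chain_conditions_def dcc_hopf_quotients_def by blast
  \<comment> \<open>A stage beyond both bounds and at least 1, since a positive power is claimed: a
    factor \<open>g\<close> can then be split off from it later.\<close>
  define n where "n = Suc (max N1 N2)"
  let ?w = "t n \<cdot> s n"
  have w: "is_isomorphism C ?w" by (rule is_isomorphism_Cmp) (use N1[of n] N2[of n]
      in \<open>simp_all add: n_def\<close>)
  \<comment> \<open>The composite of restriction and inclusion is \<open>g\<close> as an
    endomorphism of \<open>J n\<close>, and it is invertible at this stage.\<close>
  have gi: "g \<cdot> i n = i n \<cdot> ?w"
  proof -
    have "g \<cdot> i n = (i n \<cdot> t n) \<cdot> s n" by (simp only: it si)
    then show ?thesis by simp
  qed
  have gk: "?g k \<cdot> i n = i n \<cdot> cpow C (Car (J n)) ?w k" for k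
  proof (induction k)
    case (Suc k)
    have "?g (Suc k) \<cdot> i n = g \<cdot> i n \<cdot> cpow C (Car (J n)) ?w k" using Suc by simp
    also have "\<dots> = (i n \<cdot> ?w) \<cdot> cpow C (Car (J n)) ?w k" by (rule Cmp_reassoc[OF gi]) simp_all
    finally show ?case by simp
  qed simp
  \<comment> \<open>Since \<open>g\<^sup>n = i p\<close> and \<open>g\<close> restricts to
    \<open>?w\<close>, the composite \<open>p i\<close> is the \<open>n\<close>-th power of
    \<open>?w\<close>.\<close>
  have "i n \<cdot> p n \<cdot> i n = i n \<cdot> cpow C (Car (J n)) ?w n"
    using gk[of n] by (simp add: ip)
  then have pi: "p n \<cdot> i n = cpow C (Car (J n)) ?w n" by (rule mono_cancel[OF im]) simp_all
  have iso: "is_isomorphism C (p n \<cdot> i n)" unfolding pi by (rule is_isomorphism_cpow[OF w]) simp_all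
  have "is_isomorphism C ((p n \<cdot> i n) \<cdot> ?w)" by (rule is_isomorphism_Cmp[OF w iso]) simp_all
  then have "is_isomorphism C (p n \<cdot> g \<cdot> i n)" unfolding gi by simp
  with iso i[of n] p[of n] ip[of n] show ?thesis unfolding n_def
    by (intro exI[of _ "max N1 N2"] exI[of _ "J (Suc (max N1 N2))"] exI) simp
qed

section \<open>Common tensor factors obtained from a product \<open>b c\<close>\<close>

lemma cpow_conjugate:
  assumes "b \<in> Arr C" "c \<in> Arr C" "Dom C c = A" "Cod C c = B" "Dom C b = B" "Cod C b = A"
  shows "c \<cdot> cpow C A (b \<cdot> c) n \<cdot> b = cpow C B (c \<cdot> b) (Suc n)"
proof (induction n)
  case 0
  show ?case using assms by simp
next
  case (Suc n)
  have "c \<cdot> cpow C A (b \<cdot> c) (Suc n) \<cdot> b = (c \<cdot> b) \<cdot> c \<cdot> cpow C A (b \<cdot> c) n \<cdot> b"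
    using assms by simp
  then show ?case unfolding Suc by simp
qed

text \<open>The Fitting part \<open>J\<close> of \<open>b c\<close> is carried to \<open>K\<close>
  by \<open>c i\<close> and \<open>p b\<close>. In one order these compose to a power of
  \<open>c b\<close>, in the other to \<open>p (b c) i\<close>; the invertibility of the latter is
  the last clause of \<open>fitting\<close>.\<close>

lemma common_factor_of_product:
  assumes b: "b \<in> Hom K H" and c: "c \<in> Hom H K" and f: "complementary C H f (b \<cdot> c)"
    and f': "complementary C K f' (c \<cdot> b)" and dcc: "both_chain_conditions C H"
    and [simp]: "is_hopf_algebra C H" "is_hopf_algebra C K"
  shows "\<exists>n J i p. common_tensor_factor C J H K \<and> is_hopf_algebra C J \<and> i \<in> Hom J H \<and> p \<in> Hom H J \<and>
    cpow C (Car H) (b \<cdot> c) (Suc n) = i \<cdot> p \<and> is_isomorphism C (p \<cdot> i)"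
proof -
  note [simp] = Hom_typing[OF b] Hom_typing[OF c]
  have bc: "b \<cdot> c \<in> Hom H H" by (rule Hom_comp[OF c b]) simp_all
  obtain n J i p where [simp]: "is_hopf_algebra C J" and i: "i \<in> Hom J H" and p: "p \<in> Hom H J"
    and ip: "cpow C (Car H) (b \<cdot> c) (Suc n) = i \<cdot> p"
        and iso: "is_isomorphism C (p \<cdot> i)" "is_isomorphism C (p \<cdot> (b \<cdot> c) \<cdot> i)"
    using fitting[OF bc dcc] by auto
  note [simp] = Hom_typing[OF i] Hom_typing[OF p]
  obtain h where "complementary C H h (i \<cdot> p)" using complementary_cpow[OF f, of n] unfolding ip by auto
  then have 1: "tensor_factor C J H" by (rule tensor_factorI[OF _ i p iso(1)]) simp_all
  have "(c \<cdot> i) \<cdot> (p \<cdot> b) = c \<cdot> (i \<cdot> p) \<cdot> b" by simp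
  also have "\<dots> = cpow C (Car K) (c \<cdot> b) (Suc (Suc n))" unfolding ip[symmetric]
    by (rule cpow_conjugate) simp_all
  finally obtain h' where "complementary C K h' ((c \<cdot> i) \<cdot> (p \<cdot> b))"
    using complementary_cpow[OF f', of "Suc n"] by auto
  then have 2: "tensor_factor C J K"
    by (rule tensor_factorI[OF _ Hom_comp[OF i c] Hom_comp[OF b p]]) (use iso(2) in simp_all)
  show ?thesis using 1 2 i p ip iso(1) unfolding common_tensor_factor_def
    by (intro exI[of _ n] exI[of _ J] exI[of _ i] exI[of _ p]) simp
qed

text \<open>The only Hopf morphisms to and from the unit are \<open>\<epsilon>\<close> and
  \<open>\<eta>\<close>. As \<open>\<epsilon> \<eta> = 1\<close> always holds, they are mutually
  inverse exactly when \<open>\<eta> \<epsilon> = 1\<close>.\<close>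

lemma trivial_hopf_iff:
  assumes [simp]: "is_hopf_algebra C A"
  shows "trivial_hopf C A \<longleftrightarrow> idm A = zer A A"
proof
  assume "trivial_hopf C A"
  then obtain h k where h: "h \<in> Hom A (unit_hopf C)" and k: "k \<in> Hom (unit_hopf C) A"
      and hk: "mutually_inverse C h k"
    by (auto simp: trivial_hopf_def hopf_isomorphic_def hopf_Iso_def)
  note [simp] = Hom_typing[OF h] Hom_typing[OF k]
  have "h = \<epsilon>\<^bsub>A\<^esub>" "k = \<eta>\<^bsub>A\<^esub>" using h k by (simp_all add: hopf_Hom_def)
  then show "idm A = zer A A" using hk by (simp add: mutually_inverse_iff cunit_def)
next
  assume id: "idm A = zer A A"
  interpret d: strict_braided_category "dual_cat C" by (rule dual)
  have "alg_hom C A (unit_hopf C) \<epsilon>\<^bsub>A\<^esub>" using d.coalg_hom_unit(2)[of "dual_hopf A"] alg_hom_dual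
    by (metis coalg_hom_dual dual_hopf_simps(3) hopf_algebraD(1) is_bialgebra_dual assms
      unit_hopf_simps(7,8))
  then have h: "\<epsilon>\<^bsub>A\<^esub> \<in> Hom A (unit_hopf C)" by (simp add: hopf_Hom_iff coalg_hom_unit)
  have m: "mutually_inverse C \<epsilon>\<^bsub>A\<^esub> \<eta>\<^bsub>A\<^esub>"
    using id bialgebra_axioms(4)[of A] by (simp add: mutually_inverse_iff cunit_def)
  have "\<eta>\<^bsub>A\<^esub> \<in> Hom (unit_hopf C) A" by (rule hopf_Hom_inverse[OF h m]) simp_all
  with h m show "trivial_hopf C A" by (auto simp: trivial_hopf_def hopf_isomorphic_def hopf_Iso_def)
qed

text \<open>Triviality is assumed only for factors \<open>J\<close> through which a positive power
  of \<open>b c\<close> splits off. This form serves both cases: with central \<open>b\<close> and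
  \<open>c\<close> the extra data show that \<open>J\<close> is abelian, and otherwise they are
  ignored. A trivial \<open>J\<close> makes that power zero.\<close>

lemma complementary_isomorphism:
  assumes b: "b \<in> Hom K H" and c: "c \<in> Hom H K" and f: "complementary C H f (b \<cdot> c)"
    and f': "complementary C K f' (c \<cdot> b)" and dcc: "both_chain_conditions C H"
    and [simp]: "is_hopf_algebra C H" "is_hopf_algebra C K"
    and triv: "\<And>J i p n. common_tensor_factor C J H K \<Longrightarrow> is_hopf_algebra C J \<Longrightarrow> i \<in> Hom J H \<Longrightarrow>
      p \<in> Hom H J \<Longrightarrow> cpow C (Car H) (b \<cdot> c) (Suc n) = i \<cdot> p \<Longrightarrow> is_isomorphism C (p \<cdot> i) \<Longrightarrow> trivial_hopf C J"
  shows "is_isomorphism C f"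
proof -
  obtain n J i p where *: "common_tensor_factor C J H K" and J [simp]: "is_hopf_algebra C J"
      and i: "i \<in> Hom J H" and p: "p \<in> Hom H J"
    and ip: "cpow C (Car H) (b \<cdot> c) (Suc n) = i \<cdot> p" "is_isomorphism C (p \<cdot> i)"
    using common_factor_of_product[OF b c f f' dcc] by auto
  note [simp] = Hom_typing[OF i] Hom_typing[OF p]
  have "idm J = zer J J" using triv[OF * J i p ip] by (simp add: trivial_hopf_iff)
  then have "i \<cdot> p = i \<cdot> zer J J \<cdot> p" by (metis Cmp_Idn(1) Hom_typing(1,3)[OF p])
  also have "\<dots> = zer H H"
    using coalg_hom_zer[OF HomD(2)[OF p], of J] alg_hom_zer[OF HomD(1)[OF i], of H] by simp
  finally show ?thesis using complementary_nilpotent[OF f, of "Suc n"] ip by simp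
qed

end

section \<open>Matrices of endomorphisms\<close>

locale hopf_pair = abelian_braided_category C for C :: "('o, 'm, 'z) braided_cat_scheme" (structure) +
  fixes H K :: "('o, 'm) hopf"
  assumes hopf [simp]: "is_hopf_algebra C H" "is_hopf_algebra C K"
    and unbraided_HK: "unbraided C (Car H) (Car K)"
begin

abbreviation \<open>HK \<equiv> H \<boxtimes> K\<close>
abbreviation "\<iota>\<^sub>1 \<equiv> in1 C H K"
abbreviation "\<iota>\<^sub>2 \<equiv> in2 C H K"
abbreviation "\<pi>\<^sub>1 \<equiv> pr1 C H K"
abbreviation "\<pi>\<^sub>2 \<equiv> pr2 C H K"

lemma dual_pair: "hopf_pair (dual_cat C) (dual_hopf H) (dual_hopf K)"
  using dual_abelian unbraided_HK by (simp add: hopf_pair_def hopf_pair_axioms_def)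

lemma in_pr_Hom:
  "\<iota>\<^sub>1 \<in> Hom H HK" "\<iota>\<^sub>2 \<in> Hom K HK" "\<pi>\<^sub>1 \<in> Hom HK H" "\<pi>\<^sub>2 \<in> Hom HK K"
  by (simp_all add: in_pr_hopf_Hom)

lemma pr_bicocommuting: "bicocommuting C HK \<pi>\<^sub>1 \<pi>\<^sub>2"
  by (rule bicocommutingI_unbraided) (simp_all add: cocommuting_def pr_Com unbraided_HK)

lemma in_bicommuting: "bicommuting C HK \<iota>\<^sub>1 \<iota>\<^sub>2"
proof -
  interpret d: hopf_pair "dual_cat C" "dual_hopf H" "dual_hopf K" by (rule dual_pair)
  show ?thesis
    using d.pr_bicocommuting d.bicommuting_dual[of "dual_hopf HK" \<iota>\<^sub>1 \<iota>\<^sub>2] by simp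
qed

text \<open>Insert \<open>1\<close>, the sum of the two idempotents of \<open>HK\<close>, between
  \<open>x\<close> and \<open>y\<close> and distribute. This single identity is the source of the
  matrix product and of the rows of a matrix.\<close>

lemma hom_product:
  assumes x: "alg_hom C HK X x" and y: "coalg_hom C Y HK y" and [simp]: "is_algebra C X"
      "is_coalgebra C Y"
  shows "x \<cdot> y = (x \<cdot> \<iota>\<^sub>1 \<cdot> \<pi>\<^sub>1 \<cdot> y) \<star>\<^bsub>Y,X\<^esub> (x \<cdot> \<iota>\<^sub>2 \<cdot> \<pi>\<^sub>2 \<cdot> y)"
proof -
  note [simp] = hom_typing(1-3)[OF x] hom_typing(4-6)[OF y]
  have "x \<cdot> y = x \<cdot> ((\<iota>\<^sub>1 \<cdot> \<pi>\<^sub>1) \<star>\<^bsub>HK,HK\<^esub> (\<iota>\<^sub>2 \<cdot> \<pi>\<^sub>2)) \<cdot> y" by (simp add: in_pr_conv)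
  also have "((\<iota>\<^sub>1 \<cdot> \<pi>\<^sub>1) \<star>\<^bsub>HK,HK\<^esub> (\<iota>\<^sub>2 \<cdot> \<pi>\<^sub>2)) \<cdot> y = (\<iota>\<^sub>1 \<cdot> \<pi>\<^sub>1 \<cdot> y) \<star>\<^bsub>Y,HK\<^esub> (\<iota>\<^sub>2 \<cdot> \<pi>\<^sub>2 \<cdot> y)"
    by (subst coalg_hom_conv[OF y]) simp_all
  also have "x \<cdot> \<dots> = (x \<cdot> \<iota>\<^sub>1 \<cdot> \<pi>\<^sub>1 \<cdot> y) \<star>\<^bsub>Y,X\<^esub> (x \<cdot> \<iota>\<^sub>2 \<cdot> \<pi>\<^sub>2 \<cdot> y)"
    by (subst alg_hom_conv[OF x]) simp_all
  finally show ?thesis .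
qed

text \<open>
  The rows show that a matrix is a morphism of coalgebras, the columns that it is a morphism of
  algebras. In this way the bialgebra axiom for \<open>H \<otimes> K\<close> is never needed.
\<close>

lemma matrix_morphism_rows:
  assumes [simp]: "a \<in> Arr C" "Dom C a = Car H" "Cod C a = Car H" "b \<in> Arr C" "Dom C b = Car K"
      "Cod C b = Car H"
    "c \<in> Arr C" "Dom C c = Car H" "Cod C c = Car K" "d \<in> Arr C" "Dom C d = Car K" "Cod C d = Car K"
  shows "matrix_morphism C H K (a, b, c, d) = ((\<nabla>\<^bsub>H\<^esub> \<cdot> (a \<otimes> b)) \<otimes> (\<nabla>\<^bsub>K\<^esub> \<cdot> (c \<otimes> d))) \<cdot> Com HK"
proof -
  have "((\<nabla>\<^bsub>H\<^esub> \<cdot> (a \<otimes> b)) \<otimes> (\<nabla>\<^bsub>K\<^esub> \<cdot> (c \<otimes> d))) = (\<nabla>\<^bsub>H\<^esub> \<otimes> \<nabla>\<^bsub>K\<^esub>) \<cdot> ((a \<otimes> b) \<otimes> (c \<otimes> d))"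
    by (simp del: Ten_assoc)
  then show ?thesis by (simp add: matrix_morphism_def tensor_hopf_def)
qed

lemma matrix_morphism_columns:
  assumes [simp]: "a \<in> Arr C" "Dom C a = Car H" "Cod C a = Car H" "b \<in> Arr C" "Dom C b = Car K"
      "Cod C b = Car H"
    "c \<in> Arr C" "Dom C c = Car H" "Cod C c = Car K" "d \<in> Arr C" "Dom C d = Car K" "Cod C d = Car K"
  shows "matrix_morphism C H K (a, b, c, d) = Mul HK \<cdot> (((a \<otimes> c) \<cdot> \<Delta>\<^bsub>H\<^esub>) \<otimes> ((b \<otimes> d) \<cdot> \<Delta>\<^bsub>K\<^esub>))"
proof -
  have M: "Mul HK = (\<nabla>\<^bsub>H\<^esub> \<otimes> \<nabla>\<^bsub>K\<^esub>) \<cdot> mid (Car H) (Car K) (Car H) (Car K)" by (simp add: tensor_hopf_def)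
  have "((a \<otimes> c) \<cdot> \<Delta>\<^bsub>H\<^esub>) \<otimes> ((b \<otimes> d) \<cdot> \<Delta>\<^bsub>K\<^esub>) = ((a \<otimes> c) \<otimes> (b \<otimes> d)) \<cdot> (\<Delta>\<^bsub>H\<^esub> \<otimes> \<Delta>\<^bsub>K\<^esub>)"
    by (simp del: Ten_assoc)
  then have "Mul HK \<cdot> (((a \<otimes> c) \<cdot> \<Delta>\<^bsub>H\<^esub>) \<otimes> ((b \<otimes> d) \<cdot> \<Delta>\<^bsub>K\<^esub>))
      = (\<nabla>\<^bsub>H\<^esub> \<otimes> \<nabla>\<^bsub>K\<^esub>) \<cdot> mid (Car H) (Car K) (Car H) (Car K) \<cdot> (a \<otimes> c \<otimes> b \<otimes> d) \<cdot> (\<Delta>\<^bsub>H\<^esub> \<otimes> \<Delta>\<^bsub>K\<^esub>)"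
    unfolding M by simp
  also have "mid (Car H) (Car K) (Car H) (Car K) \<cdot> (a \<otimes> c \<otimes> b \<otimes> d) \<cdot> (\<Delta>\<^bsub>H\<^esub> \<otimes> \<Delta>\<^bsub>K\<^esub>)
      = ((a \<otimes> b \<otimes> c \<otimes> d) \<cdot> mid (Car H) (Car H) (Car K) (Car K)) \<cdot> (\<Delta>\<^bsub>H\<^esub> \<otimes> \<Delta>\<^bsub>K\<^esub>)"
    by (rule Cmp_reassoc) (subst mid_natural, simp_all)
  finally show ?thesis by (simp add: matrix_morphism_def)
qed

text \<open>The conditions under which a matrix denotes an endomorphism, in symmetric form. For
  \<open>H\<close> and \<open>K\<close> unbraided this agrees with the relations in one
  order.\<close>

definition matrix_compatible where
  "matrix_compatible a b c d \<longleftrightarrow>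
     a \<in> Hom H H \<and> b \<in> Hom K H \<and> c \<in> Hom H K \<and> d \<in> Hom K K \<and>
     bicommuting C H a b \<and> bicommuting C K c d \<and> bicocommuting C H a c \<and> bicocommuting C K b d"

text \<open>The two rows are coalgebra morphisms to \<open>H\<close> and \<open>K\<close>, and it
  remains to see that they cocommute. This is checked on the four pairs of summands:
  \<open>a\<close>, \<open>c\<close> and \<open>b\<close>, \<open>d\<close> by assumption, the mixed
  pairs because \<open>\<pi>\<close> and its companion projection cocommute.\<close>

lemma matrix_morphism_coalg_hom:
  assumes "matrix_compatible a b c d"
  shows "coalg_hom C HK HK (matrix_morphism C H K (a, b, c, d))"
proof -
  have a: "a \<in> Hom H H" and b: "b \<in> Hom K H" and c: "c \<in> Hom H K" and d: "d \<in> Hom K K"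
    and ac: "bicocommuting C H a c" and bd: "bicocommuting C K b d"
    using assms by (auto simp: matrix_compatible_def)
  note [simp] = Hom_typing[OF a] Hom_typing[OF b] Hom_typing[OF c] Hom_typing[OF d]
  let ?u = "\<nabla>\<^bsub>H\<^esub> \<cdot> (a \<otimes> b)" and ?v = "\<nabla>\<^bsub>K\<^esub> \<cdot> (c \<otimes> d)"
  have u: "?u = (a \<cdot> \<pi>\<^sub>1) \<star>\<^bsub>HK,H\<^esub> (b \<cdot> \<pi>\<^sub>2)" and v: "?v = (c \<cdot> \<pi>\<^sub>1) \<star>\<^bsub>HK,K\<^esub> (d \<cdot> \<pi>\<^sub>2)"
    by (rule conv_pr(1)[symmetric]; simp)+
  have 1: "bicocommuting C HK (a \<cdot> \<pi>\<^sub>1) (c \<cdot> \<pi>\<^sub>1)"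
    by (rule bicocommuting_coalg_hom[OF ac]) (simp_all add: pr_coalg_hom)
  have 2: "bicocommuting C HK (b \<cdot> \<pi>\<^sub>2) (d \<cdot> \<pi>\<^sub>2)"
    by (rule bicocommuting_coalg_hom[OF bd]) (simp_all add: pr_coalg_hom)
  have 3: "bicocommuting C HK (a \<cdot> \<pi>\<^sub>1) (d \<cdot> \<pi>\<^sub>2)" "bicocommuting C HK (b \<cdot> \<pi>\<^sub>2) (c \<cdot> \<pi>\<^sub>1)"
    by (rule bicocommuting_postcomp[OF pr_bicocommuting]
      bicocommuting_postcomp[OF bicocommuting_sym[OF pr_bicocommuting]]; simp)+
  have "bicocommuting C HK (c \<cdot> \<pi>\<^sub>1) ?u" "bicocommuting C HK (d \<cdot> \<pi>\<^sub>2) ?u" unfolding u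
    by (rule bicocommuting_sym, rule bicocommuting_conv[OF 1 3(2)]; simp)
      (rule bicocommuting_sym, rule bicocommuting_conv[OF 3(1) 2]; simp)
  then have "bicocommuting C HK ?v ?u" unfolding v
    by (rule bicocommuting_conv) simp_all
  then have "cocommuting C HK ?u ?v" by (simp add: bicocommuting_def)
  then have "coalg_hom C HK HK ((?u \<otimes> ?v) \<cdot> Com HK)"
    by (intro coalg_hom_Com coalg_hom_Mul HomD[OF a] HomD[OF b] HomD[OF c] HomD[OF d]) simp_all
  then show ?thesis by (simp add: matrix_morphism_rows)
qed

lemma matrix_morphism_Hom:
  assumes "matrix_compatible a b c d"
  shows "matrix_morphism C H K (a, b, c, d) \<in> Hom HK HK"
proof -
  interpret d: hopf_pair "dual_cat C" "dual_hopf H" "dual_hopf K" by (rule dual_pair)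
  have h: "a \<in> Hom H H" "b \<in> Hom K H" "c \<in> Hom H K" "d \<in> Hom K K"
    using assms by (auto simp: matrix_compatible_def)
  note [simp] = Hom_typing[OF h(1)] Hom_typing[OF h(2)] Hom_typing[OF h(3)] Hom_typing[OF h(4)]
  \<comment> \<open>Duality transposes the matrix, exchanging \<open>b\<close> and \<open>c\<close>
    as well as rows and columns.\<close>
  have "d.matrix_compatible a c b d"
    using assms bicommuting_dual d.bicommuting_dual[of "dual_hopf H" a b]
      d.bicommuting_dual[of "dual_hopf K" c d]
    by (simp add: d.matrix_compatible_def matrix_compatible_def)
  from d.matrix_morphism_coalg_hom[OF this]
  have "alg_hom C HK HK (matrix_morphism C H K (a, b, c, d))"
    by (simp add: d.matrix_morphism_rows matrix_morphism_columns)
  then show ?thesis using matrix_morphism_coalg_hom[OF assms] by (simp add: hopf_Hom_iff)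
qed

lemma matrix_morphism_entries:
  assumes "matrix_compatible a b c d"
  shows "\<pi>\<^sub>1 \<cdot> matrix_morphism C H K (a, b, c, d) \<cdot> \<iota>\<^sub>1 = a"
      "\<pi>\<^sub>1 \<cdot> matrix_morphism C H K (a, b, c, d) \<cdot> \<iota>\<^sub>2 = b"
    "\<pi>\<^sub>2 \<cdot> matrix_morphism C H K (a, b, c, d) \<cdot> \<iota>\<^sub>1 = c" "\<pi>\<^sub>2 \<cdot> matrix_morphism C H K (a, b, c, d) \<cdot> \<iota>\<^sub>2 = d"
proof -
  have a: "a \<in> Hom H H" and b: "b \<in> Hom K H" and c: "c \<in> Hom H K" and d: "d \<in> Hom K K"
    using assms by (auto simp: matrix_compatible_def)
  note [simp] = Hom_typing[OF a] Hom_typing[OF b] Hom_typing[OF c] Hom_typing[OF d]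
  let ?u = "\<nabla>\<^bsub>H\<^esub> \<cdot> (a \<otimes> b)" and ?v = "\<nabla>\<^bsub>K\<^esub> \<cdot> (c \<otimes> d)" and ?m = "matrix_morphism C H K (a, b, c, d)"
  note Hom = matrix_morphism_Hom[OF assms]
  note [simp] = Hom_typing[OF Hom]
  have uv: "coalg_hom C HK H ?u" "coalg_hom C HK K ?v"
    by (intro coalg_hom_Mul HomD[OF a] HomD[OF b] HomD[OF c] HomD[OF d]; simp)+
  have e: "\<epsilon>\<^bsub>H\<^esub> \<cdot> ?u = Cou HK" "\<epsilon>\<^bsub>K\<^esub> \<cdot> ?v = Cou HK" using uv by (simp_all only: coalg_hom_def)
  let ?t = "idm HK"
  have T: "(Cou HK \<otimes> ?t) \<cdot> Com HK = ?t" "(?t \<otimes> Cou HK) \<cdot> Com HK = ?t"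
  proof -
    have "is_coalgebra C HK" by simp
    then show "(Cou HK \<otimes> ?t) \<cdot> Com HK = ?t" "(?t \<otimes> Cou HK) \<cdot> Com HK = ?t"
      unfolding is_coalgebra_def by blast+
  qed
  have "\<pi>\<^sub>1 \<cdot> ?m = (?u \<otimes> (\<epsilon>\<^bsub>K\<^esub> \<cdot> ?v)) \<cdot> Com HK" by (simp add: matrix_morphism_rows pr1_def)
  also have "\<dots> = ?u \<cdot> (?t \<otimes> Cou HK) \<cdot> Com HK"
  proof -
    have "?u \<otimes> Cou HK = ?u \<cdot> (?t \<otimes> Cou HK)"
      using Ten_Cmp'[of ?t ?u "Cou HK" "Idn C (Unit C)"] by simp
    then show ?thesis unfolding e by simp
  qed
  also have "\<dots> = ?u" by (simp only: T) simp
  finally have m1: "\<pi>\<^sub>1 \<cdot> ?m = ?u" .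
  have "\<pi>\<^sub>2 \<cdot> ?m = ((\<epsilon>\<^bsub>H\<^esub> \<cdot> ?u) \<otimes> ?v) \<cdot> Com HK" by (simp add: matrix_morphism_rows pr2_def)
  also have "\<dots> = ?v \<cdot> (Cou HK \<otimes> ?t) \<cdot> Com HK"
  proof -
    have "Cou HK \<otimes> ?v = ?v \<cdot> (Cou HK \<otimes> ?t)"
      using Ten_Cmp'[of "Cou HK" "Idn C (Unit C)" ?t ?v] by simp
    then show ?thesis unfolding e by simp
  qed
  also have "\<dots> = ?v" by (simp only: T) simp
  finally have m2: "\<pi>\<^sub>2 \<cdot> ?m = ?v" .
  have u: "?u = (a \<cdot> \<pi>\<^sub>1) \<star>\<^bsub>HK,H\<^esub> (b \<cdot> \<pi>\<^sub>2)" and v: "?v = (c \<cdot> \<pi>\<^sub>1) \<star>\<^bsub>HK,K\<^esub> (d \<cdot> \<pi>\<^sub>2)"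
    by (rule conv_pr(1)[symmetric]; simp)+
  note z = alg_hom_zer[OF HomD(1)[OF a]] alg_hom_zer[OF HomD(1)[OF b]]
    alg_hom_zer[OF HomD(1)[OF c]] alg_hom_zer[OF HomD(1)[OF d]]
  have "?u \<cdot> \<iota>\<^sub>1 = a" "?u \<cdot> \<iota>\<^sub>2 = b" unfolding u
    by (subst coalg_hom_conv[OF in_coalg_hom(1)] coalg_hom_conv[OF in_coalg_hom(2)]; simp add: pr_in z)+
  moreover have "?v \<cdot> \<iota>\<^sub>1 = c" "?v \<cdot> \<iota>\<^sub>2 = d" unfolding v
    by (subst coalg_hom_conv[OF in_coalg_hom(1)] coalg_hom_conv[OF in_coalg_hom(2)]; simp add: pr_in z)+
  moreover have "\<pi>\<^sub>1 \<cdot> ?m \<cdot> x = ?u \<cdot> x" "\<pi>\<^sub>2 \<cdot> ?m \<cdot> x = ?v \<cdot> x" if "x \<in> Arr C" "Cod C x = Car HK" for x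
    using Cmp_reassoc[OF m1, of x] Cmp_reassoc[OF m2, of x] that by simp_all
  ultimately show "\<pi>\<^sub>1 \<cdot> ?m \<cdot> \<iota>\<^sub>1 = a" "\<pi>\<^sub>1 \<cdot> ?m \<cdot> \<iota>\<^sub>2 = b" "\<pi>\<^sub>2 \<cdot> ?m \<cdot> \<iota>\<^sub>1 = c" "\<pi>\<^sub>2 \<cdot> ?m \<cdot> \<iota>\<^sub>2 = d"
    by simp_all
qed

text \<open>The relations among the entries are those between the two injections and between the two
  projections, transported along \<open>f\<close>. The matrix is recovered by splitting each row
  with \<open>hom_product\<close> and reassembling the rows by \<open>pr_Com\<close>.\<close>

lemma matrix_decomposition:
  assumes f: "f \<in> Hom HK HK"
  defines "a \<equiv> \<pi>\<^sub>1 \<cdot> f \<cdot> \<iota>\<^sub>1" and "b \<equiv> \<pi>\<^sub>1 \<cdot> f \<cdot> \<iota>\<^sub>2" and "c \<equiv> \<pi>\<^sub>2 \<cdot> f \<cdot> \<iota>\<^sub>1" and "d \<equiv> \<pi>\<^sub>2 \<cdot> f \<cdot> \<iota>\<^sub>2"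
  shows "matrix_compatible a b c d" "f = matrix_morphism C H K (a, b, c, d)"
proof -
  note [simp] = Hom_typing[OF f]
  have Hom: "\<pi>\<^sub>1 \<cdot> f \<in> Hom HK H" "\<pi>\<^sub>2 \<cdot> f \<in> Hom HK K" "f \<cdot> \<iota>\<^sub>1 \<in> Hom H HK" "f \<cdot> \<iota>\<^sub>2 \<in> Hom K HK"
    by (rule hopf_Hom_Cmp[OF f in_pr_Hom(3)] hopf_Hom_Cmp[OF f in_pr_Hom(4)]
      hopf_Hom_Cmp[OF in_pr_Hom(1) f] hopf_Hom_Cmp[OF in_pr_Hom(2) f]; simp)+
  have h: "a \<in> Hom H H" "b \<in> Hom K H" "c \<in> Hom H K" "d \<in> Hom K K"
    unfolding a_def b_def c_def d_def
    by (rule hopf_Hom_Cmp[OF Hom(3) in_pr_Hom(3)] hopf_Hom_Cmp[OF Hom(4) in_pr_Hom(3)]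
      hopf_Hom_Cmp[OF Hom(3) in_pr_Hom(4)] hopf_Hom_Cmp[OF Hom(4) in_pr_Hom(4)]; simp)+
  note [simp] = Hom_typing[OF h(1)] Hom_typing[OF h(2)] Hom_typing[OF h(3)] Hom_typing[OF h(4)]
  have "bicommuting C H ((\<pi>\<^sub>1 \<cdot> f) \<cdot> \<iota>\<^sub>1) ((\<pi>\<^sub>1 \<cdot> f) \<cdot> \<iota>\<^sub>2)"
      "bicommuting C K ((\<pi>\<^sub>2 \<cdot> f) \<cdot> \<iota>\<^sub>1) ((\<pi>\<^sub>2 \<cdot> f) \<cdot> \<iota>\<^sub>2)"
    by (rule bicommuting_alg_hom[OF in_bicommuting HomD(1)[OF Hom(1)]]
      bicommuting_alg_hom[OF in_bicommuting HomD(1)[OF Hom(2)]]; simp)+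
  moreover have "bicocommuting C H (\<pi>\<^sub>1 \<cdot> f \<cdot> \<iota>\<^sub>1) (\<pi>\<^sub>2 \<cdot> f \<cdot> \<iota>\<^sub>1)"
      "bicocommuting C K (\<pi>\<^sub>1 \<cdot> f \<cdot> \<iota>\<^sub>2) (\<pi>\<^sub>2 \<cdot> f \<cdot> \<iota>\<^sub>2)"
    by (rule bicocommuting_coalg_hom[OF pr_bicocommuting HomD(2)[OF Hom(3)]]
      bicocommuting_coalg_hom[OF pr_bicocommuting HomD(2)[OF Hom(4)]]; simp)+
  ultimately show "matrix_compatible a b c d"
    using h by (simp add: matrix_compatible_def a_def b_def c_def d_def)
  have 1: "\<pi>\<^sub>1 \<cdot> f = \<nabla>\<^bsub>H\<^esub> \<cdot> (a \<otimes> b)"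
    using hom_product[OF HomD(1)[OF Hom(1)] Idn_hom(2)] conv_pr(1)[of H K H a b]
      by (simp add: a_def b_def)
  have 2: "\<pi>\<^sub>2 \<cdot> f = \<nabla>\<^bsub>K\<^esub> \<cdot> (c \<otimes> d)"
    using hom_product[OF HomD(1)[OF Hom(2)] Idn_hom(2)] conv_pr(1)[of H K K c d]
      by (simp add: c_def d_def)
  have "f = ((\<pi>\<^sub>1 \<otimes> \<pi>\<^sub>2) \<cdot> Com HK) \<cdot> f" by (simp add: pr_Com)
  also have "\<dots> = (\<pi>\<^sub>1 \<otimes> \<pi>\<^sub>2) \<cdot> Com HK \<cdot> f" by simp
  also have "Com HK \<cdot> f = (f \<otimes> f) \<cdot> Com HK" using HomD(2)[OF f] by (simp add: coalg_hom_def)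
  also have "(\<pi>\<^sub>1 \<otimes> \<pi>\<^sub>2) \<cdot> (f \<otimes> f) \<cdot> Com HK = ((\<pi>\<^sub>1 \<cdot> f) \<otimes> (\<pi>\<^sub>2 \<cdot> f)) \<cdot> Com HK" by simp
  finally show "f = matrix_morphism C H K (a, b, c, d)" unfolding 1 2 by (simp add: matrix_morphism_rows)
qed

lemma matrix_product:
  assumes f: "f \<in> Hom HK HK" and g: "g \<in> Hom HK HK"
  shows "\<pi>\<^sub>1 \<cdot> (f \<cdot> g) \<cdot> \<iota>\<^sub>1 = ((\<pi>\<^sub>1 \<cdot> f \<cdot> \<iota>\<^sub>1) \<cdot> (\<pi>\<^sub>1 \<cdot> g \<cdot> \<iota>\<^sub>1)) \<star>\<^bsub>H,H\<^esub> ((\<pi>\<^sub>1 \<cdot> f \<cdot> \<iota>\<^sub>2) \<cdot> (\<pi>\<^sub>2 \<cdot> g \<cdot> \<iota>\<^sub>1))"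
    and "\<pi>\<^sub>1 \<cdot> (f \<cdot> g) \<cdot> \<iota>\<^sub>2 = ((\<pi>\<^sub>1 \<cdot> f \<cdot> \<iota>\<^sub>1) \<cdot> (\<pi>\<^sub>1 \<cdot> g \<cdot> \<iota>\<^sub>2)) \<star>\<^bsub>K,H\<^esub> ((\<pi>\<^sub>1 \<cdot> f \<cdot> \<iota>\<^sub>2) \<cdot> (\<pi>\<^sub>2 \<cdot> g \<cdot> \<iota>\<^sub>2))"
    and "\<pi>\<^sub>2 \<cdot> (f \<cdot> g) \<cdot> \<iota>\<^sub>1 = ((\<pi>\<^sub>2 \<cdot> f \<cdot> \<iota>\<^sub>1) \<cdot> (\<pi>\<^sub>1 \<cdot> g \<cdot> \<iota>\<^sub>1)) \<star>\<^bsub>H,K\<^esub> ((\<pi>\<^sub>2 \<cdot> f \<cdot> \<iota>\<^sub>2) \<cdot> (\<pi>\<^sub>2 \<cdot> g \<cdot> \<iota>\<^sub>1))"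
    and "\<pi>\<^sub>2 \<cdot> (f \<cdot> g) \<cdot> \<iota>\<^sub>2 = ((\<pi>\<^sub>2 \<cdot> f \<cdot> \<iota>\<^sub>1) \<cdot> (\<pi>\<^sub>1 \<cdot> g \<cdot> \<iota>\<^sub>2)) \<star>\<^bsub>K,K\<^esub> ((\<pi>\<^sub>2 \<cdot> f \<cdot> \<iota>\<^sub>2) \<cdot> (\<pi>\<^sub>2 \<cdot> g \<cdot> \<iota>\<^sub>2))"
proof -
  note [simp] = Hom_typing[OF f] Hom_typing[OF g]
  have F: "alg_hom C HK H (\<pi>\<^sub>1 \<cdot> f)" "alg_hom C HK K (\<pi>\<^sub>2 \<cdot> f)" "coalg_hom C H HK (g \<cdot> \<iota>\<^sub>1)"
      "coalg_hom C K HK (g \<cdot> \<iota>\<^sub>2)"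
    by (rule alg_hom_Cmp[OF HomD(1)[OF f] HomD(1)[OF in_pr_Hom(3)]] alg_hom_Cmp[OF HomD(1)[OF f]
      HomD(1)[OF in_pr_Hom(4)]]
        coalg_hom_Cmp[OF HomD(2)[OF in_pr_Hom(1)] HomD(2)[OF g]]
            coalg_hom_Cmp[OF HomD(2)[OF in_pr_Hom(2)] HomD(2)[OF g]]; simp)+
  show "\<pi>\<^sub>1 \<cdot> (f \<cdot> g) \<cdot> \<iota>\<^sub>1 = ((\<pi>\<^sub>1 \<cdot> f \<cdot> \<iota>\<^sub>1) \<cdot> (\<pi>\<^sub>1 \<cdot> g \<cdot> \<iota>\<^sub>1)) \<star>\<^bsub>H,H\<^esub> ((\<pi>\<^sub>1 \<cdot> f \<cdot> \<iota>\<^sub>2) \<cdot> (\<pi>\<^sub>2 \<cdot> g \<cdot> \<iota>\<^sub>1))"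
    using hom_product[OF F(1,3)] by simp
  show "\<pi>\<^sub>1 \<cdot> (f \<cdot> g) \<cdot> \<iota>\<^sub>2 = ((\<pi>\<^sub>1 \<cdot> f \<cdot> \<iota>\<^sub>1) \<cdot> (\<pi>\<^sub>1 \<cdot> g \<cdot> \<iota>\<^sub>2)) \<star>\<^bsub>K,H\<^esub> ((\<pi>\<^sub>1 \<cdot> f \<cdot> \<iota>\<^sub>2) \<cdot> (\<pi>\<^sub>2 \<cdot> g \<cdot> \<iota>\<^sub>2))"
    using hom_product[OF F(1,4)] by simp
  show "\<pi>\<^sub>2 \<cdot> (f \<cdot> g) \<cdot> \<iota>\<^sub>1 = ((\<pi>\<^sub>2 \<cdot> f \<cdot> \<iota>\<^sub>1) \<cdot> (\<pi>\<^sub>1 \<cdot> g \<cdot> \<iota>\<^sub>1)) \<star>\<^bsub>H,K\<^esub> ((\<pi>\<^sub>2 \<cdot> f \<cdot> \<iota>\<^sub>2) \<cdot> (\<pi>\<^sub>2 \<cdot> g \<cdot> \<iota>\<^sub>1))"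
    using hom_product[OF F(2,3)] by simp
  show "\<pi>\<^sub>2 \<cdot> (f \<cdot> g) \<cdot> \<iota>\<^sub>2 = ((\<pi>\<^sub>2 \<cdot> f \<cdot> \<iota>\<^sub>1) \<cdot> (\<pi>\<^sub>1 \<cdot> g \<cdot> \<iota>\<^sub>2)) \<star>\<^bsub>K,K\<^esub> ((\<pi>\<^sub>2 \<cdot> f \<cdot> \<iota>\<^sub>2) \<cdot> (\<pi>\<^sub>2 \<cdot> g \<cdot> \<iota>\<^sub>2))"
    using hom_product[OF F(2,4)] by simp
qed

lemma diagonal_matrix:
  assumes f: "f \<in> Hom HK HK" and z: "\<pi>\<^sub>1 \<cdot> f \<cdot> \<iota>\<^sub>2 = zer K H" "\<pi>\<^sub>2 \<cdot> f \<cdot> \<iota>\<^sub>1 = zer H K"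
  shows "f = (\<pi>\<^sub>1 \<cdot> f \<cdot> \<iota>\<^sub>1) \<otimes> (\<pi>\<^sub>2 \<cdot> f \<cdot> \<iota>\<^sub>2)"
proof -
  let ?x = "\<pi>\<^sub>1 \<cdot> f \<cdot> \<iota>\<^sub>1" and ?y = "\<pi>\<^sub>2 \<cdot> f \<cdot> \<iota>\<^sub>2"
  note [simp] = Hom_typing[OF f]
  have "\<nabla>\<^bsub>H\<^esub> \<cdot> (?x \<otimes> zer K H) = ?x \<cdot> \<pi>\<^sub>1" "\<nabla>\<^bsub>K\<^esub> \<cdot> (zer H K \<otimes> ?y) = ?y \<cdot> \<pi>\<^sub>2"
    using conv_pr(1)[of H K H ?x "zer K H"] conv_pr(1)[of H K K "zer H K" ?y]
      coalg_hom_zer[OF pr_coalg_hom(2)[of H K], of H] coalg_hom_zer[OF pr_coalg_hom(1)[of H K], of K]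
    by simp_all
  then have "f = ((?x \<cdot> \<pi>\<^sub>1) \<otimes> (?y \<cdot> \<pi>\<^sub>2)) \<cdot> Com HK"
    using matrix_decomposition(2)[OF f] unfolding z by (simp add: matrix_morphism_rows)
  also have "\<dots> = (?x \<otimes> ?y) \<cdot> (\<pi>\<^sub>1 \<otimes> \<pi>\<^sub>2) \<cdot> Com HK" by simp
  also have "\<dots> = ?x \<otimes> ?y" by (simp only: pr_Com hopf hopf_algebraD bialgebraD) simp
  finally show ?thesis .
qed

end

section \<open>Products of isomorphisms and commutative retracts\<close>

context strict_braided_category
begin

text \<open>The first product provides a left inverse of \<open>g\<close>, the second a right
  inverse.\<close>

lemma isomorphism_of_products:
  assumes "is_isomorphism C (f \<cdot> g)" "is_isomorphism C (g \<cdot> h)" "f \<in> Arr C" "g \<in> Arr C" "h \<in> Arr C"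
    "Dom C f = Cod C g" "Dom C g = Cod C h"
  shows "is_isomorphism C g"
proof -
  obtain u v where u: "mutually_inverse C (f \<cdot> g) u" and v: "mutually_inverse C (g \<cdot> h) v"
    using assms(1,2) by (auto simp: is_isomorphism_def)
  have "g \<cdot> h \<cdot> v = (g \<cdot> h) \<cdot> v"
    by (rule Cmp_assoc'[symmetric]) (use assms v in \<open>simp_all add: mutually_inverse_iff\<close>)
  also have "\<dots> = Idn C (Cod C g)" using assms v by (simp only: mutually_inverse_iff Cmp_typing)
  finally have "mutually_inverse C g (u \<cdot> f)"
    by (intro isomorphismI_left_right[where h = "h \<cdot> v"]) (use assms u v in \<open>simp_all add:
      mutually_inverse_iff\<close>)
  then show ?thesis by (auto simp: is_isomorphism_def)
qed

lemma hopf_AutD: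
  assumes "a \<in> hopf_Aut C A"
  shows "\<exists>a'. a \<in> Hom A A \<and> a' \<in> Hom A A \<and> a' \<in> hopf_Aut C A \<and> a' \<cdot> a = idm A \<and> a \<cdot> a' = idm A"
proof -
  obtain a' where a': "a \<in> Hom A A" "a' \<in> Hom A A" "mutually_inverse C a a'"
    using assms by (auto simp: hopf_Aut_def hopf_Iso_def)
  moreover have "mutually_inverse C a' a" using a'(3) by (auto simp: mutually_inverse_iff)
  ultimately show ?thesis using Hom_typing[OF a'(1)]
    by (intro exI[of _ a']) (auto simp: hopf_Aut_def hopf_Iso_def mutually_inverse_iff)
qed

text \<open>The self-commutation of \<open>i\<close> is commutativity of \<open>J\<close> seen after
  \<open>i\<close>, and \<open>i\<close> can be cancelled because it has a left inverse.\<close>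

lemma commutative_retract:
  assumes i: "alg_hom C J H i" and h: "h \<cdot> i = idm J" "h \<in> Arr C" "Dom C h = Car H" "Cod C h = Car J"
    and c: "commuting C H i i" and [simp]: "is_algebra C J" "is_algebra C H"
  shows "\<nabla>\<^bsub>J\<^esub> \<cdot> \<tau> (Car J) (Car J) = \<nabla>\<^bsub>J\<^esub>"
proof -
  note [simp] = hom_typing(1-3)[OF i] h(2-)
  have I: "i \<cdot> \<nabla>\<^bsub>J\<^esub> = \<nabla>\<^bsub>H\<^esub> \<cdot> (i \<otimes> i)" using i by (simp add: alg_hom_def)
  have "i \<cdot> \<nabla>\<^bsub>J\<^esub> \<cdot> \<tau> (Car J) (Car J) = (\<nabla>\<^bsub>H\<^esub> \<cdot> (i \<otimes> i)) \<cdot> \<tau> (Car J) (Car J)"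
    by (rule Cmp_reassoc[OF I]) simp_all
  also have "\<dots> = \<nabla>\<^bsub>H\<^esub> \<cdot> (i \<otimes> i)" using c[unfolded commuting_def, symmetric] by simp
  also have "\<dots> = i \<cdot> \<nabla>\<^bsub>J\<^esub>" by (simp only: I)
  finally show ?thesis by (rule Cmp_cancel_left[OF h(1)]) simp_all
qed

lemma cocommutative_retract:
  assumes "coalg_hom C H J p" "p \<cdot> h = idm J" "h \<in> Arr C" "Cod C h = Car H" "Dom C h = Car J"
    and "cocommuting C H p p" "is_coalgebra C J" "is_coalgebra C H"
  shows "\<tau> (Car J) (Car J) \<cdot> \<Delta>\<^bsub>J\<^esub> = \<Delta>\<^bsub>J\<^esub>"
proof -
  interpret d: strict_braided_category "dual_cat C" by (rule dual)
  show ?thesis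
    using d.commutative_retract[of "dual_hopf J" "dual_hopf H" p h] assms hom_typing(4-6)[OF assms(1)]
      by simp
qed

end

section \<open>Central off-diagonal entries, obstructions, and automorphisms\<close>

context hopf_pair
begin

lemma swapped_pair: "hopf_pair C K H"
  using unbraided_HK by unfold_locales (simp_all add: unbraided_sym)

text \<open>Both relations in the definition involve the pair \<open>H\<close>, \<open>K\<close>,
  through the domains for \<open>\<curlyvee>\<close> and the codomains for
  \<open>\<curlywedge>\<close>, so unbraidedness makes them symmetric.\<close>

lemma hopf_Hom_c_iff:
  "b \<in> hopf_Hom_c C K H \<longleftrightarrow>
    b \<in> Hom K H \<and> bicommuting C H b (idm H) \<and> bicocommuting C K b (idm K)"
proof (cases "b \<in> Hom K H")
  case True
  note [simp] = Hom_typing[OF True]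
  show ?thesis
    using bicommutingI_unbraided[of H b "idm H"] bicocommutingI_unbraided[of K b "idm K"]
      unbraided_HK unbraided_sym[OF unbraided_HK]
    by (auto simp: hopf_Hom_c_def bicommuting_def bicocommuting_def)
qed (simp add: hopf_Hom_c_def)

text \<open>After composing with an automorphism, commutation with the identity becomes commutation
  with that automorphism; its inverse then restores the identity.\<close>

lemma hopf_Hom_c_conjugate:
  assumes b: "b \<in> hopf_Hom_c C K H" and x: "x \<in> hopf_Aut C H" and y: "y \<in> hopf_Aut C K"
  shows "x \<cdot> b \<cdot> y \<in> hopf_Hom_c C K H"
proof -
  have b': "b \<in> Hom K H" "bicommuting C H b (idm H)" "bicocommuting C K b (idm K)"
    using b by (simp_all add: hopf_Hom_c_iff)
  obtain x' where x': "x \<in> Hom H H" "x' \<in> Hom H H" "x \<cdot> x' = idm H" using hopf_AutD[OF x] by blast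
  obtain y' where y': "y \<in> Hom K K" "y' \<in> Hom K K" "y' \<cdot> y = idm K" using hopf_AutD[OF y] by blast
  note [simp] = Hom_typing[OF b'(1)] Hom_typing[OF x'(1)] Hom_typing[OF x'(2)]
    Hom_typing[OF y'(1)] Hom_typing[OF y'(2)]
  have bY: "b \<cdot> y \<in> Hom K H" by (rule Hom_comp[OF y'(1) b'(1)]) simp_all
  have 1: "x \<cdot> b \<cdot> y \<in> Hom K H" by (rule Hom_comp[OF bY x'(1)]) simp_all
  have "bicommuting C H (x \<cdot> b) (x \<cdot> idm H)"
    by (rule bicommuting_alg_hom[OF b'(2) HomD(1)[OF x'(1)]]) simp_all
  then have "bicommuting C H ((x \<cdot> b) \<cdot> y) ((x \<cdot> idm H) \<cdot> x')"
    by (rule bicommuting_precomp) simp_all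
  then have 2: "bicommuting C H (x \<cdot> b \<cdot> y) (idm H)" by (simp add: x'(3))
  have "bicocommuting C K (b \<cdot> y) (idm K \<cdot> y)"
    by (rule bicocommuting_coalg_hom[OF b'(3) HomD(2)[OF y'(1)]]) simp_all
  then have "bicocommuting C K (x \<cdot> b \<cdot> y) (y' \<cdot> idm K \<cdot> y)"
    by (rule bicocommuting_postcomp) simp_all
  then have 3: "bicocommuting C K (x \<cdot> b \<cdot> y) (idm K)" by (simp add: y'(3))
  show ?thesis using 1 2 3 by (simp add: hopf_Hom_c_iff)
qed

lemma hopf_Hom_c_Ant:
  assumes b: "b \<in> hopf_Hom_c C K H"
  shows "Ant H \<cdot> b \<in> hopf_Hom_c C K H"
proof -
  have b': "b \<in> Hom K H" "bicommuting C H b (idm H)" "bicocommuting C K b (idm K)"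
    using b by (simp_all add: hopf_Hom_c_iff)
  note [simp] = Hom_typing[OF b'(1)]
  have "bicommuting C H (b \<cdot> idm K) (idm H \<cdot> b)" by (rule bicommuting_precomp[OF b'(2)]) simp_all
  moreover have "bicocommuting C K (idm H \<cdot> b) (b \<cdot> idm K)"
    by (rule bicocommuting_postcomp[OF b'(3)]) simp_all
  ultimately have 1: "Ant H \<cdot> b \<in> Hom K H" using b'(1) by (intro hopf_Hom_Ant) simp_all
  have "bicommuting C H (b \<cdot> Ant K) (idm H \<cdot> idm H)" by (rule bicommuting_precomp[OF b'(2)]) simp_all
  then have 2: "bicommuting C H (Ant H \<cdot> b) (idm H)" using hopf_Hom_antipode[OF b'(1)] by simp
  have "bicocommuting C K (Ant H \<cdot> b) (idm K \<cdot> idm K)"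
    by (rule bicocommuting_postcomp[OF b'(3)]) simp_all
  then show ?thesis using 1 2 by (simp add: hopf_Hom_c_iff)
qed

text \<open>A morphism that commutes or cocommutes with the identity does so with every
  endomorphism, in particular with the diagonal entries.\<close>

lemma matrix_set_compatible:
  assumes "a \<in> hopf_Aut C H" "b \<in> hopf_Hom_c C K H" "c \<in> hopf_Hom_c C H K" "d \<in> hopf_Aut C K"
  shows "matrix_compatible a b c d"
proof -
  interpret s: hopf_pair C K H by (rule swapped_pair)
  have b: "b \<in> Hom K H" "bicommuting C H b (idm H)" "bicocommuting C K b (idm K)"
    using assms(2) by (simp_all add: hopf_Hom_c_iff)
  have c: "c \<in> Hom H K" "bicommuting C K c (idm K)" "bicocommuting C H c (idm H)"
    using assms(3) by (simp_all add: s.hopf_Hom_c_iff)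
  have ad: "a \<in> Hom H H" "d \<in> Hom K K" using assms by (auto simp: hopf_Aut_def hopf_Iso_def)
  note [simp] = Hom_typing[OF b(1)] Hom_typing[OF c(1)] Hom_typing[OF ad(1)] Hom_typing[OF ad(2)]
  have "bicommuting C H (b \<cdot> idm K) (idm H \<cdot> a)" by (rule bicommuting_precomp[OF b(2)]) simp_all
  moreover have "bicommuting C K (c \<cdot> idm H) (idm K \<cdot> d)" by (rule bicommuting_precomp[OF c(2)]) simp_all
  moreover have "bicocommuting C K (idm H \<cdot> b) (d \<cdot> idm K)"
    by (rule bicocommuting_postcomp[OF b(3)]) simp_all
  moreover have "bicocommuting C H (idm K \<cdot> c) (a \<cdot> idm H)"
    by (rule bicocommuting_postcomp[OF c(3)]) simp_all
  ultimately show ?thesis using b(1) c(1) ad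
    by (simp add: matrix_compatible_def bicommuting_sym bicocommuting_sym)
qed

lemma hopf_Hom_c_product:
  assumes b: "b \<in> hopf_Hom_c C K H" and c: "c \<in> hopf_Hom_c C H K"
  shows "b \<cdot> c \<in> Hom H H" "bicommuting C H (b \<cdot> c) (idm H)" "bicocommuting C H (b \<cdot> c) (idm H)"
proof -
  interpret s: hopf_pair C K H by (rule swapped_pair)
  have b: "b \<in> Hom K H" "bicommuting C H b (idm H)"
    using assms by (simp_all add: hopf_Hom_c_iff)
  have c: "c \<in> Hom H K" "bicocommuting C H c (idm H)"
    using assms by (simp_all add: s.hopf_Hom_c_iff)
  note [simp] = Hom_typing[OF b(1)] Hom_typing[OF c(1)]
  show "b \<cdot> c \<in> Hom H H" by (rule Hom_comp[OF c(1) b(1)]) simp_all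
  have "bicommuting C H (b \<cdot> c) (idm H \<cdot> idm H)" by (rule bicommuting_precomp[OF b(2)]) simp_all
  then show "bicommuting C H (b \<cdot> c) (idm H)" by simp
  have "bicocommuting C H (b \<cdot> c) (idm H \<cdot> idm H)" by (rule bicocommuting_postcomp[OF c(2)]) simp_all
  then show "bicocommuting C H (b \<cdot> c) (idm H)" by simp
qed

text \<open>This treats \<open>1 - b c\<close>. The factor \<open>J\<close> is abelian because its
  inclusion and its projection both factor through the central and cocentral
  \<open>b c\<close>.\<close>

lemma central_product_isomorphism:
  assumes b: "b \<in> hopf_Hom_c C K H" and c: "c \<in> hopf_Hom_c C H K" and dcc: "both_chain_conditions C H"
    and triv: "\<And>A. common_tensor_factor C A H K \<Longrightarrow> abelian_hopf C A \<Longrightarrow> trivial_hopf C A"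
  shows "is_isomorphism C (idm H \<star>\<^bsub>H,H\<^esub> (Ant H \<cdot> b \<cdot> c))"
proof -
  interpret s: hopf_pair C K H by (rule swapped_pair)
  let ?I = "idm H" and ?x = "b \<cdot> c"
  have bc: "b \<in> Hom K H" "c \<in> Hom H K"
    using b c by (simp_all add: hopf_Hom_c_iff s.hopf_Hom_c_iff)
  note x = hopf_Hom_c_product[OF b c] and y = s.hopf_Hom_c_product[OF c b]
  note [simp] = Hom_typing[OF x(1)]
  show ?thesis
  proof (rule complementary_isomorphism[OF bc complementary_central complementary_central dcc])
    fix J i p n
    assume J: "common_tensor_factor C J H K" and [simp]: "is_hopf_algebra C J" and i: "i \<in> Hom J H"
      and p: "p \<in> Hom H J" and ip: "cpow C (Car H) ?x (Suc n) = i \<cdot> p"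
          and iso: "is_isomorphism C (p \<cdot> i)"
    note [simp] = Hom_typing[OF i] Hom_typing[OF p]
    obtain v where "mutually_inverse C (p \<cdot> i) v" using iso by (auto simp: is_isomorphism_def)
    then have [simp]: "v \<in> Arr C" "Dom C v = Car J" "Cod C v = Car J"
      and "(p \<cdot> i) \<cdot> v = idm J" and vp: "v \<cdot> p \<cdot> i = idm J"
      by (simp_all add: mutually_inverse_iff)
    then have pv: "p \<cdot> i \<cdot> v = idm J" by simp
    \<comment> \<open>As a positive power of \<open>?x\<close> equals \<open>i p\<close> and
      \<open>v\<close> inverts \<open>p i\<close>, the inclusion is
      \<open>i = ?x (?x\<^sup>n i v)\<close>. So it inherits the centrality of \<open>?x\<close> and
      commutes with itself; dually for \<open>p\<close>, with \<open>?x\<close> split off on the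
      right.\<close>
    have "bicommuting C H (?x \<cdot> (cpow C (Car H) ?x n \<cdot> i \<cdot> v)) (?I \<cdot> i)"
      by (rule bicommuting_precomp[OF x(2)]) simp_all
    moreover have "?x \<cdot> (cpow C (Car H) ?x n \<cdot> i \<cdot> v) = (i \<cdot> p) \<cdot> i \<cdot> v" unfolding ip[symmetric] by simp
    moreover have "(i \<cdot> p) \<cdot> i \<cdot> v = i" by (simp add: pv)
    ultimately have "bicommuting C H i i" by simp
    then have 1: "\<nabla>\<^bsub>J\<^esub> \<cdot> \<tau> (Car J) (Car J) = \<nabla>\<^bsub>J\<^esub>"
      by (intro commutative_retract[OF HomD(1)[OF i], of "v \<cdot> p"]) (simp_all add: vp bicommuting_def)
    have "bicocommuting C H ((v \<cdot> p \<cdot> cpow C (Car H) ?x n) \<cdot> ?x) (p \<cdot> ?I)"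
      by (rule bicocommuting_postcomp[OF x(3)]) simp_all
    moreover have "(v \<cdot> p \<cdot> cpow C (Car H) ?x n) \<cdot> ?x = v \<cdot> p \<cdot> i \<cdot> p"
      unfolding ip[symmetric] using cpow_Suc_right[of ?x "Car H" n] by simp
    moreover have "v \<cdot> p \<cdot> i \<cdot> p = p"
      using Cmp_reassoc[of v "p \<cdot> i" "idm J" p] vp by simp
    ultimately have "bicocommuting C H p p" by simp
    then have "\<tau> (Car J) (Car J) \<cdot> \<Delta>\<^bsub>J\<^esub> = \<Delta>\<^bsub>J\<^esub>"
      by (intro cocommutative_retract[OF HomD(2)[OF p], of "i \<cdot> v"]) (simp_all add: pv bicocommuting_def)
    with 1 show "trivial_hopf C J" by (intro triv J) (simp add: abelian_hopf_def)
  qed (use x y in simp_all)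
qed

text \<open>
  The partner \<open>(a', - a' b d', - d' c a', d')\<close>, with \<open>a'\<close>, \<open>d'\<close> the inverses of \<open>a\<close>, \<open>d\<close>, makes the
  off-diagonal entries of the product vanish.
\<close>

lemma matrix_partner:
  assumes a: "a \<in> hopf_Aut C H" and b: "b \<in> hopf_Hom_c C K H" and c: "c \<in> hopf_Hom_c C H K"
      and d: "d \<in> hopf_Aut C K"
    and dcc: "both_chain_conditions C H" "both_chain_conditions C K"
    and triv: "\<And>A. common_tensor_factor C A H K \<Longrightarrow> abelian_hopf C A \<Longrightarrow> trivial_hopf C A"
  shows "\<exists>M \<in> matrix_set C H K. is_isomorphism C (matrix_morphism C H K (a, b, c, d)
      \<cdot> matrix_morphism C H K M)"
proof -
  interpret s: hopf_pair C K H by (rule swapped_pair)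
  obtain a' where a': "a \<in> Hom H H" "a' \<in> Hom H H" "a' \<in> hopf_Aut C H" "a \<cdot> a' = idm H"
    using hopf_AutD[OF a] by blast
  obtain d' where d': "d \<in> Hom K K" "d' \<in> Hom K K" "d' \<in> hopf_Aut C K" "d \<cdot> d' = idm K"
    using hopf_AutD[OF d] by blast
  have bc: "b \<in> Hom K H" "c \<in> Hom H K"
    using b c by (simp_all add: hopf_Hom_c_iff s.hopf_Hom_c_iff)
  note [simp] = Hom_typing[OF bc(1)] Hom_typing[OF bc(2)] Hom_typing[OF a'(1)] Hom_typing[OF a'(2)]
    Hom_typing[OF d'(1)] Hom_typing[OF d'(2)]
  let ?b = "a' \<cdot> b \<cdot> d'" and ?c = "d' \<cdot> c \<cdot> a'"
  have b1: "?b \<in> hopf_Hom_c C K H" by (rule hopf_Hom_c_conjugate[OF b a'(3) d'(3)])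
  have c1: "?c \<in> hopf_Hom_c C H K" by (rule s.hopf_Hom_c_conjugate[OF c d'(3) a'(3)])
  have b2: "Ant H \<cdot> ?b \<in> hopf_Hom_c C K H" by (rule hopf_Hom_c_Ant[OF b1])
  have c2: "Ant K \<cdot> ?c \<in> hopf_Hom_c C H K" by (rule s.hopf_Hom_c_Ant[OF c1])
  let ?M = "matrix_morphism C H K (a, b, c, d)" and ?N
      = "matrix_morphism C H K (a', Ant H \<cdot> ?b, Ant K \<cdot> ?c, d')"
  note M = matrix_set_compatible[OF a b c d] and N = matrix_set_compatible[OF a'(3) b2 c2 d'(3)]
  note MH = matrix_morphism_Hom[OF M] and NH = matrix_morphism_Hom[OF N]
  note [simp] = Hom_typing[OF MH] Hom_typing[OF NH]
  have MNH: "?M \<cdot> ?N \<in> Hom HK HK" by (rule hopf_Hom_Cmp[OF NH MH]) simp_all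
  have swap: "a \<cdot> Ant H = Ant H \<cdot> a" "b \<cdot> Ant K = Ant H \<cdot> b" "c \<cdot> Ant H = Ant K \<cdot> c"
      "d \<cdot> Ant K = Ant K \<cdot> d"
    using a' d' bc by (simp_all add: hopf_Hom_antipode)
  have swap': "a \<cdot> Ant H \<cdot> x = Ant H \<cdot> a \<cdot> x" "c \<cdot> Ant H \<cdot> x = Ant K \<cdot> c \<cdot> x" if "x \<in> Arr C"
      "Cod C x = Car H" for x
    using Cmp_reassoc[OF swap(1), of x] Cmp_reassoc[OF swap(3), of x] that by simp_all
  have swap'': "b \<cdot> Ant K \<cdot> x = Ant H \<cdot> b \<cdot> x" "d \<cdot> Ant K \<cdot> x = Ant K \<cdot> d \<cdot> x" if "x \<in> Arr C"
      "Cod C x = Car K" for x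
    using Cmp_reassoc[OF swap(2), of x] Cmp_reassoc[OF swap(4), of x] that by simp_all
  have aa: "a \<cdot> a' \<cdot> x = x" if "x \<in> Arr C" "Cod C x = Car H" for x using Cmp_reassoc[OF a'(4), of x] that
    by simp
  have dd: "d \<cdot> d' \<cdot> x = x" if "x \<in> Arr C" "Cod C x = Car K" for x using Cmp_reassoc[OF d'(4), of x] that
    by simp
  \<comment> \<open>The entry is \<open>a (- a' b d') + b d' = 0\<close>; the other off-diagonal
    entry vanishes likewise, and the diagonal ones become \<open>1 - b d' c a'\<close> and
    \<open>1 - c a' b d'\<close>.\<close>
  have "\<pi>\<^sub>1 \<cdot> (?M \<cdot> ?N) \<cdot> \<iota>\<^sub>2 = (Ant H \<cdot> b \<cdot> d') \<star>\<^bsub>K,H\<^esub> (b \<cdot> d')"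
    unfolding matrix_product[OF MH NH] matrix_morphism_entries[OF M] matrix_morphism_entries[OF N]
    by (simp add: swap' swap'' aa dd)
  also have "\<dots> = zer K H"
    by (rule antipode_conv_hom(1)) (use coalg_hom_Cmp[OF HomD(2)[OF d'(2)] HomD(2)[OF bc(1)]]
      in simp_all)
  finally have 12: "\<pi>\<^sub>1 \<cdot> (?M \<cdot> ?N) \<cdot> \<iota>\<^sub>2 = zer K H" .
  have "\<pi>\<^sub>2 \<cdot> (?M \<cdot> ?N) \<cdot> \<iota>\<^sub>1 = (c \<cdot> a') \<star>\<^bsub>H,K\<^esub> (Ant K \<cdot> c \<cdot> a')"
    unfolding matrix_product[OF MH NH] matrix_morphism_entries[OF M] matrix_morphism_entries[OF N]
    by (simp add: swap' swap'' aa dd)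
  also have "\<dots> = zer H K"
    by (rule antipode_conv_hom(2)) (use coalg_hom_Cmp[OF HomD(2)[OF a'(2)] HomD(2)[OF bc(2)]]
      in simp_all)
  finally have 21: "\<pi>\<^sub>2 \<cdot> (?M \<cdot> ?N) \<cdot> \<iota>\<^sub>1 = zer H K" .
  have 11: "\<pi>\<^sub>1 \<cdot> (?M \<cdot> ?N) \<cdot> \<iota>\<^sub>1 = idm H \<star>\<^bsub>H,H\<^esub> (Ant H \<cdot> b \<cdot> ?c)"
    unfolding matrix_product[OF MH NH] matrix_morphism_entries[OF M] matrix_morphism_entries[OF N]
    by (simp add: swap' swap'' aa dd a'(4))
  have "\<pi>\<^sub>2 \<cdot> (?M \<cdot> ?N) \<cdot> \<iota>\<^sub>2 = (Ant K \<cdot> c \<cdot> ?b) \<star>\<^bsub>K,K\<^esub> idm K"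
    unfolding matrix_product[OF MH NH] matrix_morphism_entries[OF M] matrix_morphism_entries[OF N]
    by (simp add: swap' swap'' aa dd d'(4))
  \<comment> \<open>The summands arrive in the opposite order; centrality of the product permits the
    exchange.\<close>
  also have "\<dots> = idm K \<star>\<^bsub>K,K\<^esub> (Ant K \<cdot> c \<cdot> ?b)"
    using central_antipode[OF s.hopf_Hom_c_product[OF c b1]] by (intro conv_commute) simp_all
  finally have 22: "\<pi>\<^sub>2 \<cdot> (?M \<cdot> ?N) \<cdot> \<iota>\<^sub>2 = idm K \<star>\<^bsub>K,K\<^esub> (Ant K \<cdot> c \<cdot> ?b)" .
  have i1: "is_isomorphism C (\<pi>\<^sub>1 \<cdot> (?M \<cdot> ?N) \<cdot> \<iota>\<^sub>1)"
    unfolding 11 by (rule central_product_isomorphism[OF b c1 dcc(1) triv])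
  have i2: "is_isomorphism C (\<pi>\<^sub>2 \<cdot> (?M \<cdot> ?N) \<cdot> \<iota>\<^sub>2)"
    unfolding 22 by (rule s.central_product_isomorphism[OF c b1 dcc(2)]) (use triv in \<open>auto simp:
        common_tensor_factor_def\<close>)
  obtain u v where u: "mutually_inverse C (\<pi>\<^sub>1 \<cdot> (?M \<cdot> ?N) \<cdot> \<iota>\<^sub>1) u"
      and v: "mutually_inverse C (\<pi>\<^sub>2 \<cdot> (?M \<cdot> ?N) \<cdot> \<iota>\<^sub>2) v"
    using i1 i2 by (auto simp: is_isomorphism_def)
  have "mutually_inverse C ((\<pi>\<^sub>1 \<cdot> (?M \<cdot> ?N) \<cdot> \<iota>\<^sub>1) \<otimes> (\<pi>\<^sub>2 \<cdot> (?M \<cdot> ?N) \<cdot> \<iota>\<^sub>2)) (u \<otimes> v)"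
    using u v by (simp add: mutually_inverse_iff Ten_Idn)
  then have "is_isomorphism C (?M \<cdot> ?N)"
    unfolding diagonal_matrix[OF MNH 12 21, symmetric] by (auto simp: is_isomorphism_def)
  then show ?thesis using a'(3) b2 c2 d'(3) unfolding matrix_set_def by blast
qed

text \<open>A partner \<open>N\<close> of \<open>M\<close> and a partner \<open>P\<close> of
  \<open>N\<close> make \<open>M N\<close> and \<open>N P\<close> invertible. Then \<open>N\<close>
  has inverses on both sides, and \<open>M\<close> is the product of \<open>M N\<close> with the
  inverse of \<open>N\<close>.\<close>

lemma matrix_set_isomorphism:
  assumes M: "M \<in> matrix_set C H K" and dcc: "both_chain_conditions C H" "both_chain_conditions C K"
    and triv: "\<And>A. common_tensor_factor C A H K \<Longrightarrow> abelian_hopf C A \<Longrightarrow> trivial_hopf C A"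
  shows "matrix_morphism C H K M \<in> hopf_Aut C HK"
proof -
  have Hom: "matrix_morphism C H K M \<in> Hom HK HK" if "M \<in> matrix_set C H K" for M
    using that matrix_morphism_Hom[OF matrix_set_compatible] by (auto simp: matrix_set_def)
  have partner: "\<exists>N \<in> matrix_set C H K. is_isomorphism C (matrix_morphism C H K M
      \<cdot> matrix_morphism C H K N)"
    if "M \<in> matrix_set C H K" for M
    using that matrix_partner[OF _ _ _ _ dcc triv] by (auto simp: matrix_set_def)
  obtain N where N: "N \<in> matrix_set C H K" "is_isomorphism C (matrix_morphism C H K M
      \<cdot> matrix_morphism C H K N)"
    using partner[OF M] by blast
  obtain P where P: "P \<in> matrix_set C H K" "is_isomorphism C (matrix_morphism C H K N
      \<cdot> matrix_morphism C H K P)"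
    using partner[OF N(1)] by blast
  let ?m = "matrix_morphism C H K M" and ?n = "matrix_morphism C H K N"
  note [simp] = Hom_typing[OF Hom[OF M]] Hom_typing[OF Hom[OF N(1)]] Hom_typing[OF Hom[OF P(1)]]
  have "is_isomorphism C ?n" by (rule isomorphism_of_products[OF N(2) P(2)]) simp_all
  then obtain u where u: "mutually_inverse C ?n u" by (auto simp: is_isomorphism_def)
  then have [simp]: "u \<in> Arr C" "Dom C u = Car HK" "Cod C u = Car HK" and nu: "?n \<cdot> u = idm HK"
    by (simp_all add: mutually_inverse_iff)
  have "mutually_inverse C u ?n" using u by (auto simp: mutually_inverse_iff)
  then have "is_isomorphism C u" by (auto simp: is_isomorphism_def)
  then have "is_isomorphism C ((?m \<cdot> ?n) \<cdot> u)" by (rule is_isomorphism_Cmp[OF _ N(2)]) simp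
  moreover have "(?m \<cdot> ?n) \<cdot> u = ?m" using nu by simp
  ultimately show ?thesis by (intro hopf_AutI Hom[OF M]) simp_all
qed

text \<open>A converse to \<open>tensor_factorI\<close>: the injections and projections of
  \<open>A \<boxtimes> B\<close> are transported along the isomorphism, and the complement of
  \<open>i p\<close> is the idempotent belonging to \<open>B\<close>.\<close>

lemma tensor_factorD:
  assumes "tensor_factor C A H"
  shows "\<exists>i p f. i \<in> Hom A H \<and> p \<in> Hom H A \<and> p \<cdot> i = idm A \<and> complementary C H f (i \<cdot> p)"
proof -
  obtain B where [simp]: "is_hopf_algebra C A" "is_hopf_algebra C B"
      and ub: "unbraided C (Car A) (Car B)"
    and "hopf_isomorphic C H (A \<boxtimes> B)"
    using assms by (auto simp: tensor_factor_def)
  then obtain h k where h: "h \<in> Hom H (A \<boxtimes> B)" and k: "k \<in> Hom (A \<boxtimes> B) H"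
      and hk: "mutually_inverse C h k"
    by (auto simp: hopf_isomorphic_def hopf_Iso_def)
  interpret t: hopf_pair C A B by unfold_locales (simp_all add: ub)
  note [simp] = Hom_typing[OF h] Hom_typing[OF k]
  have hk': "h \<cdot> k = Idn C (Car A \<odot> Car B)" and kh: "k \<cdot> h = idm H" using hk
    by (simp_all add: mutually_inverse_iff)
  have hk'': "h \<cdot> k \<cdot> x = x" if "x \<in> Arr C" "Cod C x = Car A \<odot> Car B" for x
    using Cmp_reassoc[OF hk', of x] that by simp
  define i where "i = k \<cdot> in1 C A B"
  define j where "j = k \<cdot> in2 C A B"
  define p where "p = pr1 C A B \<cdot> h"
  define q where "q = pr2 C A B \<cdot> h"
  have Hom: "i \<in> Hom A H" "j \<in> Hom B H" "p \<in> Hom H A" "q \<in> Hom H B"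
    unfolding i_def j_def p_def q_def
    by (rule hopf_Hom_Cmp[OF t.in_pr_Hom(1) k] hopf_Hom_Cmp[OF t.in_pr_Hom(2) k]
      hopf_Hom_Cmp[OF h t.in_pr_Hom(3)] hopf_Hom_Cmp[OF h t.in_pr_Hom(4)]; simp)+
  note [simp] = Hom_typing[OF Hom(1)] Hom_typing[OF Hom(2)] Hom_typing[OF Hom(3)] Hom_typing[OF Hom(4)]
  have pi: "p \<cdot> i = idm A" by (simp add: p_def i_def hk'' pr_in)
  have "k \<cdot> h = (i \<cdot> p) \<star>\<^bsub>H,H\<^esub> (j \<cdot> q)"
    using t.hom_product[OF HomD(1)[OF k] HomD(2)[OF h]] by (simp add: i_def j_def p_def q_def)
  then have 1: "(i \<cdot> p) \<star>\<^bsub>H,H\<^esub> (j \<cdot> q) = idm H" by (simp add: kh)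
  have "bicommuting C H i j" unfolding i_def j_def
    by (rule bicommuting_alg_hom[OF t.in_bicommuting HomD(1)[OF k]]) simp_all
  then have 2: "bicommuting C H (i \<cdot> p) (j \<cdot> q)" by (rule bicommuting_precomp) simp_all
  have "bicocommuting C H p q" unfolding p_def q_def
    by (rule bicocommuting_coalg_hom[OF t.pr_bicocommuting HomD(2)[OF h]]) simp_all
  then have 3: "bicocommuting C H (i \<cdot> p) (j \<cdot> q)" by (rule bicocommuting_postcomp) simp_all
  have "complementary C H (i \<cdot> p) (j \<cdot> q)"
    unfolding complementary_def using 1 2 3 Hom_comp[OF Hom(3,1)] Hom_comp[OF Hom(4,2)] by simp
  then have "complementary C H (j \<cdot> q) (i \<cdot> p)" by (rule complementary_sym) simp
  then show ?thesis using Hom(1,3) pi by blast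
qed

text \<open>The inclusion \<open>i\<close> commutes with \<open>f\<close> by complementarity and
  with \<open>i p\<close> because \<open>A\<close> is commutative, hence with their sum
  \<open>1\<close>. Dually \<open>q\<close> cocommutes with \<open>1\<close> by cocommutativity of
  \<open>A\<close>.\<close>

lemma hopf_Hom_c_through_abelian:
  assumes A: "abelian_hopf C A" and [simp]: "is_hopf_algebra C A"
    and i: "i \<in> Hom A H" and p: "p \<in> Hom H A" "p \<cdot> i = idm A" and f: "complementary C H f (i \<cdot> p)"
    and j: "j \<in> Hom A K" and q: "q \<in> Hom K A" "q \<cdot> j = idm A" and g: "complementary C K g (j \<cdot> q)"
  shows "i \<cdot> q \<in> hopf_Hom_c C K H"
proof -
  note D = complementaryD[OF f] and E = complementaryD[OF g]
  note [simp] = Hom_typing[OF i] Hom_typing[OF p(1)] Hom_typing[OF j] Hom_typing[OF q(1)]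
    Hom_typing[OF D(1)] Hom_typing[OF E(1)]
  have "commuting C A (idm A) (idm A)" "cocommuting C A (idm A) (idm A)"
    using A by (simp_all add: commuting_def cocommuting_def abelian_hopf_def Ten_Idn)
  then have AA: "bicommuting C A (idm A) (idm A)" "bicocommuting C A (idm A) (idm A)"
    by (simp_all add: bicommuting_def bicocommuting_def)
  have "bicommuting C H (i \<cdot> idm A) (i \<cdot> idm A)"
    by (rule bicommuting_alg_hom[OF AA(1) HomD(1)[OF i]]) simp_all
  then have "bicommuting C H (i \<cdot> p) i"
    using bicommuting_precomp[of H i i p "idm A"] by simp
  moreover have "bicommuting C H (f \<cdot> idm H) ((i \<cdot> p) \<cdot> i)"
    by (rule bicommuting_precomp[OF D(4)]) simp_all
  then have "bicommuting C H f i" by (simp add: p(2))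
  ultimately have "bicommuting C H (f \<star>\<^bsub>H,H\<^esub> (i \<cdot> p)) i"
    by (intro bicommuting_conv[of H f i "i \<cdot> p" H A]) simp_all
  then have "bicommuting C H i (idm H)" by (simp add: D(3) bicommuting_sym)
  then have 1: "bicommuting C H (i \<cdot> q) (idm H)"
    using bicommuting_precomp[of H i "idm H" q "idm H"] by simp
  have "bicocommuting C K (idm A \<cdot> q) (idm A \<cdot> q)"
    by (rule bicocommuting_coalg_hom[OF AA(2) HomD(2)[OF q(1)]]) simp_all
  then have "bicocommuting C K (j \<cdot> q) q"
    using bicocommuting_postcomp[of K q q j "idm A"] by simp
  moreover have "bicocommuting C K (idm K \<cdot> g) (q \<cdot> j \<cdot> q)"
    by (rule bicocommuting_postcomp[OF E(5)]) simp_all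
  then have "bicocommuting C K g q" using Cmp_reassoc[OF q(2), of q] by simp
  ultimately have "bicocommuting C K (g \<star>\<^bsub>K,K\<^esub> (j \<cdot> q)) q"
    by (intro bicocommuting_conv[of K g q "j \<cdot> q" K A]) simp_all
  then have "bicocommuting C K q (idm K)" by (simp add: E(3) bicocommuting_sym)
  then have 2: "bicocommuting C K (i \<cdot> q) (idm K)"
    using bicocommuting_postcomp[of K q "idm K" i "idm K"] by simp
  show ?thesis using 1 2 Hom_comp[OF q(1) i] by (simp add: hopf_Hom_c_iff)
qed

lemma trivial_from_zer:
  assumes "is_hopf_algebra C A" "i = zer A H" "p \<cdot> i = idm A" "p \<in> Hom H A"
  shows "trivial_hopf C A"
  using assms alg_hom_zer[OF HomD(1)[OF assms(4)], of A] by (simp add: trivial_hopf_iff)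

text \<open>
  The matrix kills the antidiagonal \<open>x \<mapsto> (x, - x)\<close> of the two copies of \<open>A\<close>.
\<close>

lemma abelian_factor_obstruction:
  assumes A: "common_tensor_factor C A H K" "abelian_hopf C A"
    and incl: "matrix_morphism C H K ` matrix_set C H K \<subseteq> hopf_Aut C HK"
  shows "trivial_hopf C A"
proof -
  interpret s: hopf_pair C K H by (rule swapped_pair)
  have [simp]: "is_hopf_algebra C A" using A by (auto simp: common_tensor_factor_def tensor_factor_def)
  obtain i p f where i: "i \<in> Hom A H" and p: "p \<in> Hom H A" "p \<cdot> i = idm A"
      and f: "complementary C H f (i \<cdot> p)"
    using tensor_factorD[of A] A by (auto simp: common_tensor_factor_def)
  obtain j q g where j: "j \<in> Hom A K" and q: "q \<in> Hom K A" "q \<cdot> j = idm A"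
      and g: "complementary C K g (j \<cdot> q)"
    using s.tensor_factorD[of A] A by (auto simp: common_tensor_factor_def)
  note [simp] = Hom_typing[OF i] Hom_typing[OF p(1)] Hom_typing[OF j] Hom_typing[OF q(1)]
  let ?b = "i \<cdot> q" and ?c = "j \<cdot> p" and ?h = "idm H" and ?k = "idm K"
  have b: "?b \<in> hopf_Hom_c C K H" by (rule hopf_Hom_c_through_abelian[OF A(2) _ i p f j q g]) simp
  have c: "?c \<in> hopf_Hom_c C H K" by (rule s.hopf_Hom_c_through_abelian[OF A(2) _ j q g i p f]) simp
  have idA: "?h \<in> hopf_Aut C H" "?k \<in> hopf_Aut C K"
    by (simp_all add: hopf_AutI is_isomorphism_Idn)
  let ?m = "matrix_morphism C H K (?h, ?b, ?c, ?k)"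
  note M = matrix_set_compatible[OF idA(1) b c idA(2)]
  note MH = matrix_morphism_Hom[OF M]
  note E = matrix_morphism_entries[OF M]
  note [simp] = Hom_typing[OF MH]
  have "(?h, ?b, ?c, ?k) \<in> matrix_set C H K" using idA b c by (simp add: matrix_set_def)
  then have "?m \<in> hopf_Aut C HK" using incl by blast
  then obtain m' where m': "m' \<in> Hom HK HK" "m' \<cdot> ?m = idm HK" using hopf_AutD[of ?m HK] by blast
  note [simp] = Hom_typing[OF m'(1)]
  have m1: "coalg_hom C H HK (?m \<cdot> \<iota>\<^sub>1)" and m2: "coalg_hom C K HK (?m \<cdot> \<iota>\<^sub>2)"
    by (rule coalg_hom_Cmp[OF HomD(2)[OF in_pr_Hom(1)] HomD(2)[OF MH]]
      coalg_hom_Cmp[OF HomD(2)[OF in_pr_Hom(2)] HomD(2)[OF MH]]; simp)+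
  have M1: "?m \<cdot> \<iota>\<^sub>1 = \<iota>\<^sub>1 \<star>\<^bsub>H,HK\<^esub> (\<iota>\<^sub>2 \<cdot> j \<cdot> p)"
    using hom_product[OF Idn_hom(1) m1] by (simp add: E)
  have M2: "?m \<cdot> \<iota>\<^sub>2 = (\<iota>\<^sub>1 \<cdot> i \<cdot> q) \<star>\<^bsub>K,HK\<^esub> \<iota>\<^sub>2"
    using hom_product[OF Idn_hom(1) m2] by (simp add: E)
  \<comment> \<open>The diagonal embedding of \<open>A\<close>. Both columns of the matrix restrict
    to it, the first along \<open>i\<close> and the second along \<open>j\<close>.\<close>
  let ?w = "(\<iota>\<^sub>1 \<cdot> i) \<star>\<^bsub>A,HK\<^esub> (\<iota>\<^sub>2 \<cdot> j)"
  have w1: "(?m \<cdot> \<iota>\<^sub>1) \<cdot> i = ?w"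
    unfolding M1 by (subst coalg_hom_conv[OF HomD(2)[OF i]]) (simp_all add: p)
  have w2: "(?m \<cdot> \<iota>\<^sub>2) \<cdot> j = ?w"
    unfolding M2 by (subst coalg_hom_conv[OF HomD(2)[OF j]]) (simp_all add: q)
  \<comment> \<open>Seen as a composite with \<open>?m\<close>, the sum \<open>?w\<close> is an
    algebra morphism, so that \<open>?w \<cdot> Ant A\<close> is its negative.\<close>
  have "alg_hom C A HK (?m \<cdot> \<iota>\<^sub>1 \<cdot> i)"
    by (rule alg_hom_Cmp[OF alg_hom_Cmp[OF HomD(1)[OF i] HomD(1)[OF in_pr_Hom(1)]]
      HomD(1)[OF MH]]) simp_all
  then have w: "alg_hom C A HK ?w" using w1 by simp
  \<comment> \<open>The antidiagonal. The matrix sends it to \<open>?w - ?w\<close>, so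
    invertibility makes it zero, and its component in \<open>H\<close> is \<open>i\<close>.\<close>
  let ?y = "(\<iota>\<^sub>1 \<cdot> i) \<star>\<^bsub>A,HK\<^esub> (\<iota>\<^sub>2 \<cdot> j \<cdot> Ant A)"
  have "?m \<cdot> ?y = (?m \<cdot> \<iota>\<^sub>1 \<cdot> i) \<star>\<^bsub>A,HK\<^esub> (?m \<cdot> \<iota>\<^sub>2 \<cdot> j \<cdot> Ant A)"
    by (rule alg_hom_conv[OF HomD(1)[OF MH]]) simp_all
  also have "?m \<cdot> \<iota>\<^sub>1 \<cdot> i = ?w" using w1 by simp
  also have "?m \<cdot> \<iota>\<^sub>2 \<cdot> j \<cdot> Ant A = ((?m \<cdot> \<iota>\<^sub>2) \<cdot> j) \<cdot> Ant A" by simp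
  also have "\<dots> = ?w \<cdot> Ant A" by (simp only: w2)
  also have "?w \<star>\<^bsub>A,HK\<^esub> (?w \<cdot> Ant A) = zer A HK" by (rule conv_antipode_hom(2)[OF w]) simp_all
  also have "zer A HK = ?m \<cdot> zer A HK" by (rule alg_hom_zer[OF HomD(1)[OF MH], symmetric]) simp_all
  finally have "?y = zer A HK" by (rule Cmp_cancel_left[OF m'(2)]) simp_all
  then have "\<pi>\<^sub>1 \<cdot> ?y = zer A H" by (simp add: alg_hom_zer[OF HomD(1)[OF in_pr_Hom(3)]])
  moreover have "\<pi>\<^sub>1 \<cdot> ?y = (\<pi>\<^sub>1 \<cdot> \<iota>\<^sub>1 \<cdot> i) \<star>\<^bsub>A,H\<^esub> (\<pi>\<^sub>1 \<cdot> \<iota>\<^sub>2 \<cdot> j \<cdot> Ant A)"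
    by (rule alg_hom_conv[OF HomD(1)[OF in_pr_Hom(3)]]) simp_all
  moreover have "\<pi>\<^sub>1 \<cdot> \<iota>\<^sub>1 \<cdot> i = i" using Cmp_reassoc[OF pr_in(1)[of H K], of i] by simp
  moreover have "\<pi>\<^sub>1 \<cdot> \<iota>\<^sub>2 \<cdot> j \<cdot> Ant A = zer A H"
  proof -
    have "\<pi>\<^sub>1 \<cdot> \<iota>\<^sub>2 \<cdot> j \<cdot> Ant A = zer K H \<cdot> j \<cdot> Ant A" by (rule Cmp_reassoc[OF pr_in(3)]) simp_all
    also have "\<dots> = zer A H \<cdot> Ant A" by (rule Cmp_reassoc[OF coalg_hom_zer[OF HomD(2)[OF j]]]) simp_all
    also have "\<dots> = zer A H"
      using conv_antipode_hom(1)[OF HomD(1)[OF zer_hopf_Hom], of A H] by simp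
    finally show ?thesis .
  qed
  ultimately have "i = zer A H" by simp
  then show ?thesis by (intro trivial_from_zer[OF _ _ p(2,1)]) simp_all
qed

text \<open>The first diagonal entry of \<open>f g = 1\<close> reads \<open>a a' + b c' = 1\<close>,
  the second of \<open>g f = 1\<close> reads \<open>c' b + d' d = 1\<close>. They are paired because
  \<open>complementary_isomorphism\<close> needs complements of both \<open>b c'\<close> and
  \<open>c' b\<close>.\<close>

lemma diagonal_entries_isomorphism:
  assumes f: "f \<in> Hom HK HK" and g: "g \<in> Hom HK HK" and fg: "f \<cdot> g = idm HK" and gf: "g \<cdot> f = idm HK"
    and dcc: "both_chain_conditions C H" "both_chain_conditions C K"
    and triv: "\<And>A. common_tensor_factor C A H K \<Longrightarrow> trivial_hopf C A"
  shows "is_isomorphism C ((\<pi>\<^sub>1 \<cdot> f \<cdot> \<iota>\<^sub>1) \<cdot> (\<pi>\<^sub>1 \<cdot> g \<cdot> \<iota>\<^sub>1))"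
      "is_isomorphism C ((\<pi>\<^sub>2 \<cdot> g \<cdot> \<iota>\<^sub>2) \<cdot> (\<pi>\<^sub>2 \<cdot> f \<cdot> \<iota>\<^sub>2))"
proof -
  let ?a = "\<pi>\<^sub>1 \<cdot> f \<cdot> \<iota>\<^sub>1" and ?b = "\<pi>\<^sub>1 \<cdot> f \<cdot> \<iota>\<^sub>2" and ?c = "\<pi>\<^sub>2 \<cdot> f \<cdot> \<iota>\<^sub>1" and ?d = "\<pi>\<^sub>2 \<cdot> f \<cdot> \<iota>\<^sub>2"
  let ?a' = "\<pi>\<^sub>1 \<cdot> g \<cdot> \<iota>\<^sub>1" and ?b' = "\<pi>\<^sub>1 \<cdot> g \<cdot> \<iota>\<^sub>2" and ?c' = "\<pi>\<^sub>2 \<cdot> g \<cdot> \<iota>\<^sub>1" and ?d' = "\<pi>\<^sub>2 \<cdot> g \<cdot> \<iota>\<^sub>2"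
  note F = matrix_decomposition(1)[OF f, unfolded matrix_compatible_def]
  note G = matrix_decomposition(1)[OF g, unfolded matrix_compatible_def]
  define a b c d where abcd: "a = ?a" "b = ?b" "c = ?c" "d = ?d"
  define a' b' c' d' where abcd': "a' = ?a'" "b' = ?b'" "c' = ?c'" "d' = ?d'"
  note F = F[folded abcd] and G = G[folded abcd']
  have h: "a \<in> Hom H H" "b \<in> Hom K H" "c \<in> Hom H K" "d \<in> Hom K K"
    "a' \<in> Hom H H" "b' \<in> Hom K H" "c' \<in> Hom H K" "d' \<in> Hom K K"
    using F G by auto
  note [simp] = Hom_typing[OF h(1)] Hom_typing[OF h(2)] Hom_typing[OF h(3)] Hom_typing[OF h(4)]
    Hom_typing[OF h(5)] Hom_typing[OF h(6)] Hom_typing[OF h(7)] Hom_typing[OF h(8)]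
  have 11: "(a \<cdot> a') \<star>\<^bsub>H,H\<^esub> (b \<cdot> c') = idm H"
    using matrix_product(1)[OF f g] unfolding fg by (simp add: abcd abcd' pr_in)
  have 22: "(c' \<cdot> b) \<star>\<^bsub>K,K\<^esub> (d' \<cdot> d) = idm K"
    using matrix_product(4)[OF g f] unfolding gf by (simp add: abcd abcd' pr_in)
  \<comment> \<open>Commutation comes from the rows of \<open>f\<close> and cocommutation from the
    columns of \<open>g\<close>; for the complement in \<open>K\<close> the two matrices exchange
    roles.\<close>
  have "bicommuting C H (a \<cdot> a') (b \<cdot> c')" by (rule bicommuting_precomp) (use F in simp_all)
  moreover have "bicocommuting C H (a \<cdot> a') (b \<cdot> c')"
    by (rule bicocommuting_postcomp) (use G in simp_all)
  ultimately have H: "complementary C H (a \<cdot> a') (b \<cdot> c')"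
    using 11 Hom_comp[OF h(5,1)] Hom_comp[OF h(7,2)] by (simp add: complementary_def)
  have "bicommuting C K (c' \<cdot> b) (d' \<cdot> d)" by (rule bicommuting_precomp) (use G in simp_all)
  moreover have "bicocommuting C K (c' \<cdot> b) (d' \<cdot> d)"
    by (rule bicocommuting_postcomp) (use F in simp_all)
  ultimately have "complementary C K (c' \<cdot> b) (d' \<cdot> d)"
    using 22 Hom_comp[OF h(4,8)] Hom_comp[OF h(2,7)] by (simp add: complementary_def)
  then have K: "complementary C K (d' \<cdot> d) (c' \<cdot> b)" by (rule complementary_sym) simp
  have "is_isomorphism C (a \<cdot> a')"
    by (rule complementary_isomorphism[OF h(2,7) H K dcc(1)]) (use triv in simp_all)
  moreover have "is_isomorphism C (d' \<cdot> d)"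
    by (rule complementary_isomorphism[OF h(7,2) K H dcc(2)]) (use triv in \<open>simp_all add:
      common_tensor_factor_def\<close>)
  ultimately show "is_isomorphism C (?a \<cdot> ?a')" "is_isomorphism C (?d' \<cdot> ?d)"
    by (simp_all only: abcd abcd')
qed

text \<open>Applying the preceding lemma to \<open>f\<close>, \<open>g\<close> and to
  \<open>g\<close>, \<open>f\<close> makes the diagonal entries of \<open>f\<close> invertible from
  both sides. The relations of \<open>b\<close> and \<open>c\<close> with \<open>a\<close> and
  \<open>d\<close> become relations with the identity after composing with the inverses.\<close>

lemma automorphism_matrix:
  assumes f: "f \<in> hopf_Aut C HK" and dcc: "both_chain_conditions C H" "both_chain_conditions C K"
    and triv: "\<And>A. common_tensor_factor C A H K \<Longrightarrow> trivial_hopf C A"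
  shows "f \<in> matrix_morphism C H K ` matrix_set C H K"
proof -
  interpret s: hopf_pair C K H by (rule swapped_pair)
  obtain g where fH: "f \<in> Hom HK HK" and gH: "g \<in> Hom HK HK" and inv: "g \<cdot> f = idm HK" "f \<cdot> g = idm HK"
    using hopf_AutD[OF f] by blast
  define a b c d where abcd: "a = \<pi>\<^sub>1 \<cdot> f \<cdot> \<iota>\<^sub>1" "b = \<pi>\<^sub>1 \<cdot> f \<cdot> \<iota>\<^sub>2" "c = \<pi>\<^sub>2 \<cdot> f \<cdot> \<iota>\<^sub>1" "d = \<pi>\<^sub>2 \<cdot> f \<cdot> \<iota>\<^sub>2"
  define a' d' where abcd': "a' = \<pi>\<^sub>1 \<cdot> g \<cdot> \<iota>\<^sub>1" "d' = \<pi>\<^sub>2 \<cdot> g \<cdot> \<iota>\<^sub>2"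
  note F = matrix_decomposition[OF fH, folded abcd]
  note comp = F(1)[unfolded matrix_compatible_def]
  have h: "a \<in> Hom H H" "b \<in> Hom K H" "c \<in> Hom H K" "d \<in> Hom K K"
    "a' \<in> Hom H H" "d' \<in> Hom K K"
    using comp matrix_decomposition(1)[OF gH, folded abcd', unfolded matrix_compatible_def] by simp_all
  note [simp] = Hom_typing[OF h(1)] Hom_typing[OF h(2)] Hom_typing[OF h(3)] Hom_typing[OF h(4)]
    Hom_typing[OF h(5)] Hom_typing[OF h(6)]
  have "is_isomorphism C (a \<cdot> a')" "is_isomorphism C (d' \<cdot> d)"
    unfolding abcd abcd' by (rule diagonal_entries_isomorphism[OF fH gH inv(2,1) dcc triv]; assumption)+
  moreover have "is_isomorphism C (a' \<cdot> a)" "is_isomorphism C (d \<cdot> d')"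
    unfolding abcd abcd' by (rule diagonal_entries_isomorphism[OF gH fH inv dcc triv]; assumption)+
  ultimately have "is_isomorphism C a" "is_isomorphism C d"
    using isomorphism_of_products[of a' a a'] isomorphism_of_products[of d' d d'] by simp_all
  then have ad: "a \<in> hopf_Aut C H" "d \<in> hopf_Aut C K" using h by (simp_all add: hopf_AutI)
  obtain x where x: "x \<in> Hom H H" "a \<cdot> x = idm H" "x \<cdot> a = idm H" using hopf_AutD[OF ad(1)] by blast
  obtain y where y: "y \<in> Hom K K" "d \<cdot> y = idm K" "y \<cdot> d = idm K" using hopf_AutD[OF ad(2)] by blast
  note [simp] = Hom_typing[OF x(1)] Hom_typing[OF y(1)]
  have "bicommuting C H (a \<cdot> x) (b \<cdot> idm K)" by (rule bicommuting_precomp) (use comp in simp_all)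
  moreover have "bicocommuting C K (idm H \<cdot> b) (y \<cdot> d)"
    by (rule bicocommuting_postcomp) (use comp in simp_all)
  ultimately have b: "b \<in> hopf_Hom_c C K H" using h by (simp add: hopf_Hom_c_iff x y bicommuting_sym)
  have "bicommuting C K (c \<cdot> idm H) (d \<cdot> y)" by (rule bicommuting_precomp) (use comp in simp_all)
  moreover have "bicocommuting C H (x \<cdot> a) (idm K \<cdot> c)"
    by (rule bicocommuting_postcomp) (use comp in simp_all)
  ultimately have c: "c \<in> hopf_Hom_c C H K" using h by (simp add: s.hopf_Hom_c_iff x y bicocommuting_sym)
  show ?thesis using F(2) ad b c by (intro image_eqI[of _ _ "(a, b, c, d)"]) (simp_all add:
      matrix_set_def)
qed

text \<open>The involution with rows \<open>f\<close>, \<open>i q\<close> and \<open>j p\<close>,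
  \<open>g\<close> exchanges the two copies of \<open>A\<close> and fixes the complements. The
  equation \<open>f i = 0\<close> is what contradicts invertibility of the diagonal entry for
  nontrivial \<open>A\<close>.\<close>

lemma common_factor_swap:
  assumes A: "common_tensor_factor C A H K"
  shows "\<exists>i p f s. is_hopf_algebra C A \<and> i \<in> Hom A H \<and> p \<in> Hom H A \<and> p \<cdot> i = idm A \<and>
    f \<cdot> i = zer A H \<and> s \<in> hopf_Aut C HK \<and> \<pi>\<^sub>1 \<cdot> s \<cdot> \<iota>\<^sub>1 = f"
proof -
  interpret s: hopf_pair C K H by (rule swapped_pair)
  have [simp]: "is_hopf_algebra C A" using A by (auto simp: common_tensor_factor_def tensor_factor_def)
  obtain i p f where i: "i \<in> Hom A H" and p: "p \<in> Hom H A" "p \<cdot> i = idm A"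
      and f: "complementary C H f (i \<cdot> p)"
    using tensor_factorD[of A] A by (auto simp: common_tensor_factor_def)
  obtain j q g where j: "j \<in> Hom A K" and q: "q \<in> Hom K A" "q \<cdot> j = idm A"
      and g: "complementary C K g (j \<cdot> q)"
    using s.tensor_factorD[of A] A by (auto simp: common_tensor_factor_def)
  note F = complementaryD[OF f] and G = complementaryD[OF g]
  note f' = complementary_idempotent[OF f i p hopf(1)] and g'
      = complementary_idempotent[OF g j q hopf(2)]
  note [simp] = Hom_typing[OF i] Hom_typing[OF p(1)] Hom_typing[OF j] Hom_typing[OF q(1)]
    Hom_typing[OF F(1)] Hom_typing[OF G(1)]
  have pi: "p \<cdot> i \<cdot> x = x" if "x \<in> Arr C" "Cod C x = Car A" for x using Cmp_reassoc[OF p(2), of x] that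
    by simp
  have qj: "q \<cdot> j \<cdot> x = x" if "x \<in> Arr C" "Cod C x = Car A" for x using Cmp_reassoc[OF q(2), of x] that
    by simp
  have "bicommuting C H (f \<cdot> idm H) ((i \<cdot> p) \<cdot> i \<cdot> q)" by (rule bicommuting_precomp[OF F(4)]) simp_all
  moreover have "bicommuting C K (g \<cdot> idm K) ((j \<cdot> q) \<cdot> j \<cdot> p)"
    by (rule bicommuting_precomp[OF G(4)]) simp_all
  moreover have "bicocommuting C H (idm H \<cdot> f) ((j \<cdot> p) \<cdot> i \<cdot> p)"
    by (rule bicocommuting_postcomp[OF F(5)]) simp_all
  moreover have "bicocommuting C K (idm K \<cdot> g) ((i \<cdot> q) \<cdot> j \<cdot> q)"
    by (rule bicocommuting_postcomp[OF G(5)]) simp_all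
  ultimately have M: "matrix_compatible f (i \<cdot> q) (j \<cdot> p) g"
    using F(1) G(1) Hom_comp[OF q(1) i] Hom_comp[OF p(1) j]
    by (simp add: matrix_compatible_def pi qj bicommuting_sym bicocommuting_sym)
  let ?s = "matrix_morphism C H K (f, i \<cdot> q, j \<cdot> p, g)"
  note SH = matrix_morphism_Hom[OF M] and E = matrix_morphism_entries[OF M]
  note [simp] = Hom_typing[OF SH]
  have SS: "?s \<cdot> ?s \<in> Hom HK HK" by (rule hopf_Hom_Cmp[OF SH SH]) simp_all
  have z1: "f \<cdot> i \<cdot> q = zer K H" using Cmp_reassoc[OF f'(1), of q]
      coalg_hom_zer[OF HomD(2)[OF q(1)], of H] by simp
  have z2: "i \<cdot> q \<cdot> g = zer K H" using g'(2) alg_hom_zer[OF HomD(1)[OF i], of K] by simp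
  have z3: "j \<cdot> p \<cdot> f = zer H K" using f'(2) alg_hom_zer[OF HomD(1)[OF j], of H] by simp
  have z4: "g \<cdot> j \<cdot> p = zer H K" using Cmp_reassoc[OF g'(1), of p]
      coalg_hom_zer[OF HomD(2)[OF p(1)], of K] by simp
  \<comment> \<open>For instance, the first diagonal entry of the square is
    \<open>f f + i q j p = f + i p = 1\<close>; off the diagonal every summand contains a product
    that vanishes.\<close>
  have e: "\<pi>\<^sub>1 \<cdot> (?s \<cdot> ?s) \<cdot> \<iota>\<^sub>1 = idm H" "\<pi>\<^sub>1 \<cdot> (?s \<cdot> ?s) \<cdot> \<iota>\<^sub>2 = zer K H"
    "\<pi>\<^sub>2 \<cdot> (?s \<cdot> ?s) \<cdot> \<iota>\<^sub>1 = zer H K" "\<pi>\<^sub>2 \<cdot> (?s \<cdot> ?s) \<cdot> \<iota>\<^sub>2 = idm K"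
    unfolding matrix_product[OF SH SH] E
    using complementaryD(3)[OF complementary_sym[OF g]]
    by (simp_all add: pi qj f'(3) g'(3) F(3) z1 z2 z3 z4)
  have "?s \<cdot> ?s = idm HK" using diagonal_matrix[OF SS e(2,3)] unfolding e by (simp add: Ten_Idn)
  then have "mutually_inverse C ?s ?s" by (simp add: mutually_inverse_iff)
  then have "?s \<in> hopf_Aut C HK" using SH by (auto simp: hopf_Aut_def hopf_Iso_def)
  then show ?thesis using i p f'(1) E(1)
    by (intro exI[of _ i] exI[of _ p] exI[of _ f] exI[of _ ?s]) simp
qed

text \<open>If the swap comes from a matrix with automorphisms on the diagonal, its entry
  \<open>f\<close> can be cancelled in \<open>f i = 0\<close>, so \<open>i = 0\<close> although
  \<open>p i = 1\<close>.\<close>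

lemma common_factor_obstruction:
  assumes A: "common_tensor_factor C A H K"
    and incl: "hopf_Aut C HK \<subseteq> matrix_morphism C H K ` matrix_set C H K"
  shows "trivial_hopf C A"
proof -
  obtain i p f s where [simp]: "is_hopf_algebra C A" and i: "i \<in> Hom A H"
      and p: "p \<in> Hom H A" "p \<cdot> i = idm A"
    and fi: "f \<cdot> i = zer A H" and s: "s \<in> hopf_Aut C HK" "\<pi>\<^sub>1 \<cdot> s \<cdot> \<iota>\<^sub>1 = f"
    using common_factor_swap[OF A] by blast
  obtain a b c d where "s = matrix_morphism C H K (a, b, c, d)"
      and abcd: "a \<in> hopf_Aut C H" "b \<in> hopf_Hom_c C K H" "c \<in> hopf_Hom_c C H K" "d \<in> hopf_Aut C K"
    using s(1) incl unfolding matrix_set_def by blast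
  then have "f = a" using s(2) matrix_morphism_entries(1)[OF matrix_set_compatible[OF abcd]] by simp
  then obtain x where x: "f \<in> Hom H H" "x \<in> Hom H H" "x \<cdot> f = idm H" using hopf_AutD[OF abcd(1)] by blast
  note [simp] = Hom_typing[OF i] Hom_typing[OF p(1)] Hom_typing[OF x(1)] Hom_typing[OF x(2)]
  have "f \<cdot> i = f \<cdot> zer A H" unfolding fi by (rule alg_hom_zer[OF HomD(1)[OF x(1)], symmetric]) simp_all
  then have "i = zer A H" by (rule Cmp_cancel_left[OF x(3)]) simp_all
  then show ?thesis by (intro trivial_from_zer[OF _ _ p(2,1)]) simp_all
qed

end

theorem theorem8p1:
  fixes C :: "('o, 'm) braided_cat"
    and H K :: "('o, 'm) hopf"
  assumes "abelian_braided_category C"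
    and "is_hopf_algebra C H" and "is_hopf_algebra C K"
    and "unbraided C (Car H) (Car K)"
    and "is_isomorphism C (Ant H)" and "is_isomorphism C (Ant K)"
    and "both_chain_conditions C H" and "both_chain_conditions C K"
  shows "(matrix_morphism C H K ` matrix_set C H K \<subseteq> hopf_Aut C (tensor_hopf C H K) \<longleftrightarrow>
            \<not> (\<exists>A. common_tensor_factor C A H K \<and> abelian_hopf C A \<and> \<not> trivial_hopf C A)) \<and>
         (hopf_Aut C (tensor_hopf C H K) = matrix_morphism C H K ` matrix_set C H K \<longleftrightarrow>
            \<not> (\<exists>A. common_tensor_factor C A H K \<and> \<not> trivial_hopf C A))"
proof -
  interpret hopf_pair C H K
    using assms by (simp add: hopf_pair_def hopf_pair_axioms_def)
  have "matrix_morphism C H K ` matrix_set C H K \<subseteq> hopf_Aut C (tensor_hopf C H K) \<longleftrightarrow>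
      \<not> (\<exists>A. common_tensor_factor C A H K \<and> abelian_hopf C A \<and> \<not> trivial_hopf C A)"
    using abelian_factor_obstruction matrix_set_isomorphism[OF _ assms(7,8)] by blast
  \<comment> \<open>Only one inclusion is compared here. The other follows from the first
    equivalence, as the absence of nontrivial common factors includes that of abelian ones.\<close>
  moreover have "hopf_Aut C (tensor_hopf C H K) \<subseteq> matrix_morphism C H K ` matrix_set C H K \<longleftrightarrow>
      \<not> (\<exists>A. common_tensor_factor C A H K \<and> \<not> trivial_hopf C A)"
    using common_factor_obstruction automorphism_matrix[OF _ assms(7,8)] by blast
  ultimately show ?thesis by blast
qed

end
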